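(* Let $G=\{G(x),x\in\mathbb{R}\}$ be a real-valued continuous Gaussian process with mean zero and stationary increments, and let $\sigma^2(h)=E(G(x+h)-G(x))^2$. Assume that $\sigma^2(h)$ is concave and monotonically increasing for $h\in[0,\delta]$, for some $\delta>0$, with $\sigma(h)>0$ for $h\in(0,\delta]$. Let $1\le p<\infty$ and set $h_n=1/(\log n)^q$, $n\ge2$, where $q>p$. If $$\lim_{n\to\infty}\frac{\sigma(h_n-h_{n+1})}{\sigma(h_{n+1})}=0,$$ then, almost surely, $$\lim_{h\to0}\int_a^b\left|\frac{G(x+h)-G(x)}{\sigma(h)}\right|^p dx=E|\eta|^p\,(b-a)$$ for all real $a<b$.
   Context: $\sigma$ denotes the nonnegative square root of $\sigma^2$ (by stationarity of increments $\sigma^2(h)$ does not depend on $x$). $\eta$ is a normal random variable with mean zero and variance one. "Continuous" means that $G$ has continuous sample paths almost surely. *)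

theory Defs
  imports "HOL-Probability.Probability"
begin

(* Degenerate (constant) normal variables are included, as is needed for Gaussian vectors with
   singular covariance; normal_density m s is the density of N(m, s^2). *)
definition gaussian_rv :: "'a measure \<Rightarrow> ('a \<Rightarrow> real) \<Rightarrow> bool" where
  "gaussian_rv M X \<longleftrightarrow> X \<in> borel_measurable M \<and>
     ((\<exists>m s. 0 < s \<and> distributed M lborel X (normal_density m s)) \<or>
      (\<exists>m. AE \<omega> in M. X \<omega> = m))"

(* Joint normality of all finite families, in the form: every finite linear combination is normal. *)
definition gaussian_process :: "'a measure \<Rightarrow> (real \<Rightarrow> 'a \<Rightarrow> real) \<Rightarrow> bool" where
  "gaussian_process M G \<longleftrightarrow> (\<forall>I c. finite I \<longrightarrow> gaussian_rv M (\<lambda>\<omega>. \<Sum>x\<in>I. c x * G x \<omega>))"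

definition mean_zero :: "'a measure \<Rightarrow> (real \<Rightarrow> 'a \<Rightarrow> real) \<Rightarrow> bool" where
  "mean_zero M G \<longleftrightarrow> (\<forall>x. integrable M (G x) \<and> (\<integral>\<omega>. G x \<omega> \<partial>M) = 0)"

definition continuous_paths :: "'a measure \<Rightarrow> (real \<Rightarrow> 'a \<Rightarrow> real) \<Rightarrow> bool" where
  "continuous_paths M G \<longleftrightarrow> (AE \<omega> in M. continuous_on UNIV (\<lambda>x. G x \<omega>))"

(* The finite-dimensional distributions of the process x |-> G(s + x) - G(s) do not depend on s. *)
definition stationary_increments :: "'a measure \<Rightarrow> (real \<Rightarrow> 'a \<Rightarrow> real) \<Rightarrow> bool" where
  "stationary_increments M G \<longleftrightarrow>
     (\<forall>s t I. finite I \<longrightarrow>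
        distr M (Pi\<^sub>M I (\<lambda>_. borel)) (\<lambda>\<omega>. \<lambda>x\<in>I. G (s + x) \<omega> - G s \<omega>) =
        distr M (Pi\<^sub>M I (\<lambda>_. borel)) (\<lambda>\<omega>. \<lambda>x\<in>I. G (t + x) \<omega> - G t \<omega>))"

(* The base point 0 is immaterial under stationary increments: see incr_var_eq. *)
definition incr_var :: "'a measure \<Rightarrow> (real \<Rightarrow> 'a \<Rightarrow> real) \<Rightarrow> real \<Rightarrow> real" where
  "incr_var M G h = (\<integral>\<omega>. (G (0 + h) \<omega> - G 0 \<omega>)\<^sup>2 \<partial>M)"

definition incr_sd :: "'a measure \<Rightarrow> (real \<Rightarrow> 'a \<Rightarrow> real) \<Rightarrow> real \<Rightarrow> real" where
  "incr_sd M G h = sqrt (incr_var M G h)"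

lemma gaussian_process_measurable:
  assumes "gaussian_process M G"
  shows "G x \<in> borel_measurable M"
  using assms[unfolded gaussian_process_def, rule_format, of "{x}" "\<lambda>_. 1"]
  by (simp add: gaussian_rv_def)

lemma incr_var_eq:
  assumes "gaussian_process M G" and "stationary_increments M G"
  shows "(\<integral>\<omega>. (G (x + h) \<omega> - G x \<omega>)\<^sup>2 \<partial>M) = incr_var M G h"
proof -
  have G: "G y \<in> borel_measurable M" for y
    using assms(1) by (rule gaussian_process_measurable)
  define P :: "(real \<Rightarrow> real) measure" where "P = Pi\<^sub>M {h} (\<lambda>_. borel)"
  define D where "D s = distr M P (\<lambda>\<omega>. \<lambda>y\<in>{h}. G (s + y) \<omega> - G s \<omega>)" for s
  have eval: "(\<lambda>f. (f h)\<^sup>2) \<in> borel_measurable P"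
    unfolding P_def by (intro borel_measurable_power measurable_component_singleton) simp
  have incr: "(\<lambda>\<omega>. \<lambda>y\<in>{h}. G (s + y) \<omega> - G s \<omega>) \<in> measurable M P" for s
    unfolding P_def by (intro measurable_restrict borel_measurable_diff G)
  have int: "(\<integral>f. (f h)\<^sup>2 \<partial>D s) = (\<integral>\<omega>. (G (s + h) \<omega> - G s \<omega>)\<^sup>2 \<partial>M)" for s
    unfolding D_def integral_distr[OF incr eval] by simp
  have "D x = D 0"
    unfolding D_def P_def
    using assms(2)[unfolded stationary_increments_def, rule_format, of "{h}" x 0] by simp
  then show ?thesis
    unfolding incr_var_def int[symmetric] by (rule arg_cong)
qed

end

theory Submission
  imports Defs
begin

text \<open>
Fix a small step \<open>h\<close> and write \<open>Y\<^sub>x\<close> for the increment over \<open>[x, x + h]\<close> divided by its standard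
deviation. The \<open>Y\<^sub>x\<close> are standard normal, so the integral \<open>I(h)\<close> of \<open>|Y\<^sub>x|\<close> to the power \<open>p\<close> over
\<open>[a, b]\<close> has mean \<open>(b - a) E|\<eta>|\<^sup>p\<close>, and the theorem says that \<open>I(h)\<close> concentrates at its mean. There are
three ingredients.

\<^item> Weak dependence. For points at distance between \<open>h\<close> and \<open>\<delta> - h\<close> the covariances of the \<open>Y\<^sub>x\<close> are second
differences of the concave function \<open>\<sigma>\<^sup>2\<close>. They all have the same sign, so on a lattice of length
at most \<open>\<delta>\<close> with spacing at least \<open>h\<close> their sum telescopes and the row sums of the covariance matrix outside the diagonal are at most
1 (\<open>covariance_row_sum_le\<close>). A colouring argument (\<open>balanced_colouring\<close>) splits the lattice into \<open>R\<close>
classes inside which these row sums are at most \<open>1 / R\<close>: every class is a nearly standard Gaussian vector.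

\<^item> Comparison with independent variables. If the row sums outside the diagonal are at most \<open>e\<close>, then by
diagonal dominance the vector is an independent sum of \<open>sqrt (1 - e)\<close> times a standard vector and of
another Gaussian vector; and adding a suitable independent Gaussian vector to it gives \<open>sqrt (1 + e)\<close>
times a standard vector. The first decomposition bounds products of even functions that decrease in the
absolute value (\<open>expectation_prod_le\<close>), hence the lower tail; the second bounds exponentials of convex
functions (\<open>expectation_exp_convex_le\<close>), hence the upper tail. Both exponential bounds pass from the
classes to the lattice, and from the lattice to the integral, by convexity of the exponential function
(\<open>path_exponential_bound\<close>). For the upper tail the \<open>p\<close>-th power is replaced beyond a level \<open>T\<close> by its
tangent line, which keeps it convex and gives it exponential moments; the error has expectation of order
\<open>exp (- T\<^sup>2 / 8)\<close>. With \<open>T\<^sup>2 = h powr (- 1 / p)\<close> and \<open>h = h\<^sub>n\<close> all the resulting probabilities are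
\<open>exp (- \<kappa> (ln n) powr r)\<close> with \<open>r > 1\<close>, and this is where \<open>q > p\<close> is used. The Borel-Cantelli lemma gives
convergence along \<open>h\<^sub>n\<close> (\<open>rational_windows_convergence\<close>).

\<^item> Interpolation. A step \<open>h\<close> between \<open>h\<^sub>n\<^sub>+\<^sub>1\<close> and \<open>h\<^sub>n\<close> is \<open>h\<^sub>n\<^sub>+\<^sub>1 + r\<close> with \<open>r \<le> h\<^sub>n - h\<^sub>n\<^sub>+\<^sub>1\<close>, so the
increment over \<open>h\<close> differs from the one over \<open>h\<^sub>n\<^sub>+\<^sub>1\<close> by an increment over \<open>r\<close>. Expanding \<open>r\<close> greedily
along the same sequence, the standard deviations at least halve at every stage, because
\<open>\<sigma>(h\<^sub>n - h\<^sub>n\<^sub>+\<^sub>1) / \<sigma>(h\<^sub>n\<^sub>+\<^sub>1)\<close> tends to 0; so the \<open>L\<^sup>p\<close> norm of the increment over \<open>r\<close> is at most a constant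
times \<open>\<sigma>(r)\<close> (\<open>chaining\<close>), which is negligible against \<open>\<sigma>(h\<^sub>n\<^sub>+\<^sub>1)\<close>. This part is about a single
continuous path.
\<close>

section \<open>Laws of random vectors are determined by their characteristic functions\<close>

text \<open>Levy's uniqueness theorem for the images of the finite measures with densities \<open>W1\<close> and \<open>W2\<close>: after
division by the common total mass these are probability distributions. Real trigonometric integrals
are used in place of complex ones because the weights met below are real trigonometric polynomials.\<close>

lemma weighted_levy_uniqueness:
  fixes M1 M2 :: "'a measure"
  assumes "prob_space M1" "prob_space M2"
    and [measurable]: "X1 \<in> borel_measurable M1" "X2 \<in> borel_measurable M2"
      "W1 \<in> borel_measurable M1" "W2 \<in> borel_measurable M2"
    and W1: "\<And>x. 0 \<le> W1 x" "\<And>x. W1 x \<le> B" and W2: "\<And>x. 0 \<le> W2 x" "\<And>x. W2 x \<le> B"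
    and eqc: "\<And>t. (\<integral>x. W1 x * cos (t * X1 x) \<partial>M1) = (\<integral>x. W2 x * cos (t * X2 x) \<partial>M2)"
    and eqs: "\<And>t. (\<integral>x. W1 x * sin (t * X1 x) \<partial>M1) = (\<integral>x. W2 x * sin (t * X2 x) \<partial>M2)"
    and [measurable]: "g \<in> borel_measurable borel"
  shows "(\<integral>x. W1 x * g (X1 x) \<partial>M1) = (\<integral>x. W2 x * (g (X2 x) :: real) \<partial>M2)"
proof -
  interpret M1: prob_space M1 by fact
  interpret M2: prob_space M2 by fact
  define m where "m = (\<integral>x. W1 x \<partial>M1)"
  have m2: "m = (\<integral>x. W2 x \<partial>M2)" using eqc[of 0] by (simp add: m_def)
  have iW: "integrable M1 W1" "integrable M2 W2"
    using W1 W2 by (auto intro!: M1.integrable_const_bound[of _ B] M2.integrable_const_bound[of _ B])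
  have m0: "0 \<le> m" unfolding m_def using W1 by simp
  show ?thesis
  proof (cases "m = 0")
    case True
    have "AE x in M1. W1 x = 0" "AE x in M2. W2 x = 0"
      using True m2 iW W1 W2 integral_nonneg_eq_0_iff_AE[of M1 W1] integral_nonneg_eq_0_iff_AE[of M2 W2]
      by (auto simp: m_def)
    then have "(\<integral>x. W1 x * g (X1 x) \<partial>M1) = 0" "(\<integral>x. W2 x * g (X2 x) \<partial>M2) = 0"
      by (auto intro!: integral_eq_zero_AE)
    then show ?thesis by simp
  next
    case False
    then have mp: "m > 0" using m0 by simp
    define D1 where "D1 = distr (density M1 (\<lambda>x. W1 x / m)) borel X1"
    define D2 where "D2 = distr (density M2 (\<lambda>x. W2 x / m)) borel X2"
    have p1: "prob_space (density M1 (\<lambda>x. W1 x / m))"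
      using W1 mp iW by (intro prob_spaceI) (simp add: emeasure_density nn_integral_eq_integral m_def)
    have p2: "prob_space (density M2 (\<lambda>x. W2 x / m))"
      using W2 mp iW by (intro prob_spaceI) (simp add: emeasure_density nn_integral_eq_integral m2)
    have [simp]: "sets D1 = sets borel" "sets D2 = sets borel" by (auto simp: D1_def D2_def)
    have r1: "real_distribution D1" unfolding D1_def
      by (intro prob_space.real_distribution_distr p1) simp
    have r2: "real_distribution D2" unfolding D2_def
      by (intro prob_space.real_distribution_distr p2) simp
    have I1: "(\<integral>x. f x \<partial>D1) = (\<integral>x. W1 x * f (X1 x) \<partial>M1) / m" if [measurable]: "f \<in> borel_measurable borel" for f :: "real \<Rightarrow> real"
      unfolding D1_def using W1 mp by (subst integral_distr, simp, simp) (subst integral_density, auto)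
    have I2: "(\<integral>x. f x \<partial>D2) = (\<integral>x. W2 x * f (X2 x) \<partial>M2) / m" if [measurable]: "f \<in> borel_measurable borel" for f :: "real \<Rightarrow> real"
      unfolding D2_def using W2 mp by (subst integral_distr, simp, simp) (subst integral_density, auto)
    have ch: "char D t = complex_of_real (\<integral>x. cos (t * x) \<partial>D) + \<i> * complex_of_real (\<integral>x. sin (t * x) \<partial>D)"
      if "real_distribution D" for D t
    proof -
      interpret real_distribution D by fact
      have i: "integrable D (\<lambda>x. iexp (t * x))" by (intro integrable_iexp) auto
      show ?thesis
        using integral_Re[OF i] integral_Im[OF i]
        by (intro complex_eqI) (simp_all add: char_def Re_exp Im_exp)
    qed
    have "char D1 = char D2"
      using eqc eqs by (intro ext) (simp add: ch[OF r1] ch[OF r2] I1 I2)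
    then have "D1 = D2" using Levy_uniqueness[OF r1 r2] by simp
    then show ?thesis using I1[of g] I2[of g] mp by simp
  qed
qed

text \<open>One coordinate after the other, trigonometric factors are traded for indicators of Borel sets. The
one-dimensional theorem needs nonnegative weights, and a cosine is not one; but \<open>1 + cos\<close> is, and
products of cosines are again sums of cosines, so the induction hypothesis covers the characteristic
function of the next coordinate under such a weight. Once all coordinates carry indicators, the two
measures agree on boxes.\<close>

lemma cos_char_eq_imp_law_eq:
  fixes \<mu> \<nu> :: "('i \<Rightarrow> real) measure"
  assumes "prob_space \<mu>" "prob_space \<nu>" and J: "finite J"
    and s[measurable_cong]: "sets \<mu> = sets (Pi\<^sub>M J (\<lambda>_. borel))" "sets \<nu> = sets (Pi\<^sub>M J (\<lambda>_. borel))"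
    and eq: "\<And>c \<beta>. (\<integral>x. cos (\<beta> + (\<Sum>j\<in>J. c j * x j)) \<partial>\<mu>) = (\<integral>x. cos (\<beta> + (\<Sum>j\<in>J. c j * x j)) \<partial>\<nu>)"
  shows "\<mu> = \<nu>"
proof -
  interpret \<mu>: prob_space \<mu> by fact
  interpret \<nu>: prob_space \<nu> by fact
  have boxes: "(\<integral>x. (\<Prod>j\<in>A. indicator (S j) (x j)) * cos (\<beta> + (\<Sum>j\<in>J. c j * x j)) \<partial>\<mu>) =
      (\<integral>x. (\<Prod>j\<in>A. indicator (S j) (x j)) * cos (\<beta> + (\<Sum>j\<in>J. c j * x j)) \<partial>\<nu>)"
    if "finite A" "A \<subseteq> J" and S: "\<And>j. S j \<in> sets borel" for A c \<beta> and S :: "'i \<Rightarrow> real set"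
    using that(1,2)
  proof (induction A arbitrary: c \<beta> rule: finite_induct)
    case empty
    then show ?case using eq by simp
  next
    case (insert k A)
    have k: "k \<in> J" and AJ: "\<And>j. j \<in> A \<Longrightarrow> j \<in> J" using insert by auto
    define P where "P x = (\<Prod>j\<in>A. indicator (S j) (x j) :: real)" for x :: "'i \<Rightarrow> real"
    define L where "L c x = (\<Sum>j\<in>J. c j * x j)" for c x :: "'i \<Rightarrow> real"
    have [measurable]: "S j \<in> sets borel" for j using S .
    have [measurable]: "(\<lambda>x. x k) \<in> borel_measurable \<mu>" "(\<lambda>x. x k) \<in> borel_measurable \<nu>"
      using k by measurable
    have Lm: "L c \<in> borel_measurable (Pi\<^sub>M J (\<lambda>_. borel))" for c
      unfolding L_def[abs_def] by (intro borel_measurable_sum borel_measurable_times borel_measurable_const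
          measurable_component_singleton)
    then have [measurable]: "L c \<in> borel_measurable \<mu>" "L c \<in> borel_measurable \<nu>" for c
      by (simp_all cong: measurable_cong_sets add: s)
    have "P \<in> borel_measurable (Pi\<^sub>M J (\<lambda>_. borel))"
      unfolding P_def[abs_def] by (intro borel_measurable_prod borel_measurable_indicator
          measurable_compose[OF measurable_component_singleton] AJ) (auto simp: S)
    then have [measurable]: "P \<in> borel_measurable \<mu>" "P \<in> borel_measurable \<nu>"
      by (simp_all cong: measurable_cong_sets add: s)
    have P01: "0 \<le> P x" "P x \<le> 1" for x
      unfolding P_def by (auto intro!: prod_nonneg prod_le_1)
    have IH: "(\<integral>x. P x * cos (\<beta> + L c x) \<partial>\<mu>) = (\<integral>x. P x * cos (\<beta> + L c x) \<partial>\<nu>)" for c \<beta>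
      using insert unfolding P_def L_def by auto
    have bd: "\<bar>P x * cos y\<bar> \<le> 1" for x y
      using P01[of x] abs_cos_le_one[of y] by (auto simp: abs_mult intro: mult_le_one)
    have ipc: "integrable \<mu> (\<lambda>x. P x * cos (\<beta> + L c x))" "integrable \<nu> (\<lambda>x. P x * cos (\<beta> + L c x))" for \<beta> c
      using bd by (auto intro!: \<mu>.integrable_const_bound[of _ 1] \<nu>.integrable_const_bound[of _ 1])
    have Lk: "L (c(k := c k + t)) x = L c x + t * x k" for c t x
    proof -
      have "L (c(k := c k + t)) x = (\<Sum>j\<in>J. c j * x j + (if j = k then t * x j else 0))"
        unfolding L_def by (intro sum.cong) (auto simp: algebra_simps)
      then show ?thesis using J k by (simp add: sum.distrib sum.delta L_def)
    qed
    have L0: "L (\<lambda>_. 0) x = 0" for x by (simp add: L_def)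
    \<comment> \<open>The coordinate \<open>k\<close> under the nonnegative weight \<open>P * (1 + cos (\<beta> + L c))\<close>.\<close>
    have key: "(\<integral>x. (P x * (1 + cos (\<beta> + L c x))) * indicator (S k) (x k) \<partial>\<mu>) =
      (\<integral>x. (P x * (1 + cos (\<beta> + L c x))) * indicator (S k) (x k) \<partial>\<nu>)" for \<beta> c
    proof -
      have expand: "P x * (1 + cos (\<beta> + L c x)) * cos (\<gamma> + t * x k) =
           P x * cos (\<gamma> + L ((\<lambda>_. 0)(k := 0 + t)) x) + (1/2) * (P x * cos (\<beta> - \<gamma> + L (c(k := c k + (-t))) x)) +
           (1/2) * (P x * cos (\<beta> + \<gamma> + L (c(k := c k + t)) x))" for x \<gamma> t
      proof -
        have "cos (\<beta> + L c x) * cos (\<gamma> + t * x k) = (cos ((\<beta> + L c x) - (\<gamma> + t * x k)) + cos ((\<beta> + L c x) + (\<gamma> + t * x k))) / 2"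
          by (rule cos_times_cos)
        also have "\<dots> = (cos (\<beta> - \<gamma> + L (c(k := c k + (-t))) x) + cos (\<beta> + \<gamma> + L (c(k := c k + t)) x)) / 2"
          unfolding Lk by (simp add: algebra_simps)
        finally have e: "cos (\<beta> + L c x) * cos (\<gamma> + t * x k) = \<dots>" .
        have e2: "cos (\<gamma> + L ((\<lambda>_. 0)(k := 0 + t)) x) = cos (\<gamma> + t * x k)"
          using Lk[of "\<lambda>_. 0" t x] by (simp add: L0)
        have "P x * (1 + cos (\<beta> + L c x)) * cos (\<gamma> + t * x k) = P x * cos (\<gamma> + t * x k) + P x * (cos (\<beta> + L c x) * cos (\<gamma> + t * x k))"
          by (simp add: algebra_simps)
        then show ?thesis unfolding e e2 by (simp add: algebra_simps add_divide_distrib)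
      qed
      have c1: "(\<integral>x. P x * (1 + cos (\<beta> + L c x)) * cos (\<gamma> + t * x k) \<partial>\<mu>) =
             (\<integral>x. P x * (1 + cos (\<beta> + L c x)) * cos (\<gamma> + t * x k) \<partial>\<nu>)" for \<gamma> t
        unfolding expand using IH ipc by simp
      show ?thesis
      proof (rule weighted_levy_uniqueness[where B=2 and ?X1.0="\<lambda>x. x k" and ?X2.0="\<lambda>x. x k"
            and ?W1.0="\<lambda>x. P x * (1 + cos (\<beta> + L c x))" and ?W2.0="\<lambda>x. P x * (1 + cos (\<beta> + L c x))"
            and g="indicator (S k)"])
        show "(\<integral>x. P x * (1 + cos (\<beta> + L c x)) * cos (t * x k) \<partial>\<mu>) =
             (\<integral>x. P x * (1 + cos (\<beta> + L c x)) * cos (t * x k) \<partial>\<nu>)" for t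
          using c1[of 0 t] by simp
        have "cos (- (pi/2) + y) = sin y" for y :: real by (simp add: cos_diff)
        then show "(\<integral>x. P x * (1 + cos (\<beta> + L c x)) * sin (t * x k) \<partial>\<mu>) =
             (\<integral>x. P x * (1 + cos (\<beta> + L c x)) * sin (t * x k) \<partial>\<nu>)" for t
          using c1[of "-(pi/2)" t] by simp
        have c0: "0 \<le> 1 + cos y" "1 + cos y \<le> 2" for y :: real
          using cos_ge_minus_one[of y] cos_le_one[of y] by linarith+
        show "0 \<le> P x * (1 + cos (\<beta> + L c x))" "0 \<le> P x * (1 + cos (\<beta> + L c x))"
            "P x * (1 + cos (\<beta> + L c x)) \<le> 2" "P x * (1 + cos (\<beta> + L c x)) \<le> 2" for x
          using P01[of x] c0[of "\<beta> + L c x"] mult_mono[of "P x" 1 "1 + cos (\<beta> + L c x)" 2] by auto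
      qed (auto intro: \<mu>.prob_space_axioms \<nu>.prob_space_axioms)
    qed
    have bd2: "\<bar>P x * cos y * indicator (S k) (x k)\<bar> \<le> 1" "\<bar>P x * indicator (S k) (x k)\<bar> \<le> 1" for x y
      using bd[of x y] P01[of x] by (auto simp: indicator_def)
    have i1: "integrable \<mu> (\<lambda>x. P x * cos (\<beta> + L c x) * indicator (S k) (x k))"
       "integrable \<nu> (\<lambda>x. P x * cos (\<beta> + L c x) * indicator (S k) (x k))"
       "integrable \<mu> (\<lambda>x. P x * indicator (S k) (x k))" "integrable \<nu> (\<lambda>x. P x * indicator (S k) (x k))"
      using bd2 by (auto intro!: \<mu>.integrable_const_bound[of _ 1] \<nu>.integrable_const_bound[of _ 1])
    \<comment> \<open>The weight with \<open>cos (pi / 2) = 0\<close> is \<open>P\<close> itself; subtracting it leaves the pure cosine.\<close>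
    have e0: "(\<integral>x. P x * indicator (S k) (x k) \<partial>\<mu>) = (\<integral>x. P x * indicator (S k) (x k) \<partial>\<nu>)"
      using key[of "pi/2" "\<lambda>_. 0"] by (simp add: L0)
    have "(\<integral>x. P x * cos (\<beta> + L c x) * indicator (S k) (x k) \<partial>\<mu>) = (\<integral>x. P x * cos (\<beta> + L c x) * indicator (S k) (x k) \<partial>\<nu>)"
      using key[of \<beta> c] e0 i1 by (simp add: algebra_simps)
    then show ?case using insert(1,2) by (simp add: P_def L_def mult_ac)
  qed
  show ?thesis
  proof (rule measure_eqI_PiM_finite[OF J s])
    fix A :: "'i \<Rightarrow> real set" assume A: "\<And>i. i \<in> J \<Longrightarrow> A i \<in> sets borel"
    define S where "S j = (if j \<in> J then A j else {})" for j
    have bs: "Pi\<^sub>E J A \<in> sets (Pi\<^sub>M J (\<lambda>_. borel))" using A J by (intro sets_PiM_I_finite) auto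
    have ind: "(\<Prod>j\<in>J. indicator (S j) (x j)) = (indicator (Pi\<^sub>E J A) x :: real)"
      if "x \<in> space (Pi\<^sub>M J (\<lambda>_. borel :: real measure))" for x
      using that J by (auto simp: S_def indicator_def space_PiM PiE_iff prod_zero_iff split: if_splits)
    have "(\<integral>x. (indicator (Pi\<^sub>E J A) x :: real) \<partial>\<mu>) = (\<integral>x. (\<Prod>j\<in>J. indicator (S j) (x j)) \<partial>\<mu>)"
      by (intro Bochner_Integration.integral_cong refl ind[symmetric]) (simp add: sets_eq_imp_space_eq[OF s(1)])
    also have "\<dots> = (\<integral>x. (\<Prod>j\<in>J. indicator (S j) (x j)) \<partial>\<nu>)"
      using boxes[OF J subset_refl, of S 0 "\<lambda>_. 0"] A by (auto simp: S_def)
    also have "\<dots> = (\<integral>x. indicator (Pi\<^sub>E J A) x \<partial>\<nu>)"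
      by (intro Bochner_Integration.integral_cong refl ind) (simp add: sets_eq_imp_space_eq[OF s(2)])
    finally show "emeasure \<mu> (Pi\<^sub>E J A) = emeasure \<nu> (Pi\<^sub>E J A)"
      using bs s by (simp add: \<mu>.emeasure_eq_measure \<nu>.emeasure_eq_measure)
  next
    show "range (\<lambda>_::nat. Pi\<^sub>E J (\<lambda>_. UNIV)) \<subseteq> prod_algebra J (\<lambda>_. borel :: real measure)"
      using J by (auto intro!: prod_algebraI_finite)
    show "(\<Union>i::nat. Pi\<^sub>E J (\<lambda>_. UNIV)) = space (Pi\<^sub>M J (\<lambda>_. borel :: real measure))"
      by (simp add: space_PiM)
    show "emeasure \<mu> (Pi\<^sub>E J (\<lambda>_. UNIV)) \<noteq> \<infinity>" by simp
  qed
qed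

section \<open>Centred Gaussian variables and standard normal vectors\<close>

lemma integral_std_normal_cos:
  "(\<integral>x. cos (\<beta> + t * x) \<partial>std_normal_distribution) = cos \<beta> * exp (- t\<^sup>2 / 2)"
proof -
  interpret real_distribution std_normal_distribution by (rule real_dist_normal_dist)
  have i: "integrable std_normal_distribution (\<lambda>x. iexp (t * x))" by (intro integrable_iexp) auto
  have ch: "(CLINT x|std_normal_distribution. iexp (t * x)) = complex_of_real (exp (- t\<^sup>2 / 2))"
    using fun_cong[OF char_std_normal_distribution, of t] unfolding char_def .
  have "(CLINT x|std_normal_distribution. iexp \<beta> * iexp (t * x)) = iexp \<beta> * complex_of_real (exp (- t\<^sup>2 / 2))"
    unfolding ch[symmetric] by (rule integral_mult_right_zero)
  moreover have "integrable std_normal_distribution (\<lambda>x. iexp \<beta> * iexp (t * x))"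
    using i by simp
  moreover have "Re (iexp \<beta> * iexp (t * x)) = cos (\<beta> + t * x)" for x
    by (simp add: Re_exp Im_exp cos_add)
  ultimately have "(\<integral>x. cos (\<beta> + t * x) \<partial>std_normal_distribution) = Re (iexp \<beta> * complex_of_real (exp (- t\<^sup>2 / 2)))"
    using integral_Re[of std_normal_distribution "\<lambda>x. iexp \<beta> * iexp (t * x)"] by (metis (no_types, lifting) Bochner_Integration.integral_cong)
  then show ?thesis by (simp add: Re_exp)
qed

lemma distributed_normal_eq_affine_std:
  assumes "prob_space M" "0 < s" "distributed M lborel X (normal_density m s)"
  shows "distr M borel (\<lambda>\<omega>. (X \<omega> - m) / s) = std_normal_distribution"
proof -
  interpret prob_space M by fact
  have "distributed M lborel (\<lambda>\<omega>. (X \<omega> - m) / s) std_normal_density"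
    using assms(3) unfolding normal_standard_normal_convert[OF assms(2)] .
  then have "distr M lborel (\<lambda>\<omega>. (X \<omega> - m) / s) = std_normal_distribution"
    by (rule distributed_distr_eq_density)
  moreover have "distr M borel (\<lambda>\<omega>. (X \<omega> - m) / s) = distr M lborel (\<lambda>\<omega>. (X \<omega> - m) / s)"
    by (rule distr_cong) simp_all
  ultimately show ?thesis by simp
qed

text \<open>The constant case of \<^const>\<open>gaussian_rv\<close> has to be the constant 0 here, and then all
formulas hold with variance 0; no case distinction remains for later use.\<close>

lemma centered_gaussian:
  assumes "prob_space M" and X: "gaussian_rv M X" and "integrable M X" and "(\<integral>\<omega>. X \<omega> \<partial>M) = 0"
  shows "integrable M (\<lambda>\<omega>. (X \<omega>)\<^sup>2)"
    and "(\<integral>\<omega>. cos (\<beta> + t * X \<omega>) \<partial>M) = cos \<beta> * exp (- t\<^sup>2 * (\<integral>\<omega>. (X \<omega>)\<^sup>2 \<partial>M) / 2)"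
    and "(\<integral>\<omega>. (X \<omega>)\<^sup>2 \<partial>M) = 1 \<Longrightarrow> distr M borel X = std_normal_distribution"
proof -
  interpret prob_space M by fact
  have [measurable]: "X \<in> borel_measurable M" using X by (simp add: gaussian_rv_def)
  consider (n) m s where "0 < s" "distributed M lborel X (normal_density m s)" | (c) m where "AE \<omega> in M. X \<omega> = m"
    using X unfolding gaussian_rv_def by blast
  then have "integrable M (\<lambda>\<omega>. (X \<omega>)\<^sup>2) \<and> (\<integral>\<omega>. cos (\<beta> + t * X \<omega>) \<partial>M) = cos \<beta> * exp (- t\<^sup>2 * (\<integral>\<omega>. (X \<omega>)\<^sup>2 \<partial>M) / 2)
     \<and> ((\<integral>\<omega>. (X \<omega>)\<^sup>2 \<partial>M) = 1 \<longrightarrow> distr M borel X = std_normal_distribution)"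
  proof cases
    case n
    have m: "m = 0" using normal_distributed_expectation[OF n] assms(4) by simp
    define Z where "Z \<omega> = X \<omega> / s" for \<omega>
    have XZ: "X = (\<lambda>\<omega>. s * Z \<omega>)" using n by (auto simp: Z_def)
    have [measurable]: "Z \<in> borel_measurable M" unfolding Z_def[abs_def] by measurable
    have d: "distr M borel Z = std_normal_distribution"
      using distributed_normal_eq_affine_std[OF prob_space_axioms n] by (simp add: m Z_def[abs_def])
    have i2: "integrable (distr M borel Z) (\<lambda>x. x\<^sup>2)"
      unfolding d by (rule integrable_std_normal_distribution_moment)
    have e2: "(\<integral>x. x\<^sup>2 \<partial>distr M borel Z) = 1"
      unfolding d using std_normal_distribution_even_moments(1)[of 1] by simp
    have iZ: "integrable M (\<lambda>\<omega>. (Z \<omega>)\<^sup>2)" and eZ: "(\<integral>\<omega>. (Z \<omega>)\<^sup>2 \<partial>M) = 1"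
      using i2 e2 by (simp_all add: integrable_distr_eq integral_distr)
    have "(\<integral>\<omega>. cos (\<beta> + (t * s) * Z \<omega>) \<partial>M) = (\<integral>x. cos (\<beta> + (t * s) * x) \<partial>distr M borel Z)"
      by (simp add: integral_distr)
    also have "\<dots> = cos \<beta> * exp (- (t * s)\<^sup>2 / 2)" unfolding d by (rule integral_std_normal_cos)
    finally have c: "(\<integral>\<omega>. cos (\<beta> + t * X \<omega>) \<partial>M) = cos \<beta> * exp (- (t * s)\<^sup>2 / 2)"
      by (simp add: XZ mult.assoc)
    have v: "(\<integral>\<omega>. (X \<omega>)\<^sup>2 \<partial>M) = s\<^sup>2" using eZ by (simp add: XZ power_mult_distrib)
    have "distr M borel X = std_normal_distribution" if "s\<^sup>2 = 1"
    proof -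
      have "s = 1" using that n(1) by (simp add: power2_eq_1_iff)
      then show ?thesis using d XZ by simp
    qed
    moreover have "integrable M (\<lambda>\<omega>. (X \<omega>)\<^sup>2)" using iZ by (simp add: XZ power_mult_distrib)
    ultimately show ?thesis unfolding v using c by (simp add: power_mult_distrib)
  next
    case c
    have "(\<integral>\<omega>. X \<omega> \<partial>M) = (\<integral>\<omega>. m \<partial>M)" using c by (intro integral_cong_AE) auto
    then have "m = 0" using assms(4) by (simp add: prob_space)
    then have ae: "AE \<omega> in M. X \<omega> = 0" using c by simp
    have i: "integrable M (\<lambda>\<omega>. (X \<omega>)\<^sup>2) \<longleftrightarrow> integrable M (\<lambda>\<omega>. 0 :: real)"
      using ae by (intro integrable_cong_AE) auto
    have v: "(\<integral>\<omega>. (X \<omega>)\<^sup>2 \<partial>M) = 0"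
      using ae by (intro integral_eq_zero_AE) auto
    have "(\<integral>\<omega>. cos (\<beta> + t * X \<omega>) \<partial>M) = (\<integral>\<omega>. cos \<beta> \<partial>M)"
      using ae by (intro integral_cong_AE) auto
    then show ?thesis using i v by (simp add: prob_space)
  qed
  then show "integrable M (\<lambda>\<omega>. (X \<omega>)\<^sup>2)"
    and "(\<integral>\<omega>. cos (\<beta> + t * X \<omega>) \<partial>M) = cos \<beta> * exp (- t\<^sup>2 * (\<integral>\<omega>. (X \<omega>)\<^sup>2 \<partial>M) / 2)"
    and "(\<integral>\<omega>. (X \<omega>)\<^sup>2 \<partial>M) = 1 \<Longrightarrow> distr M borel X = std_normal_distribution" by auto
qed

definition std_normal_vector :: "'i set \<Rightarrow> ('i \<Rightarrow> real) measure" where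
  "std_normal_vector J = Pi\<^sub>M J (\<lambda>_. std_normal_distribution)"

lemma sets_std_normal_vector [measurable_cong]: "sets (std_normal_vector J) = sets (Pi\<^sub>M J (\<lambda>_. borel))"
  unfolding std_normal_vector_def by (intro sets_PiM_cong) auto

lemma prob_space_std_normal_vector: "prob_space (std_normal_vector J)"
  unfolding std_normal_vector_def using real_dist_normal_dist
  by (intro prob_space_PiM) (simp add: real_distribution_def)

lemma integral_std_normal_vector_cos:
  assumes J: "finite J"
  shows "(\<integral>x. cos (\<beta> + (\<Sum>j\<in>J. c j * x j)) \<partial>std_normal_vector J) = cos \<beta> * exp (- (\<Sum>j\<in>J. (c j)\<^sup>2) / 2)"
proof -
  interpret S: real_distribution std_normal_distribution by (rule real_dist_normal_dist)
  interpret P: product_sigma_finite "\<lambda>_. std_normal_distribution" by standard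
  interpret V: prob_space "std_normal_vector J" by (rule prob_space_std_normal_vector)
  have i: "integrable std_normal_distribution (\<lambda>x. iexp (t * x))" for t by (intro S.integrable_iexp) auto
  have ch: "(CLINT x|std_normal_distribution. iexp (t * x)) = complex_of_real (exp (- t\<^sup>2 / 2))" for t
    using fun_cong[OF char_std_normal_distribution, of t] unfolding char_def .
  have sm: "(\<lambda>x. (\<Sum>j\<in>J. c j * x j)) \<in> borel_measurable (std_normal_vector J)"
    by measurable
  have iv: "integrable (std_normal_vector J) (\<lambda>x. iexp (\<beta> + (\<Sum>j\<in>J. c j * x j)))"
    using sm by (intro V.integrable_iexp) (auto intro!: borel_measurable_of_real)
  have "(CLINT x|std_normal_vector J. iexp (\<beta> + (\<Sum>j\<in>J. c j * x j))) =
    (CLINT x|std_normal_vector J. iexp \<beta> * (\<Prod>j\<in>J. iexp (c j * x j)))"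
    using J by (simp add: exp_add[symmetric] exp_sum[symmetric] sum_distrib_left distrib_left)
  also have "\<dots> = iexp \<beta> * (CLINT x|std_normal_vector J. (\<Prod>j\<in>J. iexp (c j * x j)))"
    by (rule integral_mult_right_zero)
  also have "\<dots> = iexp \<beta> * (\<Prod>j\<in>J. complex_of_real (exp (- (c j)\<^sup>2 / 2)))"
    unfolding std_normal_vector_def ch[symmetric] using P.product_integral_prod[OF J i[of "c _"]] by simp
  also have "(\<Prod>j\<in>J. complex_of_real (exp (- (c j)\<^sup>2 / 2))) = complex_of_real (exp (- (\<Sum>j\<in>J. (c j)\<^sup>2) / 2))"
    using J by (simp add: exp_sum[symmetric] sum_negf sum_divide_distrib flip: of_real_prod)
  finally have "Re (CLINT x|std_normal_vector J. iexp (\<beta> + (\<Sum>j\<in>J. c j * x j))) = cos \<beta> * exp (- (\<Sum>j\<in>J. (c j)\<^sup>2) / 2)"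
    by (simp add: Re_exp)
  then show ?thesis using integral_Re[OF iv] by (simp add: Re_exp)
qed

text \<open>A symmetric diagonally dominant form with diagonal \<open>e\<close> is a nonnegative combination of squares: each
ordered pair of distinct indices \<open>a\<close>, \<open>b\<close> contributes \<open>(c a + sgn (d a b) * c b)\<^sup>2\<close> with weight \<open>\<bar>d a b\<bar> / 2\<close>, whose
mixed term is \<open>d a b * c a * c b\<close>, and the slack in the diagonal contributes the squares
\<open>(c a)\<^sup>2\<close>. So a Gaussian vector with this covariance can be written down from independent normals indexed by \<open>J \<times> J\<close>.\<close>

lemma diagonally_dominant_sum_of_squares:
  fixes d :: "'i \<Rightarrow> 'i \<Rightarrow> real"
  assumes J: "finite J" and sym: "\<And>i k. d i k = d k i"
    and dom: "\<And>i. i \<in> J \<Longrightarrow> (\<Sum>k\<in>J - {i}. \<bar>d i k\<bar>) \<le> e"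
  obtains B :: "'i \<Rightarrow> 'i \<times> 'i \<Rightarrow> real" where
    "\<And>c. (\<Sum>k\<in>J \<times> J. (\<Sum>i\<in>J. c i * B i k)\<^sup>2) = e * (\<Sum>i\<in>J. (c i)\<^sup>2) + (\<Sum>i\<in>J. \<Sum>k\<in>J - {i}. d i k * c i * c k)"
proof
  define sl where "sl i = e - (\<Sum>k\<in>J - {i}. \<bar>d i k\<bar>)" for i
  define B where "B i = (\<lambda>(a, b). if a = b then (if i = a then sqrt (sl a) else 0)
     else (if i = a then sqrt (\<bar>d a b\<bar> / 2) else 0) + (if i = b then sgn (d a b) * sqrt (\<bar>d a b\<bar> / 2) else 0))" for i
  fix c :: "'i \<Rightarrow> real"
  have sl: "sl i \<ge> 0" if "i \<in> J" for i using dom[OF that] by (simp add: sl_def)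
  have form: "(\<Sum>i\<in>J. c i * B i (a, b)) = (if a = b then c a * sqrt (sl a) else (c a + sgn (d a b) * c b) * sqrt (\<bar>d a b\<bar> / 2))"
    if "a \<in> J" "b \<in> J" for a b
    using J that by (simp add: B_def sum.distrib distrib_left if_distrib[of "\<lambda>x. c _ * x"] sum.delta algebra_simps cong: if_cong)
  have sq: "(\<Sum>i\<in>J. c i * B i (a, b))\<^sup>2 = (if a = b then (c a)\<^sup>2 * sl a else
      (\<bar>d a b\<bar> * (c a)\<^sup>2 + \<bar>d a b\<bar> * (c b)\<^sup>2) / 2 + d a b * c a * c b)"
    if "a \<in> J" "b \<in> J" for a b
  proof -
    have "(c a + sgn (d a b) * c b)\<^sup>2 * (\<bar>d a b\<bar> / 2) = (\<bar>d a b\<bar> * (c a)\<^sup>2 + \<bar>d a b\<bar> * (c b)\<^sup>2) / 2 + d a b * c a * c b"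
      by (cases "d a b" "0::real" rule: linorder_cases) (simp_all add: power2_eq_square field_simps)
    then show ?thesis unfolding form[OF that] using sl[OF that(1)] sl[OF that(2)] by (simp add: power_mult_distrib)
  qed
  have row: "(\<Sum>b\<in>J. (\<Sum>i\<in>J. c i * B i (a, b))\<^sup>2) = (c a)\<^sup>2 * sl a +
      (\<Sum>b\<in>J - {a}. (\<bar>d a b\<bar> * (c a)\<^sup>2 + \<bar>d a b\<bar> * (c b)\<^sup>2) / 2 + d a b * c a * c b)" if "a \<in> J" for a
  proof -
    have "(\<Sum>b\<in>J. (\<Sum>i\<in>J. c i * B i (a, b))\<^sup>2) = (\<Sum>i\<in>J. c i * B i (a, a))\<^sup>2 + (\<Sum>b\<in>J - {a}. (\<Sum>i\<in>J. c i * B i (a, b))\<^sup>2)"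
      by (rule sum.remove[OF J that])
    also have "(\<Sum>i\<in>J. c i * B i (a, a))\<^sup>2 = (c a)\<^sup>2 * sl a" using sq[OF that that] by simp
    also have "(\<Sum>b\<in>J - {a}. (\<Sum>i\<in>J. c i * B i (a, b))\<^sup>2) =
       (\<Sum>b\<in>J - {a}. (\<bar>d a b\<bar> * (c a)\<^sup>2 + \<bar>d a b\<bar> * (c b)\<^sup>2) / 2 + d a b * c a * c b)"
      by (intro sum.cong refl) (subst sq[OF that], auto)
    finally show ?thesis .
  qed
  have offdiag: "(\<Sum>b\<in>J. if a = b then 0 else F b) = (\<Sum>b\<in>J - {a}. F b)" if "a \<in> J" for a and F :: "'i \<Rightarrow> real"
    by (rule sum.mono_neutral_cong_right) (use J in \<open>auto split: if_splits\<close>)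
  have swap: "(\<Sum>a\<in>J. \<Sum>b\<in>J - {a}. \<bar>d a b\<bar> * (c b)\<^sup>2) = (\<Sum>a\<in>J. \<Sum>b\<in>J - {a}. \<bar>d a b\<bar> * (c a)\<^sup>2)"
  proof -
    have "(\<Sum>a\<in>J. \<Sum>b\<in>J - {a}. \<bar>d a b\<bar> * (c b)\<^sup>2) = (\<Sum>a\<in>J. \<Sum>b\<in>J. if a = b then 0 else \<bar>d a b\<bar> * (c b)\<^sup>2)"
      by (intro sum.cong refl offdiag[symmetric])
    also have "\<dots> = (\<Sum>b\<in>J. \<Sum>a\<in>J. if a = b then 0 else \<bar>d a b\<bar> * (c b)\<^sup>2)" by (rule sum.swap)
    also have "\<dots> = (\<Sum>b\<in>J. \<Sum>a\<in>J. if b = a then 0 else \<bar>d b a\<bar> * (c b)\<^sup>2)"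
      by (intro sum.cong refl) (auto simp: sym)
    also have "\<dots> = (\<Sum>a\<in>J. \<Sum>b\<in>J - {a}. \<bar>d a b\<bar> * (c a)\<^sup>2)"
      by (intro sum.cong refl offdiag)
    finally show ?thesis .
  qed
  have "(\<Sum>k\<in>J \<times> J. (\<Sum>i\<in>J. c i * B i k)\<^sup>2) = (\<Sum>a\<in>J. \<Sum>b\<in>J. (\<Sum>i\<in>J. c i * B i (a, b))\<^sup>2)"
    by (simp add: sum.cartesian_product case_prod_unfold)
  also have "\<dots> = (\<Sum>a\<in>J. (c a)\<^sup>2 * sl a) + ((\<Sum>a\<in>J. \<Sum>b\<in>J - {a}. \<bar>d a b\<bar> * (c a)\<^sup>2) + (\<Sum>a\<in>J. \<Sum>b\<in>J - {a}. \<bar>d a b\<bar> * (c b)\<^sup>2)) / 2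
      + (\<Sum>a\<in>J. \<Sum>b\<in>J - {a}. d a b * c a * c b)"
    by (simp add: row sum.distrib sum_divide_distrib[symmetric] add_divide_distrib)
  also have "\<dots> = (\<Sum>a\<in>J. (c a)\<^sup>2 * sl a + (\<Sum>b\<in>J - {a}. \<bar>d a b\<bar> * (c a)\<^sup>2)) + (\<Sum>a\<in>J. \<Sum>b\<in>J - {a}. d a b * c a * c b)"
    unfolding swap by (simp add: sum.distrib)
  also have "(\<Sum>a\<in>J. (c a)\<^sup>2 * sl a + (\<Sum>b\<in>J - {a}. \<bar>d a b\<bar> * (c a)\<^sup>2)) = e * (\<Sum>i\<in>J. (c i)\<^sup>2)"
    unfolding sum_distrib_left
    by (intro sum.cong refl) (simp add: sl_def sum_distrib_right[symmetric] algebra_simps)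
  finally show "(\<Sum>k\<in>J \<times> J. (\<Sum>i\<in>J. c i * B i k)\<^sup>2) = e * (\<Sum>i\<in>J. (c i)\<^sup>2) + (\<Sum>i\<in>J. \<Sum>k\<in>J - {i}. d i k * c i * c k)" .
qed

section \<open>Comparing a nearly standard Gaussian vector with independent normals\<close>

text \<open>The one-dimensional case of Anderson's inequality. The reflection \<open>z \<mapsto> v - z\<close> with \<open>v = w / s\<close> exchanges the
densities at \<open>z\<close> and \<open>z - v\<close>, so twice the difference of the two sides is the integral of the product of
\<open>\<phi> z - \<phi> (z - v)\<close> and \<open>g (s * z) - g (s * (v - z))\<close>. Both factors are
nonnegative if \<open>\<bar>z\<bar> \<le> \<bar>z - v\<bar>\<close>, and both are nonpositive otherwise.\<close>

lemma std_normal_shift_le: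
  fixes g :: "real \<Rightarrow> real"
  assumes [measurable]: "g \<in> borel_measurable borel" and g0: "\<And>x. 0 \<le> g x"
    and anti: "\<And>x y. \<bar>x\<bar> \<le> \<bar>y\<bar> \<Longrightarrow> g y \<le> g x" and s: "0 < s"
  shows "(\<integral>\<^sup>+z. ennreal (g (s * z + w)) \<partial>std_normal_distribution) \<le> (\<integral>\<^sup>+z. ennreal (g (s * z)) \<partial>std_normal_distribution)"
proof -
  interpret S: real_distribution std_normal_distribution by (rule real_dist_normal_dist)
  let ?\<phi> = std_normal_density
  define v where "v = w / s"
  have b: "g x \<le> g 0" for x using anti[of 0 x] by simp
  have ib: "integrable std_normal_distribution f" if "f \<in> borel_measurable borel" "\<And>x. \<bar>f x\<bar> \<le> g 0" for f
    using that by (intro S.integrable_const_bound[of _ "g 0"]) auto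
  have i1: "integrable std_normal_distribution (\<lambda>z. g (s * z))" "integrable std_normal_distribution (\<lambda>z. g (s * z + w))"
    using g0 b by (auto intro!: ib)
  have il: "integrable lborel (\<lambda>z. ?\<phi> (z - u) * g (f z))" if [measurable]: "f \<in> borel_measurable borel" for u f
  proof -
    have "integrable std_normal_distribution (\<lambda>z. g (f (z + u)))"
      using g0 b by (auto intro!: ib)
    then have "integrable lborel (\<lambda>z. ?\<phi> z * g (f (z + u)))"
      by (simp add: integrable_density)
    from lborel_integrable_real_affine[OF this, of 1 "-u"] show ?thesis by simp
  qed
  have il0: "integrable lborel (\<lambda>z. ?\<phi> z * g (f z))" if [measurable]: "f \<in> borel_measurable borel" for f
    using il[OF that, of 0] by simp
  have e1: "(\<integral>z. g (s * z) \<partial>std_normal_distribution) = (\<integral>z. ?\<phi> z * g (s * z) \<partial>lborel)"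
    by (subst integral_density) auto
  have "(\<integral>z. g (s * z + w) \<partial>std_normal_distribution) = (\<integral>z. ?\<phi> z * g (s * z + w) \<partial>lborel)"
    by (subst integral_density) auto
  also have "\<dots> = (\<integral>z. ?\<phi> (z - v) * g (s * z) \<partial>lborel)"
    using s by (subst lborel_integral_real_affine[of 1 _ "-v"]) (auto simp: v_def algebra_simps)
  finally have e2: "(\<integral>z. g (s * z + w) \<partial>std_normal_distribution) = (\<integral>z. ?\<phi> (z - v) * g (s * z) \<partial>lborel)" .
  define D where "D = (\<integral>z. (?\<phi> z - ?\<phi> (z - v)) * g (s * z) \<partial>lborel)"
  have De: "D = (\<integral>z. g (s * z) \<partial>std_normal_distribution) - (\<integral>z. g (s * z + w) \<partial>std_normal_distribution)"
    unfolding D_def e1 e2 left_diff_distrib by (rule Bochner_Integration.integral_diff) (intro il0 il, measurable)+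
  have even: "?\<phi> (- x) = ?\<phi> x" for x by (simp add: std_normal_density_def)
  have "D = (\<integral>z. (?\<phi> (v - z) - ?\<phi> (- z)) * g (s * (v - z)) \<partial>lborel)"
    unfolding D_def by (subst lborel_integral_real_affine[of "-1" _ v]) auto
  also have "\<dots> = (\<integral>z. (?\<phi> (z - v) - ?\<phi> z) * g (s * (v - z)) \<partial>lborel)"
    using even[of "z - v" for z] even by (intro Bochner_Integration.integral_cong) auto
  finally have D2: "D = (\<integral>z. (?\<phi> (z - v) - ?\<phi> z) * g (s * (v - z)) \<partial>lborel)" .
  have "D + D = (\<integral>z. (?\<phi> z - ?\<phi> (z - v)) * g (s * z) + (?\<phi> (z - v) - ?\<phi> z) * g (s * (v - z)) \<partial>lborel)"
    unfolding D_def by (subst (2) D_def[symmetric], subst D2, subst Bochner_Integration.integral_add)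
      (auto simp: left_diff_distrib intro!: Bochner_Integration.integrable_diff il il0)
  also have "\<dots> \<ge> 0"
  proof (rule Bochner_Integration.integral_nonneg)
    fix z
    have m: "?\<phi> y \<le> ?\<phi> x" if "\<bar>x\<bar> \<le> \<bar>y\<bar>" for x y
      using that by (auto simp: std_normal_density_def abs_le_square_iff intro!: divide_right_mono)
    have "0 \<le> (?\<phi> z - ?\<phi> (z - v)) * (g (s * z) - g (s * (v - z)))"
    proof (cases "\<bar>z\<bar> \<le> \<bar>z - v\<bar>")
      case True
      then have "\<bar>s * z\<bar> \<le> \<bar>s * (v - z)\<bar>" using s by (simp add: abs_mult abs_minus_commute)
      then show ?thesis using m[OF True] anti by (intro mult_nonneg_nonneg) auto
    next
      case False
      then have "\<bar>s * (v - z)\<bar> \<le> \<bar>s * z\<bar>" using s by (simp add: abs_mult abs_minus_commute)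
      then show ?thesis using m[of "z - v" z] False anti by (intro mult_nonpos_nonpos) auto
    qed
    then show "0 \<le> (?\<phi> z - ?\<phi> (z - v)) * g (s * z) + (?\<phi> (z - v) - ?\<phi> z) * g (s * (v - z))"
      by (simp add: algebra_simps)
  qed
  finally have "(\<integral>z. g (s * z + w) \<partial>std_normal_distribution) \<le> (\<integral>z. g (s * z) \<partial>std_normal_distribution)"
    using De by simp
  then show ?thesis using i1 g0 by (simp add: nn_integral_eq_integral)
qed

lemma integral_pair_cos:
  fixes L1 :: "'a \<Rightarrow> real" and L2 :: "'b \<Rightarrow> real"
  assumes "prob_space N1" "prob_space N2"
    and [measurable]: "L1 \<in> borel_measurable N1" "L2 \<in> borel_measurable N2"
    and 1: "\<And>\<beta>. (\<integral>x. cos (\<beta> + L1 x) \<partial>N1) = cos \<beta> * q1" and 2: "\<And>\<beta>. (\<integral>y. cos (\<beta> + L2 y) \<partial>N2) = cos \<beta> * q2"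
  shows "(\<integral>z. cos (\<beta> + (L1 (fst z) + L2 (snd z))) \<partial>(N1 \<Otimes>\<^sub>M N2)) = cos \<beta> * (q1 * q2)"
proof -
  interpret N1: prob_space N1 by fact
  interpret N2: prob_space N2 by fact
  interpret P: pair_prob_space N1 N2 ..
  have i: "integrable (N1 \<Otimes>\<^sub>M N2) (\<lambda>z. cos (\<beta> + (L1 (fst z) + L2 (snd z))))"
    by (intro P.integrable_const_bound[of _ 1]) auto
  have "(\<integral>z. cos (\<beta> + (L1 (fst z) + L2 (snd z))) \<partial>(N1 \<Otimes>\<^sub>M N2)) = (\<integral>x. \<integral>y. cos ((\<beta> + L1 x) + L2 y) \<partial>N2 \<partial>N1)"
    using P.integral_fst'[OF i] by (simp add: add.assoc)
  also have "\<dots> = cos \<beta> * (q1 * q2)" unfolding 2 by (simp add: 1)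
  finally show ?thesis .
qed

lemma law_eq_of_cos:
  fixes X :: "'i \<Rightarrow> 'a \<Rightarrow> real" and Y :: "'i \<Rightarrow> 'b \<Rightarrow> real"
  assumes "prob_space N1" "prob_space N2" "finite J"
    and m1: "\<And>i. i \<in> J \<Longrightarrow> X i \<in> borel_measurable N1" and m2: "\<And>i. i \<in> J \<Longrightarrow> Y i \<in> borel_measurable N2"
    and eq: "\<And>c \<beta>. (\<integral>x. cos (\<beta> + (\<Sum>i\<in>J. c i * X i x)) \<partial>N1) = (\<integral>x. cos (\<beta> + (\<Sum>i\<in>J. c i * Y i x)) \<partial>N2)"
    and [measurable]: "\<And>i. i \<in> J \<Longrightarrow> f i \<in> borel_measurable borel"
  shows "(\<integral>\<^sup>+x. (\<Prod>i\<in>J. f i (X i x)) \<partial>N1) = (\<integral>\<^sup>+x. (\<Prod>i\<in>J. f i (Y i x)) \<partial>N2)"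
proof -
  let ?P = "Pi\<^sub>M J (\<lambda>_. borel :: real measure)"
  have [measurable]: "(\<lambda>x. \<lambda>i\<in>J. X i x) \<in> measurable N1 ?P" "(\<lambda>x. \<lambda>i\<in>J. Y i x) \<in> measurable N2 ?P"
    using m1 m2 by (auto intro!: measurable_restrict)
  have lin[measurable]: "(\<lambda>x. \<Sum>i\<in>J. c i * x i) \<in> borel_measurable ?P" for c :: "_ \<Rightarrow> real"
    by measurable
  have pr[measurable]: "(\<lambda>x. \<Prod>i\<in>J. f i (x i)) \<in> borel_measurable ?P"
    by measurable
  have "distr N1 ?P (\<lambda>x. \<lambda>i\<in>J. X i x) = distr N2 ?P (\<lambda>x. \<lambda>i\<in>J. Y i x)"
  proof (rule cos_char_eq_imp_law_eq[OF _ _ \<open>finite J\<close>])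
    show "prob_space (distr N1 ?P (\<lambda>x. \<lambda>i\<in>J. X i x))" "prob_space (distr N2 ?P (\<lambda>x. \<lambda>i\<in>J. Y i x))"
      using assms(1,2) by (auto intro!: prob_space.prob_space_distr)
    show "(\<integral>x. cos (\<beta> + (\<Sum>j\<in>J. c j * x j)) \<partial>distr N1 ?P (\<lambda>x. \<lambda>i\<in>J. X i x)) =
          (\<integral>x. cos (\<beta> + (\<Sum>j\<in>J. c j * x j)) \<partial>distr N2 ?P (\<lambda>x. \<lambda>i\<in>J. Y i x))" for c \<beta>
      using eq[of \<beta> c] by (simp add: integral_distr)
  qed auto
  then have "(\<integral>\<^sup>+x. (\<Prod>i\<in>J. f i (x i)) \<partial>distr N1 ?P (\<lambda>x. \<lambda>i\<in>J. X i x)) =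
      (\<integral>\<^sup>+x. (\<Prod>i\<in>J. f i (x i)) \<partial>distr N2 ?P (\<lambda>x. \<lambda>i\<in>J. Y i x))" by simp
  then show ?thesis by (simp add: nn_integral_distr)
qed

lemma nn_integral_std_normal_vector_prod:
  assumes "finite J" "\<And>i. i \<in> J \<Longrightarrow> f i \<in> borel_measurable borel"
  shows "(\<integral>\<^sup>+x. (\<Prod>i\<in>J. f i (x i)) \<partial>std_normal_vector J) = (\<Prod>i\<in>J. \<integral>\<^sup>+z. f i z \<partial>std_normal_distribution)"
proof -
  interpret S: real_distribution std_normal_distribution by (rule real_dist_normal_dist)
  interpret P: product_sigma_finite "\<lambda>_. std_normal_distribution" by standard
  show ?thesis unfolding std_normal_vector_def using assms by (intro P.product_nn_integral_prod) auto
qed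

lemma linear_std_normal_cos:
  assumes "finite J" "finite K"
  shows "(\<integral>x. cos (\<beta> + (\<Sum>i\<in>J. c i * (\<Sum>k\<in>K. B i k * x k))) \<partial>std_normal_vector K) =
    cos \<beta> * exp (- (\<Sum>k\<in>K. (\<Sum>i\<in>J. c i * B i k)\<^sup>2) / 2)"
proof -
  have "(\<Sum>i\<in>J. c i * (\<Sum>k\<in>K. B i k * x k)) = (\<Sum>k\<in>K. (\<Sum>i\<in>J. c i * B i k) * x k)" for x
  proof -
    have "(\<Sum>i\<in>J. c i * (\<Sum>k\<in>K. B i k * x k)) = (\<Sum>i\<in>J. \<Sum>k\<in>K. c i * B i k * x k)"
      by (simp add: sum_distrib_left mult.assoc)
    also have "\<dots> = (\<Sum>k\<in>K. \<Sum>i\<in>J. c i * B i k * x k)" by (rule sum.swap)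
    finally show ?thesis by (simp add: sum_distrib_right)
  qed
  then show ?thesis using integral_std_normal_vector_cos[OF assms(2)] by simp
qed

text \<open>Gaussian vectors with unit variances and small covariances \<open>a\<close>, described by their characteristic
function alone, so that no further structure of the underlying space matters.\<close>

locale nearly_standard_vector = prob_space M for M :: "'a measure" +
  fixes J :: "'i set" and Y :: "'i \<Rightarrow> 'a \<Rightarrow> real" and a :: "'i \<Rightarrow> 'i \<Rightarrow> real" and e :: real
  assumes fin: "finite J" and meas [measurable]: "\<And>i. Y i \<in> borel_measurable M"
    and cosine: "\<And>c \<beta>. (\<integral>\<omega>. cos (\<beta> + (\<Sum>i\<in>J. c i * Y i \<omega>)) \<partial>M) =
      cos \<beta> * exp (- ((\<Sum>i\<in>J. (c i)\<^sup>2) + (\<Sum>i\<in>J. \<Sum>k\<in>J - {i}. a i k * c i * c k)) / 2)"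
    and sym: "\<And>i k. a i k = a k i" and dom: "\<And>i. i \<in> J \<Longrightarrow> (\<Sum>k\<in>J - {i}. \<bar>a i k\<bar>) \<le> e"
begin

text \<open>The vector has the law of \<open>s * Z + W\<close> with \<open>s\<^sup>2 = 1 - e\<close>, \<open>Z\<close> standard and \<open>W\<close> an independent Gaussian vector, whose
covariance is \<open>e\<close> on the diagonal and \<open>a\<close> off it. Given \<open>W\<close>, the coordinates are independent, and
the shift by \<open>W\<close> only decreases the expectation of each factor.\<close>

lemma expectation_prod_le:
  fixes g :: "real \<Rightarrow> real"
  assumes [measurable]: "g \<in> borel_measurable borel" and g0: "\<And>x. 0 \<le> g x"
    and anti: "\<And>x y. \<bar>x\<bar> \<le> \<bar>y\<bar> \<Longrightarrow> g y \<le> g x" and e: "e < 1"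
  shows "(\<integral>\<^sup>+\<omega>. (\<Prod>i\<in>J. ennreal (g (Y i \<omega>))) \<partial>M) \<le>
    (\<integral>\<^sup>+z. ennreal (g (sqrt (1 - e) * z)) \<partial>std_normal_distribution) ^ card J"
proof -
  define s where "s = sqrt (1 - e)"
  have s: "0 < s" "s\<^sup>2 = 1 - e" using e by (auto simp: s_def)
  define K where "K = J \<times> J"
  obtain B :: "'i \<Rightarrow> 'i \<times> 'i \<Rightarrow> real" where
    B: "\<And>c. (\<Sum>k\<in>J \<times> J. (\<Sum>i\<in>J. c i * B i k)\<^sup>2) = e * (\<Sum>i\<in>J. (c i)\<^sup>2) + (\<Sum>i\<in>J. \<Sum>k\<in>J - {i}. a i k * c i * c k)"
    using diagonally_dominant_sum_of_squares[OF fin sym dom] by blast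
  have fK: "finite K" using fin by (simp add: K_def)
  let ?Z = "std_normal_vector J" and ?W = "std_normal_vector K"
  interpret Z: prob_space ?Z by (rule prob_space_std_normal_vector)
  interpret W: prob_space ?W by (rule prob_space_std_normal_vector)
  interpret ZW: pair_prob_space ?Z ?W ..
  have mz: "(\<lambda>z. z i) \<in> borel_measurable ?Z" if "i \<in> J" for i
    using that by measurable
  have mw[measurable]: "(\<lambda>x. \<Sum>k\<in>K. B i k * x k) \<in> borel_measurable ?W" for i
    by (intro borel_measurable_sum borel_measurable_times borel_measurable_const) measurable
  have mf: "(\<lambda>z. z i) \<circ> fst \<in> borel_measurable (?Z \<Otimes>\<^sub>M ?W)" if "i \<in> J" for i
    using mz[OF that] by (intro measurable_comp[OF measurable_fst])
  then have [measurable]: "(\<lambda>z. fst z i) \<in> borel_measurable (?Z \<Otimes>\<^sub>M ?W)" if "i \<in> J" for i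
    using that by (simp add: comp_def)
  have ms: "(\<lambda>x. \<Sum>k\<in>K. B i k * x k) \<circ> snd \<in> borel_measurable (?Z \<Otimes>\<^sub>M ?W)" for i
    using mw by (intro measurable_comp[OF measurable_snd])
  then have [measurable]: "(\<lambda>z. \<Sum>k\<in>K. B i k * snd z k) \<in> borel_measurable (?Z \<Otimes>\<^sub>M ?W)" for i
    by (simp add: comp_def)
  have "(\<integral>\<^sup>+\<omega>. (\<Prod>i\<in>J. ennreal (g (Y i \<omega>))) \<partial>M) =
      (\<integral>\<^sup>+z. (\<Prod>i\<in>J. ennreal (g (s * fst z i + (\<Sum>k\<in>K. B i k * snd z k)))) \<partial>(?Z \<Otimes>\<^sub>M ?W))"
  proof (rule law_eq_of_cos[OF prob_space_axioms ZW.prob_space_axioms fin,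
        where f="\<lambda>_ y. ennreal (g y)" and X=Y and Y="\<lambda>i z. s * fst z i + (\<Sum>k\<in>K. B i k * snd z k)"])
    fix c \<beta>
    have "(\<integral>z. cos (\<beta> + (\<Sum>i\<in>J. c i * (s * fst z i + (\<Sum>k\<in>K. B i k * snd z k)))) \<partial>(?Z \<Otimes>\<^sub>M ?W)) =
       (\<integral>z. cos (\<beta> + ((\<Sum>i\<in>J. (s * c i) * fst z i) + (\<Sum>i\<in>J. c i * (\<Sum>k\<in>K. B i k * snd z k)))) \<partial>(?Z \<Otimes>\<^sub>M ?W))"
      by (simp add: distrib_left sum.distrib mult_ac)
    also have "\<dots> = cos \<beta> * (exp (- (\<Sum>i\<in>J. (s * c i)\<^sup>2) / 2) * exp (- (\<Sum>k\<in>K. (\<Sum>i\<in>J. c i * B i k)\<^sup>2) / 2))"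
      by (rule integral_pair_cos[OF Z.prob_space_axioms W.prob_space_axioms])
         (auto simp: integral_std_normal_vector_cos[OF fin] linear_std_normal_cos[OF fin fK])
    also have "\<dots> = cos \<beta> * exp (- ((\<Sum>i\<in>J. (c i)\<^sup>2) + (\<Sum>i\<in>J. \<Sum>k\<in>J - {i}. a i k * c i * c k)) / 2)"
      unfolding K_def B by (simp add: exp_add[symmetric] power_mult_distrib s sum_distrib_left[symmetric]) (simp add: field_simps)
    finally show "(\<integral>\<omega>. cos (\<beta> + (\<Sum>i\<in>J. c i * Y i \<omega>)) \<partial>M) =
      (\<integral>z. cos (\<beta> + (\<Sum>i\<in>J. c i * (s * fst z i + (\<Sum>k\<in>K. B i k * snd z k)))) \<partial>(?Z \<Otimes>\<^sub>M ?W))"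
      using cosine by simp
  qed auto
  also have "\<dots> = (\<integral>\<^sup>+x. (\<integral>\<^sup>+z. (\<Prod>i\<in>J. ennreal (g (s * z i + (\<Sum>k\<in>K. B i k * x k)))) \<partial>?Z) \<partial>?W)"
    by (subst ZW.nn_integral_snd[symmetric]) auto
  also have "\<dots> = (\<integral>\<^sup>+x. (\<Prod>i\<in>J. \<integral>\<^sup>+z. ennreal (g (s * z + (\<Sum>k\<in>K. B i k * x k))) \<partial>std_normal_distribution) \<partial>?W)"
    by (intro nn_integral_cong nn_integral_std_normal_vector_prod fin) auto
  also have "\<dots> \<le> (\<integral>\<^sup>+x. (\<Prod>i\<in>J. \<integral>\<^sup>+z. ennreal (g (s * z)) \<partial>std_normal_distribution) \<partial>?W)"
    by (intro nn_integral_mono prod_mono_ennreal std_normal_shift_le g0 anti s) auto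
  also have "\<dots> = (\<integral>\<^sup>+z. ennreal (g (s * z)) \<partial>std_normal_distribution) ^ card J"
    by (simp add: W.emeasure_space_1)
  finally show ?thesis unfolding s_def .
qed

text \<open>Add an independent Gaussian vector \<open>W\<close> with covariance \<open>e\<close> on the diagonal and \<open>- a\<close> off it: the sum, and
also the difference, is \<open>sqrt (1 + e)\<close> times a standard vector. By convexity the integrand at \<open>Y\<close> is at
most the mean of its values at \<open>Y + W\<close> and \<open>Y - W\<close>, so removing \<open>W\<close> can only decrease the expectation.\<close>

lemma expectation_exp_convex_le:
  fixes \<psi> :: "real \<Rightarrow> real"
  assumes [measurable]: "\<psi> \<in> borel_measurable borel" and conv: "\<And>x w. \<psi> x \<le> (\<psi> (x + w) + \<psi> (x - w)) / 2"
    and e: "0 \<le> e"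
  shows "(\<integral>\<^sup>+\<omega>. (\<Prod>i\<in>J. ennreal (exp (\<psi> (Y i \<omega>)))) \<partial>M) \<le>
    (\<integral>\<^sup>+z. ennreal (exp (\<psi> (sqrt (1 + e) * z))) \<partial>std_normal_distribution) ^ card J"
proof -
  define s where "s = sqrt (1 + e)"
  have s: "0 < s" "s\<^sup>2 = 1 + e" using e by (auto simp: s_def)
  define K where "K = J \<times> J"
  obtain B :: "'i \<Rightarrow> 'i \<times> 'i \<Rightarrow> real" where
    B: "\<And>c. (\<Sum>k\<in>J \<times> J. (\<Sum>i\<in>J. c i * B i k)\<^sup>2) = e * (\<Sum>i\<in>J. (c i)\<^sup>2) + (\<Sum>i\<in>J. \<Sum>k\<in>J - {i}. - a i k * c i * c k)"
    using diagonally_dominant_sum_of_squares[OF fin, of "\<lambda>i k. - a i k"] sym dom by auto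
  have fK: "finite K" using fin by (simp add: K_def)
  let ?W = "std_normal_vector K"
  interpret W: prob_space ?W by (rule prob_space_std_normal_vector)
  interpret MW: pair_prob_space M ?W ..
  have mw[measurable]: "(\<lambda>x. \<Sum>k\<in>K. B i k * x k) \<in> borel_measurable ?W" for i
    by (intro borel_measurable_sum borel_measurable_times borel_measurable_const) measurable
  have ms: "(\<lambda>x. \<Sum>k\<in>K. B i k * x k) \<circ> snd \<in> borel_measurable (M \<Otimes>\<^sub>M ?W)" for i
    using mw by (intro measurable_comp[OF measurable_snd])
  then have [measurable]: "(\<lambda>z. \<Sum>k\<in>K. B i k * snd z k) \<in> borel_measurable (M \<Otimes>\<^sub>M ?W)" for i
    by (simp add: comp_def)
  define I where "I = (\<integral>\<^sup>+z. ennreal (exp (\<psi> (s * z))) \<partial>std_normal_distribution) ^ card J"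
  have law: "(\<integral>\<^sup>+z. (\<Prod>i\<in>J. ennreal (exp (\<psi> (Y i (fst z) + \<tau> * (\<Sum>k\<in>K. B i k * snd z k))))) \<partial>(M \<Otimes>\<^sub>M ?W)) = I"
    if \<tau>: "\<tau>\<^sup>2 = 1" for \<tau>
  proof -
    have "(\<integral>\<^sup>+z. (\<Prod>i\<in>J. ennreal (exp (\<psi> (Y i (fst z) + \<tau> * (\<Sum>k\<in>K. B i k * snd z k))))) \<partial>(M \<Otimes>\<^sub>M ?W)) =
      (\<integral>\<^sup>+z. (\<Prod>i\<in>J. ennreal (exp (\<psi> (s * z i)))) \<partial>std_normal_vector J)"
    proof (rule law_eq_of_cos[OF MW.prob_space_axioms prob_space_std_normal_vector fin,
          where f="\<lambda>_ y. ennreal (exp (\<psi> y))" and X="\<lambda>i z. Y i (fst z) + \<tau> * (\<Sum>k\<in>K. B i k * snd z k)" and Y="\<lambda>i z. s * z i"])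
      fix c \<beta>
      have "(\<integral>z. cos (\<beta> + (\<Sum>i\<in>J. c i * (Y i (fst z) + \<tau> * (\<Sum>k\<in>K. B i k * snd z k)))) \<partial>(M \<Otimes>\<^sub>M ?W)) =
         (\<integral>z. cos (\<beta> + ((\<Sum>i\<in>J. c i * Y i (fst z)) + (\<Sum>i\<in>J. (\<tau> * c i) * (\<Sum>k\<in>K. B i k * snd z k)))) \<partial>(M \<Otimes>\<^sub>M ?W))"
        by (simp add: distrib_left sum.distrib mult_ac)
      also have "\<dots> = cos \<beta> * (exp (- ((\<Sum>i\<in>J. (c i)\<^sup>2) + (\<Sum>i\<in>J. \<Sum>k\<in>J - {i}. a i k * c i * c k)) / 2) *
            exp (- (\<Sum>k\<in>K. (\<Sum>i\<in>J. (\<tau> * c i) * B i k)\<^sup>2) / 2))"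
        by (rule integral_pair_cos[OF prob_space_axioms W.prob_space_axioms])
           (auto simp: cosine linear_std_normal_cos[OF fin fK])
      also have "(\<Sum>k\<in>K. (\<Sum>i\<in>J. (\<tau> * c i) * B i k)\<^sup>2) = (\<Sum>k\<in>K. (\<Sum>i\<in>J. c i * B i k)\<^sup>2)"
        by (simp add: mult.assoc sum_distrib_left[symmetric] power_mult_distrib \<tau>)
      also have "cos \<beta> * (exp (- ((\<Sum>i\<in>J. (c i)\<^sup>2) + (\<Sum>i\<in>J. \<Sum>k\<in>J - {i}. a i k * c i * c k)) / 2) *
            exp (- (\<Sum>k\<in>K. (\<Sum>i\<in>J. c i * B i k)\<^sup>2) / 2)) = cos \<beta> * exp (- (\<Sum>i\<in>J. (c i * s)\<^sup>2) / 2)"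
        unfolding K_def B by (simp add: exp_add[symmetric] power_mult_distrib s sum_distrib_right[symmetric] sum_negf) (simp add: field_simps)
      also have "\<dots> = (\<integral>z. cos (\<beta> + (\<Sum>i\<in>J. c i * (s * z i))) \<partial>std_normal_vector J)"
        using integral_std_normal_vector_cos[OF fin, of \<beta> "\<lambda>i. c i * s"] by (simp add: mult.assoc)
      finally show "(\<integral>z. cos (\<beta> + (\<Sum>i\<in>J. c i * (Y i (fst z) + \<tau> * (\<Sum>k\<in>K. B i k * snd z k)))) \<partial>(M \<Otimes>\<^sub>M ?W)) =
         (\<integral>z. cos (\<beta> + (\<Sum>i\<in>J. c i * (s * z i))) \<partial>std_normal_vector J)" .
    qed auto
    also have "\<dots> = I" unfolding I_def using nn_integral_std_normal_vector_prod[OF fin, of "\<lambda>_ z. ennreal (exp (\<psi> (s * z)))"] by simp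
    finally show ?thesis .
  qed
  have "(\<integral>\<^sup>+\<omega>. (\<Prod>i\<in>J. ennreal (exp (\<psi> (Y i \<omega>)))) \<partial>M) = (\<integral>\<^sup>+z. (\<Prod>i\<in>J. ennreal (exp (\<psi> (Y i (fst z))))) \<partial>(M \<Otimes>\<^sub>M ?W))"
    by (subst W.nn_integral_fst[symmetric]) (auto simp: W.emeasure_space_1)
  also have "\<dots> \<le> (\<integral>\<^sup>+z. ennreal (1/2) * (\<Prod>i\<in>J. ennreal (exp (\<psi> (Y i (fst z) + 1 * (\<Sum>k\<in>K. B i k * snd z k))))) +
       ennreal (1/2) * (\<Prod>i\<in>J. ennreal (exp (\<psi> (Y i (fst z) + (- 1) * (\<Sum>k\<in>K. B i k * snd z k))))) \<partial>(M \<Otimes>\<^sub>M ?W))"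
  proof (rule nn_integral_mono)
    fix z :: "'a \<times> ('i \<times> 'i \<Rightarrow> real)"
    let ?w = "\<lambda>i. \<Sum>k\<in>K. B i k * snd z k"
    have split: "ennreal (h * u + h * v) = ennreal h * ennreal u + ennreal h * ennreal v"
      if "0 \<le> h" "0 \<le> u" "0 \<le> v" for h u v
      using that by (simp add: ennreal_mult)
    have mid: "exp ((u + v) / 2) \<le> (exp u + exp v) / 2" for u v :: real
      using convex_onD[OF exp_convex, of "1/2" u v] by (simp add: field_simps)
    have "(\<Sum>i\<in>J. \<psi> (Y i (fst z))) \<le> ((\<Sum>i\<in>J. \<psi> (Y i (fst z) + ?w i)) + (\<Sum>i\<in>J. \<psi> (Y i (fst z) - ?w i))) / 2"
      using conv by (simp add: sum.distrib[symmetric] sum_divide_distrib sum_mono)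
    then have "exp (\<Sum>i\<in>J. \<psi> (Y i (fst z))) \<le> exp (((\<Sum>i\<in>J. \<psi> (Y i (fst z) + ?w i)) + (\<Sum>i\<in>J. \<psi> (Y i (fst z) - ?w i))) / 2)"
      by simp
    also have "\<dots> \<le> (exp (\<Sum>i\<in>J. \<psi> (Y i (fst z) + ?w i)) + exp (\<Sum>i\<in>J. \<psi> (Y i (fst z) - ?w i))) / 2" by (rule mid)
    finally have "ennreal (exp (\<Sum>i\<in>J. \<psi> (Y i (fst z)))) \<le>
       ennreal (1/2 * exp (\<Sum>i\<in>J. \<psi> (Y i (fst z) + ?w i)) + 1/2 * exp (\<Sum>i\<in>J. \<psi> (Y i (fst z) - ?w i)))"
      by (intro ennreal_leI) (simp add: field_simps)
    also have "\<dots> = ennreal (1/2) * ennreal (exp (\<Sum>i\<in>J. \<psi> (Y i (fst z) + ?w i))) + ennreal (1/2) * ennreal (exp (\<Sum>i\<in>J. \<psi> (Y i (fst z) - ?w i)))"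
      by (rule split) auto
    finally show "(\<Prod>i\<in>J. ennreal (exp (\<psi> (Y i (fst z))))) \<le> ennreal (1/2) * (\<Prod>i\<in>J. ennreal (exp (\<psi> (Y i (fst z) + 1 * ?w i)))) +
       ennreal (1/2) * (\<Prod>i\<in>J. ennreal (exp (\<psi> (Y i (fst z) + (- 1) * ?w i))))"
      using fin by (simp add: prod_ennreal exp_sum)
  qed
  also have "\<dots> = ennreal (1/2) * I + ennreal (1/2) * I"
  proof -
    have "(- 1 :: real)\<^sup>2 = 1" "(1 :: real)\<^sup>2 = 1" by auto
    then show ?thesis
      by (subst nn_integral_add, simp, simp, subst (1 2) nn_integral_cmult) (simp_all only: law, simp_all)
  qed
  also have "\<dots> = (ennreal (1/2) + ennreal (1/2)) * I" by (simp only: distrib_right)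
  also have "ennreal (1/2) + ennreal (1/2) = 1" by (subst ennreal_plus[symmetric]) auto
  also have "1 * I = I" by simp
  finally show ?thesis unfolding I_def s_def .
qed

end

section \<open>A balanced colouring, and second differences of a concave function\<close>

text \<open>Take a colouring for which the total weight of the pairs of equal colour is minimal. Recolouring a
single point \<open>i\<close> cannot decrease it, so the weight between \<open>i\<close> and its own class is at most the weight
between \<open>i\<close> and any other class, hence at most the average over all \<open>R\<close> classes.\<close>

lemma balanced_colouring:
  fixes w :: "'i \<Rightarrow> 'i \<Rightarrow> real"
  assumes J: "finite J" and sym: "\<And>i k. w i k = w k i" and R: "0 < R"
  obtains col :: "'i \<Rightarrow> nat" where "\<And>i. i \<in> J \<Longrightarrow> col i < R"
    and "\<And>i. i \<in> J \<Longrightarrow> (\<Sum>k\<in>J - {i}. if col k = col i then w i k else 0) \<le> (\<Sum>k\<in>J - {i}. w i k) / real R"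
proof -
  define \<Phi> where "\<Phi> c = (\<Sum>i\<in>J. \<Sum>k\<in>J - {i}. if c k = c i then w i k else 0)" for c :: "'i \<Rightarrow> nat"
  let ?C = "PiE J (\<lambda>_. {..<R})"
  have fC: "finite ?C" using J by (intro finite_PiE) auto
  have nC: "?C \<noteq> {}" using R by (auto simp: PiE_eq_empty_iff)
  obtain c where c: "c \<in> ?C" and min: "\<And>c'. c' \<in> ?C \<Longrightarrow> \<Phi> c \<le> \<Phi> c'"
    by (rule that[OF arg_min_if_finite(1)[OF fC nC, of \<Phi>] arg_min_least[OF fC nC]])
  show thesis
  proof
    fix i assume i: "i \<in> J"
    then show "c i < R" using c by auto
    define S where "S b = (\<Sum>k\<in>J - {i}. if c k = b then w i k else 0)" for b
    define rest where "rest = (\<Sum>j\<in>J - {i}. \<Sum>k\<in>J - {j} - {i}. if c k = c j then w j k else 0)"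
    \<comment> \<open>Only the pairs containing \<open>i\<close> depend on the colour of \<open>i\<close>, and each of them is counted twice.\<close>
    have split: "\<Phi> c' = 2 * S (c' i) + rest" if eq: "\<And>k. k \<noteq> i \<Longrightarrow> c' k = c k" for c'
    proof -
      have "(\<Sum>k\<in>J - {j}. if c' k = c' j then w j k else 0) =
         (if c j = c' i then w i j else 0) + (\<Sum>k\<in>J - {j} - {i}. if c k = c j then w j k else 0)"
        if j: "j \<in> J - {i}" for j
      proof -
        have fj: "finite (J - {j})" "i \<in> J - {j}" using J i j by auto
        have "(\<Sum>k\<in>J - {j}. if c' k = c' j then w j k else 0) = (if c' i = c' j then w j i else 0) +
           (\<Sum>k\<in>J - {j} - {i}. if c' k = c' j then w j k else 0)"
          by (rule sum.remove[OF fj])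
        then show ?thesis using eq[of j] j sym[of i j] eq by (auto intro!: sum.cong)
      qed
      then have "(\<Sum>j\<in>J - {i}. \<Sum>k\<in>J - {j}. if c' k = c' j then w j k else 0) = S (c' i) + rest"
        by (simp add: sum.distrib S_def rest_def)
      moreover have "(\<Sum>k\<in>J - {i}. if c' k = c' i then w i k else 0) = S (c' i)"
        unfolding S_def using eq by (intro sum.cong) auto
      moreover have "\<Phi> c' = (\<Sum>k\<in>J - {i}. if c' k = c' i then w i k else 0) + (\<Sum>j\<in>J - {i}. \<Sum>k\<in>J - {j}. if c' k = c' j then w j k else 0)"
        unfolding \<Phi>_def by (rule sum.remove[OF J i])
      ultimately show ?thesis by simp
    qed
    have le: "S (c i) \<le> S b" if "b < R" for b
    proof -
      have "c(i := b) \<in> ?C" using c that i by (auto simp: PiE_iff extensional_def)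
      from min[OF this] show ?thesis using split[of "c(i := b)"] split[of c] by simp
    qed
    have "real R * S (c i) = (\<Sum>b<R. S (c i))" by simp
    also have "\<dots> \<le> (\<Sum>b<R. S b)" using le by (intro sum_mono) auto
    also have "\<dots> = (\<Sum>k\<in>J - {i}. \<Sum>b<R. if c k = b then w i k else 0)"
      unfolding S_def by (rule sum.swap)
    also have "\<dots> = (\<Sum>k\<in>J - {i}. w i k)"
      using c by (intro sum.cong refl) (auto simp: PiE_iff)
    finally have "real R * S (c i) \<le> (\<Sum>k\<in>J - {i}. w i k)" .
    then show "(\<Sum>k\<in>J - {i}. if c k = c i then w i k else 0) \<le> (\<Sum>k\<in>J - {i}. w i k) / real R"
      using R by (simp add: S_def field_simps)
  qed
qed

lemma concave_on_inner_pair_le: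
  fixes f :: "real \<Rightarrow> real"
  assumes f: "concave_on S f" and xy: "x \<in> S" "y \<in> S" "x \<le> y" and u: "0 \<le> u" "u \<le> y - x"
  shows "f x + f y \<le> f (x + u) + f (y - u)"
proof (cases "x = y")
  case True
  then show ?thesis using u by simp
next
  case False
  define t where "t = u / (y - x)"
  have t: "0 \<le> t" "t \<le> 1" using u xy False by (auto simp: t_def divide_le_eq)
  have ut: "u = t * (y - x)" using False by (simp add: t_def)
  have c: "convex_on S (\<lambda>x. - f x)" using f by (simp add: concave_on_def)
  have "- f ((1 - t) *\<^sub>R x + t *\<^sub>R y) \<le> (1 - t) * - f x + t * - f y"
    "- f ((1 - (1 - t)) *\<^sub>R x + (1 - t) *\<^sub>R y) \<le> (1 - (1 - t)) * - f x + (1 - t) * - f y"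
    using t xy by (intro convex_onD[OF c]; simp)+
  moreover have "(1 - t) *\<^sub>R x + t *\<^sub>R y = x + u" "(1 - (1 - t)) *\<^sub>R x + (1 - t) *\<^sub>R y = y - u"
    by (simp_all add: ut algebra_simps)
  ultimately show ?thesis by (simp add: algebra_simps)
qed

text \<open>With \<open>D t = f t - f (t - h)\<close>, which is nonnegative and decreasing, the second difference at \<open>t\<close> is
\<open>D (t + h) - D t \<le> 0\<close>. As the spacing \<open>s\<close> is at least \<open>h\<close>, the intervals \<open>[j * s, j * s + h]\<close> do not overlap and the
sum telescopes to at most \<open>D s \<le> D h = f h\<close>.\<close>

lemma concave_second_differences_sum_le:
  fixes f :: "real \<Rightarrow> real"
  assumes f: "concave_on {0..\<delta>} f" and mono: "mono_on {0..\<delta>} f" and f0: "f 0 = 0"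
    and h: "0 < h" "h \<le> s" and n: "real n * s + h \<le> \<delta>"
  shows "(\<Sum>j\<in>{1..n}. \<bar>f (real j * s + h) + f (real j * s - h) - 2 * f (real j * s)\<bar>) \<le> f h"
proof -
  define D where "D t = f t - f (t - h)" for t
  have anti: "D t' \<le> D t" if "h \<le> t" "t \<le> t'" "t' \<le> \<delta>" for t t'
    using concave_on_inner_pair_le[OF f, of "t - h" t' h] that h by (simp add: D_def)
  have D0: "0 \<le> D t" if "h \<le> t" "t \<le> \<delta>" for t
    using mono_onD[OF mono, of "t - h" t] that h by (simp add: D_def)
  have js: "real j * s \<le> real n * s" "s \<le> real j * s" if "1 \<le> j" "j \<le> n" for j
    using that h by (auto intro: mult_right_mono simp: mult_le_cancel_right1)
  have "m \<le> n \<Longrightarrow> 1 \<le> m \<Longrightarrow> (\<Sum>j\<in>{1..m}. \<bar>f (real j * s + h) + f (real j * s - h) - 2 * f (real j * s)\<bar>) \<le> D s - D (real m * s + h)" for m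
  proof (induction m)
    case (Suc m)
    have "\<bar>f (real (Suc m) * s + h) + f (real (Suc m) * s - h) - 2 * f (real (Suc m) * s)\<bar> = D (real (Suc m) * s) - D (real (Suc m) * s + h)"
    proof -
      have "h \<le> real (Suc m) * s" "real (Suc m) * s + h \<le> \<delta>" 
        using js(1)[OF _ Suc.prems(1)] js(2)[OF _ Suc.prems(1)] h n by linarith+
      then have "D (real (Suc m) * s + h) \<le> D (real (Suc m) * s)" using h by (intro anti) auto
      then show ?thesis unfolding D_def by simp
    qed
    moreover have "(\<Sum>j\<in>{1..m}. \<bar>f (real j * s + h) + f (real j * s - h) - 2 * f (real j * s)\<bar>) \<le> D s - D (real (Suc m) * s)"
    proof (cases "m = 0")
      case True
      then show ?thesis by simp
    next
      case False
      then have "(\<Sum>j\<in>{1..m}. \<bar>f (real j * s + h) + f (real j * s - h) - 2 * f (real j * s)\<bar>) \<le> D s - D (real m * s + h)"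
        using Suc by auto
      moreover have "D (real (Suc m) * s) \<le> D (real m * s + h)"
        using False js[of m] js[of "Suc m"] Suc.prems h n by (intro anti) (auto simp: algebra_simps)
      ultimately show ?thesis by simp
    qed
    ultimately show ?case by simp
  qed simp
  note tele = this
  show ?thesis
  proof (cases "n = 0")
    case True
    then show ?thesis using mono_onD[OF mono, of 0 h] h n f0 by simp
  next
    case False
    have "(\<Sum>j\<in>{1..n}. \<bar>f (real j * s + h) + f (real j * s - h) - 2 * f (real j * s)\<bar>) \<le> D s - D (real n * s + h)"
      using tele[of n] False by simp
    also have "\<dots> \<le> D s" using D0[of "real n * s + h"] js[of n] False h n by simp
    also have "\<dots> \<le> D h" 
    proof -
      have "s \<le> real n * s" using js(2)[of n] False by linarith
      then show ?thesis using anti[of h s] h n by linarith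
    qed
    also have "D h = f h" by (simp add: D_def f0)
    finally show ?thesis .
  qed
qed

lemma sum_distance_le:
  fixes F :: "nat \<Rightarrow> real"
  assumes "i < n" and F: "\<And>j. 0 \<le> F j"
  shows "(\<Sum>k\<in>{..<n} - {i}. F (nat \<bar>int i - int k\<bar>)) \<le> 2 * (\<Sum>j\<in>{1..n - 1}. F j)"
proof -
  have eq: "{..<n} - {i} = {..<i} \<union> {i<..<n}" using assms by auto
  have "(\<Sum>k\<in>{..<n} - {i}. F (nat \<bar>int i - int k\<bar>)) = (\<Sum>k\<in>{..<i}. F (nat \<bar>int i - int k\<bar>)) + (\<Sum>k\<in>{i<..<n}. F (nat \<bar>int i - int k\<bar>))"
    unfolding eq by (rule sum.union_disjoint) auto
  moreover have "(\<Sum>k\<in>{..<i}. F (nat \<bar>int i - int k\<bar>)) = (\<Sum>j\<in>{1..i}. F j)"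
    by (rule sum.reindex_bij_witness[of _ "\<lambda>j. i - j" "\<lambda>k. i - k"]) (auto simp: nat_diff_distrib')
  moreover have "(\<Sum>k\<in>{i<..<n}. F (nat \<bar>int i - int k\<bar>)) = (\<Sum>j\<in>{1..n - 1 - i}. F j)"
    by (rule sum.reindex_bij_witness[of _ "\<lambda>j. i + j" "\<lambda>k. k - i"]) (auto simp: nat_diff_distrib')
  moreover have "(\<Sum>j\<in>{1..i}. F j) \<le> (\<Sum>j\<in>{1..n - 1}. F j)" using assms by (intro sum_mono2) auto
  moreover have "(\<Sum>j\<in>{1..n - 1 - i}. F j) \<le> (\<Sum>j\<in>{1..n - 1}. F j)" using assms by (intro sum_mono2) auto
  ultimately show ?thesis by linarith
qed

section \<open>Moments of the normal distribution and a truncated power\<close>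

text \<open>The power and the linear exponential are absorbed by \<open>exp (x\<^sup>2 / 8)\<close> up to a constant, and \<open>exp (x\<^sup>2 / 4)\<close> is
integrable against the normal density. The factor \<open>exp (x\<^sup>2 / 8)\<close> in the statement is what turns a
truncation at level \<open>T\<close> into a factor \<open>exp (- T\<^sup>2 / 8)\<close>.\<close>

lemma integrable_std_normal_powr_exp:
  assumes "0 \<le> a" "0 \<le> b"
  shows "integrable std_normal_distribution (\<lambda>x. \<bar>x\<bar> powr a * exp (b * \<bar>x\<bar> + x\<^sup>2 / 8))"
proof -
  interpret S: real_distribution std_normal_distribution by (rule real_dist_normal_dist)
  have "integrable lborel (\<lambda>x. sqrt 2 * normal_density 0 (sqrt 2) x)"
    by (intro integrable_mult_right integrable_normal_density) simp
  also have "(\<lambda>x. sqrt 2 * normal_density 0 (sqrt 2) x) = (\<lambda>x. std_normal_density x * exp (x\<^sup>2 / 4))"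
    by (auto simp: fun_eq_iff normal_density_def exp_add[symmetric] real_sqrt_mult field_simps)
  finally have "integrable std_normal_distribution (\<lambda>x. exp (x\<^sup>2 / 4))"
    by (simp add: integrable_density)
  then have "integrable std_normal_distribution (\<lambda>x. exp (2 * (a + b)\<^sup>2) * exp (x\<^sup>2 / 4))" by simp
  then show ?thesis
  proof (rule Bochner_Integration.integrable_bound)
    show "AE x in std_normal_distribution. norm (\<bar>x\<bar> powr a * exp (b * \<bar>x\<bar> + x\<^sup>2 / 8)) \<le> norm (exp (2 * (a + b)\<^sup>2) * exp (x\<^sup>2 / 4))"
    proof (rule AE_I2)
      fix x :: real
      have "\<bar>x\<bar> \<le> exp \<bar>x\<bar>" using exp_ge_add_one_self[of "\<bar>x\<bar>"] by linarith
      then have "\<bar>x\<bar> powr a \<le> exp \<bar>x\<bar> powr a"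
        using assms by (intro powr_mono2) auto
      then have 1: "\<bar>x\<bar> powr a \<le> exp (a * \<bar>x\<bar>)" by (simp add: exp_powr_real mult.commute)
      have "0 \<le> (\<bar>x\<bar> / 2 - 2 * (a + b))\<^sup>2" by simp
      then have 2: "(a + b) * \<bar>x\<bar> \<le> x\<^sup>2 / 8 + 2 * (a + b)\<^sup>2"
        by (simp add: power2_eq_square algebra_simps)
      have "\<bar>x\<bar> powr a * exp (b * \<bar>x\<bar> + x\<^sup>2 / 8) \<le> exp (a * \<bar>x\<bar>) * exp (b * \<bar>x\<bar> + x\<^sup>2 / 8)"
        using 1 by (rule mult_right_mono) simp
      also have "\<dots> = exp ((a + b) * \<bar>x\<bar> + x\<^sup>2 / 8)" by (simp add: exp_add[symmetric] algebra_simps)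
      also have "\<dots> \<le> exp (2 * (a + b)\<^sup>2 + x\<^sup>2 / 4)" using 2 by simp
      finally show "norm (\<bar>x\<bar> powr a * exp (b * \<bar>x\<bar> + x\<^sup>2 / 8)) \<le> norm (exp (2 * (a + b)\<^sup>2) * exp (x\<^sup>2 / 4))"
        by (simp add: exp_add)
    qed
  qed measurable
qed

lemma integrable_std_normal_powr:
  assumes "0 \<le> a" "0 \<le> b"
  shows "integrable std_normal_distribution (\<lambda>x. \<bar>x\<bar> powr a * exp (b * \<bar>x\<bar>))"
    and "integrable std_normal_distribution (\<lambda>x. \<bar>x\<bar> powr a)"
proof -
  show "integrable std_normal_distribution (\<lambda>x. \<bar>x\<bar> powr a * exp (b * \<bar>x\<bar>))"
    by (rule Bochner_Integration.integrable_bound[OF integrable_std_normal_powr_exp[OF assms]])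
       (auto simp: mult_left_mono)
  have "0 \<le> b * \<bar>x\<bar> + x\<^sup>2 / 8" for x using assms by simp
  then have "\<bar>x\<bar> powr a * 1 \<le> \<bar>x\<bar> powr a * exp (b * \<bar>x\<bar> + x\<^sup>2 / 8)" for x
    by (intro mult_left_mono) simp_all
  then show "integrable std_normal_distribution (\<lambda>x. \<bar>x\<bar> powr a)"
    by (intro Bochner_Integration.integrable_bound[OF integrable_std_normal_powr_exp[OF assms]])
       (auto)
qed

text \<open>The second-order expansion of the exponential gives
\<open>E (exp (- \<theta> V)) \<le> exp (- \<theta> E V + \<theta>\<^sup>2 E (V\<^sup>2) / 2)\<close>; for small \<open>\<theta>\<close> the linear term wins, because \<open>c < E V\<close>.\<close>

lemma (in prob_space) exp_lower_moment:
  assumes V: "\<And>x. 0 \<le> V x" and i: "integrable M V" "integrable M (\<lambda>x. (V x)\<^sup>2)" and c: "c < expectation V"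
  obtains \<theta> :: real where "0 < \<theta>" "(\<integral>\<^sup>+x. ennreal (exp (\<theta> * (c - V x))) \<partial>M) \<le> 1"
proof -
  have [measurable]: "V \<in> borel_measurable M" using i by auto
  define m where "m = expectation (\<lambda>x. (V x)\<^sup>2)"
  have m: "0 \<le> m" by (simp add: m_def)
  define \<theta> where "\<theta> = (expectation V - c) / (m + 1)"
  have \<theta>: "0 < \<theta>" using c m by (simp add: \<theta>_def)
  have exp_bound: "exp (- x) \<le> 1 - x + x\<^sup>2 / 2" if "0 \<le> x" for x :: real
  proof -
    \<comment> \<open>The product is \<open>1 + x ^ 4 / 4\<close>.\<close>
    have "1 \<le> (1 - x + x\<^sup>2 / 2) * (1 + x + x\<^sup>2 / 2)"
    proof -
      have "(1 - x + x\<^sup>2 / 2) * (1 + x + x\<^sup>2 / 2) = 1 + (x\<^sup>2)\<^sup>2 / 4" by (simp add: power2_eq_square field_simps)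
      then show ?thesis by simp
    qed
    also have "\<dots> \<le> (1 - x + x\<^sup>2 / 2) * exp x"
    proof (rule mult_left_mono)
      show "1 + x + x\<^sup>2 / 2 \<le> exp x" using exp_lower_Taylor_quadratic[OF that] .
      have "0 \<le> (1 - x)\<^sup>2 + 1" by (simp add: add_nonneg_nonneg)
      then show "0 \<le> 1 - x + x\<^sup>2 / 2" by (simp add: power2_eq_square field_simps)
    qed
    finally show ?thesis by (simp add: exp_minus field_simps)
  qed
  have int: "integrable M (\<lambda>x. exp (\<theta> * (c - V x)))"
  proof (rule integrable_const_bound[of _ "exp (\<theta> * c)"])
    show "AE x in M. norm (exp (\<theta> * (c - V x))) \<le> exp (\<theta> * c)" using V \<theta> by (auto simp: mult_left_mono)
  qed simp
  have "expectation (\<lambda>x. exp (\<theta> * (c - V x))) \<le> expectation (\<lambda>x. exp (\<theta> * c) * (1 - \<theta> * V x + \<theta>\<^sup>2 / 2 * (V x)\<^sup>2))"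
  proof (rule integral_mono[OF int])
    show "integrable M (\<lambda>x. exp (\<theta> * c) * (1 - \<theta> * V x + \<theta>\<^sup>2 / 2 * (V x)\<^sup>2))" using i by simp
    show "exp (\<theta> * (c - V x)) \<le> exp (\<theta> * c) * (1 - \<theta> * V x + \<theta>\<^sup>2 / 2 * (V x)\<^sup>2)" for x
    proof -
      have "exp (\<theta> * (c - V x)) = exp (\<theta> * c) * exp (- (\<theta> * V x))" by (simp add: exp_add[symmetric] algebra_simps)
      also have "\<dots> \<le> exp (\<theta> * c) * (1 - \<theta> * V x + (\<theta> * V x)\<^sup>2 / 2)"
        using V \<theta> by (intro mult_left_mono exp_bound) auto
      finally show ?thesis by (simp add: power_mult_distrib)
    qed
  qed
  also have "\<dots> = exp (\<theta> * c) * (1 + (- \<theta> * expectation V + \<theta>\<^sup>2 / 2 * m))"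
    using i by (simp add: m_def prob_space)
  also have "\<dots> \<le> exp (\<theta> * c) * exp (- \<theta> * expectation V + \<theta>\<^sup>2 / 2 * m)"
    by (intro mult_left_mono exp_ge_add_one_self) simp
  also have "\<dots> = exp (\<theta> * (c - expectation V + \<theta> / 2 * m))" by (simp add: exp_add[symmetric] power2_eq_square algebra_simps)
  also have "\<dots> \<le> 1"
  proof -
    have "\<theta> / 2 * m \<le> \<theta> * (m + 1)" using \<theta> m by (simp add: field_simps)
    also have "\<dots> = expectation V - c" using m by (simp add: \<theta>_def)
    finally show ?thesis using \<theta> by (simp add: mult_nonneg_nonpos)
  qed
  finally have "(\<integral>\<^sup>+x. ennreal (exp (\<theta> * (c - V x))) \<partial>M) \<le> 1"
    using int by (simp add: nn_integral_eq_integral)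
  then show ?thesis using that \<theta> by blast
qed

lemma powr_tangent_le:
  fixes u v p :: real
  assumes "1 \<le> p" "0 \<le> u" "0 \<le> v"
  shows "u powr p + p * u powr (p - 1) * (v - u) \<le> v powr p"
proof -
  consider "u = 0" | "0 < u" "v = 0" | "0 < u" "0 < v" using assms by linarith
  then show ?thesis
  proof cases
    case 1
    then show ?thesis by simp
  next
    case 2
    have "u powr p = u * u powr (p - 1)" using 2 by (simp add: powr_mult_base)
    then show ?thesis using 2 assms by (simp add: algebra_simps)
  next
    case 3
    have "p * u powr (p - 1) * (v - u) \<le> v powr p - u powr p"
    proof (rule convex_on_imp_above_tangent[OF powr_convex[OF assms(1)]])
      show "((\<lambda>x. x powr p) has_real_derivative p * u powr (p - 1)) (at u within {0<..})"
        using 3 by (auto intro!: derivative_eq_intros)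
    qed (use 3 in \<open>auto simp: interior_open\<close>)
    then show ?thesis by simp
  qed
qed

text \<open>The power \<open>\<bar>y\<bar> powr p\<close> for \<open>\<bar>y\<bar> \<le> T\<close>, continued by its tangent line for \<open>\<bar>y\<bar> > T\<close>. This form, without a case
distinction, makes continuity evident.\<close>

definition truncated_powr :: "real \<Rightarrow> real \<Rightarrow> real \<Rightarrow> real" where
  "truncated_powr p T y = min \<bar>y\<bar> T powr p + p * T powr (p - 1) * max 0 (\<bar>y\<bar> - T)"

lemma continuous_truncated_powr: "1 \<le> p \<Longrightarrow> 0 \<le> T \<Longrightarrow> continuous_on UNIV (truncated_powr p T)"
  unfolding truncated_powr_def by (intro continuous_intros continuous_on_powr') auto

lemma truncated_powr_bounds:
  assumes "1 \<le> p" "0 < T"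
  shows "0 \<le> truncated_powr p T y" "truncated_powr p T y \<le> \<bar>y\<bar> powr p"
    "truncated_powr p T y \<le> p * T powr (p - 1) * \<bar>y\<bar>"
    "\<bar>y\<bar> powr p \<le> truncated_powr p T y + exp (- T\<^sup>2 / 8) * (\<bar>y\<bar> powr p * exp (y\<^sup>2 / 8))"
proof -
  show nn: "0 \<le> truncated_powr p T y" using assms by (simp add: truncated_powr_def)
  show "truncated_powr p T y \<le> \<bar>y\<bar> powr p"
    using powr_tangent_le[of p T "\<bar>y\<bar>"] assms by (simp add: truncated_powr_def min_def max_def)
  show "truncated_powr p T y \<le> p * T powr (p - 1) * \<bar>y\<bar>"
  proof (cases "\<bar>y\<bar> \<le> T")
    case True
    have "\<bar>y\<bar> powr p = \<bar>y\<bar> * \<bar>y\<bar> powr (p - 1)" by (simp add: powr_mult_base)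
    also have "\<dots> \<le> \<bar>y\<bar> * T powr (p - 1)" using True assms by (intro mult_left_mono powr_mono2) auto
    also have "\<dots> \<le> p * (\<bar>y\<bar> * T powr (p - 1))"
      using assms mult_right_mono[of 1 p "\<bar>y\<bar> * T powr (p - 1)"] by simp
    finally show ?thesis using True by (simp add: truncated_powr_def mult_ac)
  next
    case False
    have "T powr p = T * T powr (p - 1)" using assms by (simp add: powr_mult_base)
    moreover have "T * T powr (p - 1) \<le> p * (T * T powr (p - 1))"
      using assms mult_right_mono[of 1 p "T * T powr (p - 1)"] by simp
    ultimately show ?thesis using False by (simp add: truncated_powr_def algebra_simps)
  qed
  show "\<bar>y\<bar> powr p \<le> truncated_powr p T y + exp (- T\<^sup>2 / 8) * (\<bar>y\<bar> powr p * exp (y\<^sup>2 / 8))"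
  proof (cases "\<bar>y\<bar> \<le> T")
    case True
    then show ?thesis using assms by (simp add: truncated_powr_def)
  next
    case False
    then have "T\<^sup>2 \<le> y\<^sup>2" using assms by (auto simp: abs_le_square_iff[symmetric])
    then have "1 \<le> exp (- T\<^sup>2 / 8) * exp (y\<^sup>2 / 8)" by (simp add: exp_add[symmetric])
    then have "\<bar>y\<bar> powr p * 1 \<le> \<bar>y\<bar> powr p * (exp (- T\<^sup>2 / 8) * exp (y\<^sup>2 / 8))" by (intro mult_left_mono) auto
    then show ?thesis using nn by (simp add: mult_ac)
  qed
qed

text \<open>As a function of \<open>\<bar>y\<bar>\<close>, the truncated power lies above its tangents, whose slopes \<open>d\<close> are nonnegative; and
\<open>\<bar>x + w\<bar> + \<bar>x - w\<bar> \<ge> 2 * \<bar>x\<bar>\<close>.\<close>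

lemma truncated_powr_midpoint:
  assumes p: "1 \<le> p" and T: "0 < T"
  shows "truncated_powr p T x \<le> (truncated_powr p T (x + w) + truncated_powr p T (x - w)) / 2"
proof -
  define d where "d = p * min \<bar>x\<bar> T powr (p - 1)"
  have d: "0 \<le> d" using p by (simp add: d_def)
  have slope: "truncated_powr p T x + d * (\<bar>z\<bar> - \<bar>x\<bar>) \<le> truncated_powr p T z" for z
  proof -
    have m: "u powr (p - 1) \<le> T powr (p - 1)" if "0 \<le> u" "u \<le> T" for u
      using that p by (intro powr_mono2) auto
    consider "\<bar>x\<bar> \<le> T" "\<bar>z\<bar> \<le> T" | "\<bar>x\<bar> \<le> T" "T < \<bar>z\<bar>" | "T < \<bar>x\<bar>" "\<bar>z\<bar> \<le> T" | "T < \<bar>x\<bar>" "T < \<bar>z\<bar>"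
      by linarith
    then show ?thesis
    proof cases
      case 1
      then show ?thesis using powr_tangent_le[of p "\<bar>x\<bar>" "\<bar>z\<bar>"] p by (simp add: truncated_powr_def d_def)
    next
      case 2
      have "d * (\<bar>z\<bar> - \<bar>x\<bar>) = p * \<bar>x\<bar> powr (p - 1) * (T - \<bar>x\<bar>) + p * \<bar>x\<bar> powr (p - 1) * (\<bar>z\<bar> - T)"
        using 2 by (simp add: d_def algebra_simps)
      also have "p * \<bar>x\<bar> powr (p - 1) * (\<bar>z\<bar> - T) \<le> p * T powr (p - 1) * (\<bar>z\<bar> - T)"
        using 2 p m[of "\<bar>x\<bar>"] by (intro mult_right_mono mult_left_mono) auto
      finally show ?thesis using 2 powr_tangent_le[of p "\<bar>x\<bar>" T] p T by (simp add: truncated_powr_def)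
    next
      case 3
      then show ?thesis using powr_tangent_le[of p T "\<bar>z\<bar>"] p T by (simp add: truncated_powr_def d_def algebra_simps)
    next
      case 4
      then show ?thesis by (simp add: truncated_powr_def d_def algebra_simps)
    qed
  qed
  define u v where "u = d * (\<bar>x + w\<bar> - \<bar>x\<bar>)" and "v = d * (\<bar>x - w\<bar> - \<bar>x\<bar>)"
  have "0 \<le> u + v"
    using d unfolding u_def v_def distrib_left[symmetric] by (intro mult_nonneg_nonneg) auto
  then show ?thesis using slope[of "x + w", folded u_def] slope[of "x - w", folded v_def] by simp
qed

text \<open>The condition on \<open>\<theta>\<close> makes \<open>\<theta>\<close> times the truncated power at most \<open>2 * \<bar>z\<bar>\<close>, so the quadratic remainder of
the exponential series is bounded by \<open>\<theta>\<^sup>2\<close> times a fixed integrable function. It is essential that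
\<open>B\<close> does not depend on \<open>T\<close>: later \<open>T\<close> tends to infinity.\<close>

lemma truncated_powr_exp_moment:
  assumes p: "1 \<le> p"
  obtains B :: real where "0 \<le> B" and
    "\<And>T \<theta> r. 0 < T \<Longrightarrow> 0 < \<theta> \<Longrightarrow> \<theta> * (p * T powr (p - 1)) \<le> 1 \<Longrightarrow> 0 \<le> r \<Longrightarrow> r \<le> 2 \<Longrightarrow>
      (\<integral>\<^sup>+z. ennreal (exp (\<theta> * truncated_powr p T (r * z))) \<partial>std_normal_distribution) \<le>
      ennreal (exp (\<theta> * (r powr p * (\<integral>z. \<bar>z\<bar> powr p \<partial>std_normal_distribution)) + \<theta>\<^sup>2 * B))"
proof
  interpret S: real_distribution std_normal_distribution by (rule real_dist_normal_dist)
  let ?N = std_normal_distribution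
  define b where "b z = (2 powr p)\<^sup>2 * (\<bar>z\<bar> powr (2 * p) * exp (2 * \<bar>z\<bar>))" for z :: real
  define B where "B = (\<integral>z. b z \<partial>?N)"
  have ib: "integrable ?N b" unfolding b_def[abs_def] using p integrable_std_normal_powr(1)[of "2 * p" 2] by simp
  show "0 \<le> B" unfolding B_def b_def by simp
  fix T \<theta> r :: real assume T: "0 < T" and \<theta>: "0 < \<theta>" "\<theta> * (p * T powr (p - 1)) \<le> 1" and r: "0 \<le> r" "r \<le> 2"
  let ?V = "\<lambda>z. truncated_powr p T (r * z)"
  have [measurable]: "truncated_powr p T \<in> borel_measurable borel"
    using continuous_truncated_powr p T by (intro borel_measurable_continuous_onI) simp
  note tb = truncated_powr_bounds[OF p T]
  have e: "exp x \<le> 1 + x + x\<^sup>2 * exp x" if "0 \<le> x" for x :: real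
  proof -
    have "1 - x \<le> exp (- x)" using exp_ge_add_one_self[of "- x"] by simp
    then have "(1 - x) * exp x \<le> exp (- x) * exp x" by (rule mult_right_mono) simp
    then have 1: "exp x - 1 \<le> x * exp x" by (simp add: exp_minus algebra_simps)
    have "x * (exp x - 1) \<le> x * (x * exp x)" using that 1 by (rule mult_left_mono[rotated])
    then show ?thesis using 1 by (simp add: power2_eq_square algebra_simps)
  qed
  have bound: "exp (\<theta> * ?V z) \<le> 1 + \<theta> * (r powr p * \<bar>z\<bar> powr p) + \<theta>\<^sup>2 * b z" for z
  proof -
    have V: "0 \<le> ?V z" "?V z \<le> r powr p * \<bar>z\<bar> powr p"
      using tb(1,2)[of "r * z"] r by (auto simp: abs_mult powr_mult)
    have "\<theta> * ?V z \<le> \<theta> * (p * T powr (p - 1) * \<bar>r * z\<bar>)" using \<theta> tb(3) by (intro mult_left_mono) auto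
    also have "\<dots> = (\<theta> * (p * T powr (p - 1))) * \<bar>r * z\<bar>" by (simp add: mult_ac)
    also have "\<dots> \<le> 1 * \<bar>r * z\<bar>" using \<theta> by (intro mult_right_mono) auto
    also have "\<dots> \<le> 2 * \<bar>z\<bar>" using r by (simp add: abs_mult mult_right_mono)
    finally have "exp (\<theta> * ?V z) \<le> exp (2 * \<bar>z\<bar>)" by simp
    moreover have "(?V z)\<^sup>2 \<le> (2 powr p * \<bar>z\<bar> powr p)\<^sup>2"
    proof (rule power_mono[OF _ V(1)])
      have "r powr p \<le> 2 powr p" using r p by (intro powr_mono2) auto
      then show "?V z \<le> 2 powr p * \<bar>z\<bar> powr p" using V(2) by (meson mult_right_mono order_trans powr_ge_zero)
    qed
    ultimately have "(?V z)\<^sup>2 * exp (\<theta> * ?V z) \<le> (2 powr p * \<bar>z\<bar> powr p)\<^sup>2 * exp (2 * \<bar>z\<bar>)"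
      by (intro mult_mono) auto
    also have "\<dots> = b z"
    proof -
      have "\<bar>z\<bar> powr (2 * p) = (\<bar>z\<bar> powr p)\<^sup>2" by (simp add: power2_eq_square flip: powr_add)
      then show ?thesis by (simp add: b_def power_mult_distrib)
    qed
    finally have "\<theta>\<^sup>2 * ((?V z)\<^sup>2 * exp (\<theta> * ?V z)) \<le> \<theta>\<^sup>2 * b z" by (rule mult_left_mono) simp
    moreover have "\<theta> * ?V z \<le> \<theta> * (r powr p * \<bar>z\<bar> powr p)" using V \<theta> by (intro mult_left_mono) auto
    moreover have "exp (\<theta> * ?V z) \<le> 1 + \<theta> * ?V z + \<theta>\<^sup>2 * ((?V z)\<^sup>2 * exp (\<theta> * ?V z))"
      using e[of "\<theta> * ?V z"] V \<theta> by (simp add: power_mult_distrib mult.assoc)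
    ultimately show ?thesis by linarith
  qed
  have i1: "integrable ?N (\<lambda>z. \<bar>z\<bar> powr p)" using integrable_std_normal_powr(2)[of p 0] p by simp
  have i: "integrable ?N (\<lambda>z. 1 + \<theta> * (r powr p * \<bar>z\<bar> powr p) + \<theta>\<^sup>2 * b z)" using ib i1 by simp
  have "(\<integral>\<^sup>+z. ennreal (exp (\<theta> * ?V z)) \<partial>?N) \<le> (\<integral>\<^sup>+z. ennreal (1 + \<theta> * (r powr p * \<bar>z\<bar> powr p) + \<theta>\<^sup>2 * b z) \<partial>?N)"
    using bound by (intro nn_integral_mono ennreal_leI)
  also have "\<dots> = ennreal (\<integral>z. 1 + \<theta> * (r powr p * \<bar>z\<bar> powr p) + \<theta>\<^sup>2 * b z \<partial>?N)"
    using \<theta> r by (intro nn_integral_eq_integral i AE_I2) (simp add: b_def)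
  also have "(\<integral>z. 1 + \<theta> * (r powr p * \<bar>z\<bar> powr p) + \<theta>\<^sup>2 * b z \<partial>?N) =
      1 + (\<theta> * (r powr p * (\<integral>z. \<bar>z\<bar> powr p \<partial>?N)) + \<theta>\<^sup>2 * B)"
    using i1 ib S.prob_space by (simp add: B_def)
  also have "\<dots> \<le> exp (\<theta> * (r powr p * (\<integral>z. \<bar>z\<bar> powr p \<partial>?N)) + \<theta>\<^sup>2 * B)" by (rule exp_ge_add_one_self)
  finally show "(\<integral>\<^sup>+z. ennreal (exp (\<theta> * ?V z)) \<partial>?N) \<le>
      ennreal (exp (\<theta> * (r powr p * (\<integral>z. \<bar>z\<bar> powr p \<partial>?N)) + \<theta>\<^sup>2 * B))"
    by (simp add: ennreal_leI)
qed

section \<open>Normalised increments of the process\<close>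

lemma gaussian_rv_cong_AE:
  assumes X: "gaussian_rv M X" and [measurable]: "Y \<in> borel_measurable M" and ae: "AE \<omega> in M. X \<omega> = Y \<omega>"
  shows "gaussian_rv M Y"
proof -
  have [measurable]: "X \<in> borel_measurable M" using X by (simp add: gaussian_rv_def)
  have "distributed M lborel Y d" if "distributed M lborel X d" for d
  proof -
    have "distr M lborel X = distr M lborel Y" using ae by (intro distr_cong_AE) auto
    then show ?thesis using that by (auto simp: distributed_def)
  qed
  moreover have "AE \<omega> in M. Y \<omega> = m" if "AE \<omega> in M. X \<omega> = m" for m
    using ae that by eventually_elim simp
  ultimately show ?thesis using X assms(2) unfolding gaussian_rv_def by blast
qed

lemma exp_average_le_sum:
  fixes x :: "nat \<Rightarrow> real"
  assumes R: "0 < R"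
  shows "exp ((\<Sum>r<R. x r) / real R) \<le> (\<Sum>r<R. exp (x r)) / real R"
proof -
  define m where "m = (\<Sum>r<R. x r) / real R"
  have "exp m * (1 + (x r - m)) \<le> exp (x r)" for r
  proof -
    have "exp m * (1 + (x r - m)) \<le> exp m * exp (x r - m)" by (intro mult_left_mono exp_ge_add_one_self) simp
    then show ?thesis by (simp add: exp_add[symmetric])
  qed
  then have "(\<Sum>r<R. exp m * (1 + (x r - m))) \<le> (\<Sum>r<R. exp (x r))" by (intro sum_mono)
  also have "(\<Sum>r<R. exp m * (1 + (x r - m))) = exp m * real R"
    using R by (simp add: sum_distrib_left[symmetric] sum.distrib sum_subtractf m_def)
  finally show ?thesis using R by (simp add: m_def field_simps)
qed

lemma exp_average_le_integral:
  fixes w :: "real \<Rightarrow> real"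
  assumes s: "0 < s" and w: "continuous_on {0..s} w"
  shows "exp (integral {0..s} w / s) \<le> integral {0..s} (\<lambda>x. exp (w x)) / s"
proof -
  define m where "m = integral {0..s} w / s"
  have i: "w integrable_on {0..s}" using w by (rule integrable_continuous_real)
  have "integral {0..s} (\<lambda>x. exp m * ((1 - m) + w x)) \<le> integral {0..s} (\<lambda>x. exp (w x))"
  proof (rule integral_le)
    show "(\<lambda>x. exp m * ((1 - m) + w x)) integrable_on {0..s}" "(\<lambda>x. exp (w x)) integrable_on {0..s}"
      using w by (auto intro!: integrable_continuous_real continuous_intros)
    fix x
    have "exp m * (1 + (w x - m)) \<le> exp m * exp (w x - m)" by (intro mult_left_mono exp_ge_add_one_self) simp
    then show "exp m * ((1 - m) + w x) \<le> exp (w x)" by (simp add: exp_add[symmetric] algebra_simps)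
  qed
  also have "integral {0..s} (\<lambda>x. exp m * ((1 - m) + w x)) = exp m * ((1 - m) * s + m * s)"
  proof -
    have "integral {0..s} (\<lambda>x. (1 - m) + w x) = integral {0..s} (\<lambda>x. 1 - m) + integral {0..s} w"
      by (intro integral_add integrable_const_ivl i)
    then show ?thesis using s by (simp add: m_def)
  qed
  finally show ?thesis using s by (simp add: m_def field_simps)
qed

text \<open>Folds an interval of length \<open>n * s\<close> onto \<open>[0, s]\<close>: the integrand becomes the sum over
the lattice with offset \<open>x\<close> and spacing \<open>s\<close>.\<close>

lemma integral_sum_translates:
  fixes v :: "real \<Rightarrow> real"
  assumes v: "continuous_on UNIV v" and s: "0 < s"
  shows "integral {a..a + real n * s} v = integral {0..s} (\<lambda>x. \<Sum>i<n. v (a + x + real i * s))"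
proof -
  have vi: "v integrable_on {c..d}" for c d using v by (intro integrable_continuous_real) (rule continuous_on_subset, auto)
  have cs: "continuous_on {0..s} (\<lambda>x. v (a + x + real i * s))" for i
    by (rule continuous_on_compose2[OF v]) (auto intro!: continuous_intros)
  show ?thesis
  proof (induction n)
    case (Suc n)
    have "integral {a..a + real (Suc n) * s} v = integral {a..a + real n * s} v + integral {a + real n * s..a + real (Suc n) * s} v"
      using s by (intro Henstock_Kurzweil_Integration.integral_combine[symmetric] vi) (auto simp: algebra_simps)
    also have "integral {a + real n * s..a + real (Suc n) * s} v = integral {0..s} (\<lambda>x. v (a + x + real n * s))"
    proof -
      have "integral {0..s} (v \<circ> (\<lambda>x. x + (a + real n * s))) = integral {0 + (a + real n * s)..s + (a + real n * s)} v"
        by (rule integral_shift) (rule continuous_on_subset[OF v], simp)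
      then show ?thesis by (simp add: comp_def algebra_simps)
    qed
    finally show ?case using Suc cs by (simp add: integral_add integrable_continuous_real continuous_on_sum)
  qed simp
qed

lemma nn_integral_Icc_continuous:
  fixes v :: "real \<Rightarrow> real"
  assumes v: "continuous_on {a..b} v" and v0: "\<And>x. 0 \<le> v x"
  shows "(\<integral>\<^sup>+x\<in>{a..b}. ennreal (v x) \<partial>lborel) = ennreal (integral {a..b} v)"
proof -
  have si: "set_integrable lborel {a..b} v" using v by (intro borel_integrable_atLeastAtMost') 
  have "(\<integral>\<^sup>+x\<in>{a..b}. ennreal (v x) \<partial>lborel) = (\<integral>\<^sup>+x. ennreal (indicator {a..b} x *\<^sub>R v x) \<partial>lborel)"
    by (intro nn_integral_cong) (auto simp: indicator_def)
  also have "\<dots> = ennreal (LBINT x:{a..b}. v x)"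
    using si v0 unfolding set_integrable_def set_lebesgue_integral_def
    by (intro nn_integral_eq_integral) auto
  also have "(LBINT x:{a..b}. v x) = integral {a..b} v" by (rule set_borel_integral_eq_integral(2)[OF si])
  finally show ?thesis .
qed

text \<open>A version of the process all of whose paths are continuous. Of the stationarity of the increments only
the form of their variance is kept.\<close>

locale stationary_gaussian = prob_space M for M :: "'a measure" +
  fixes X :: "real \<Rightarrow> 'a \<Rightarrow> real" and f :: "real \<Rightarrow> real" and \<delta> :: real
  assumes gauss: "gaussian_process M X" and mean: "mean_zero M X"
    and cont: "\<And>\<omega>. continuous_on UNIV (\<lambda>x. X x \<omega>)"
    and var: "\<And>x h. (\<integral>\<omega>. (X (x + h) \<omega> - X x \<omega>)\<^sup>2 \<partial>M) = f h"
    and \<delta>: "0 < \<delta>" and conc: "concave_on {0..\<delta>} f" and mono: "mono_on {0..\<delta>} f"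
    and pos: "\<And>h. 0 < h \<Longrightarrow> h \<le> \<delta> \<Longrightarrow> 0 < f h"
begin

lemma meas [measurable]: "X x \<in> borel_measurable M"
  using gaussian_process_measurable[OF gauss] .

lemma f_0: "f 0 = 0" using var[of 0 0] by simp

lemma f_minus: "f (- h) = f h"
proof -
  have "f (- h) = (\<integral>\<omega>. (X (0 + - h) \<omega> - X 0 \<omega>)\<^sup>2 \<partial>M)" by (rule var[symmetric])
  also have "\<dots> = (\<integral>\<omega>. (X (- h + h) \<omega> - X (- h) \<omega>)\<^sup>2 \<partial>M)" by (simp add: power2_commute)
  also have "\<dots> = f h" by (rule var)
  finally show ?thesis .
qed

lemma gaussian_combination:
  assumes J: "finite J"
  shows "gaussian_rv M (\<lambda>\<omega>. \<Sum>j\<in>J. c j * X (t j) \<omega>)" and "integrable M (\<lambda>\<omega>. \<Sum>j\<in>J. c j * X (t j) \<omega>)"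
    and "(\<integral>\<omega>. (\<Sum>j\<in>J. c j * X (t j) \<omega>) \<partial>M) = 0"
proof -
  have "(\<Sum>j\<in>J. c j * X (t j) \<omega>) = (\<Sum>x\<in>t ` J. (\<Sum>j\<in>{j\<in>J. t j = x}. c j) * X x \<omega>)" for \<omega>
  proof -
    have "(\<Sum>j\<in>J. c j * X (t j) \<omega>) = (\<Sum>x\<in>t ` J. \<Sum>j\<in>{j\<in>J. t j = x}. c j * X (t j) \<omega>)"
      using J by (rule sum.image_gen)
    also have "\<dots> = (\<Sum>x\<in>t ` J. (\<Sum>j\<in>{j\<in>J. t j = x}. c j) * X x \<omega>)"
      by (intro sum.cong refl) (simp add: sum_distrib_right)
    finally show ?thesis .
  qed
  then show "gaussian_rv M (\<lambda>\<omega>. \<Sum>j\<in>J. c j * X (t j) \<omega>)"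
    using gauss J unfolding gaussian_process_def by simp
  have "integrable M (X x)" "(\<integral>\<omega>. X x \<omega> \<partial>M) = 0" for x using mean by (auto simp: mean_zero_def)
  then show "integrable M (\<lambda>\<omega>. \<Sum>j\<in>J. c j * X (t j) \<omega>)" "(\<integral>\<omega>. (\<Sum>j\<in>J. c j * X (t j) \<omega>) \<partial>M) = 0"
    by simp_all
qed

text \<open>A standard normal variable if \<open>0 < h \<le> \<delta>\<close>.\<close>

definition Y :: "real \<Rightarrow> real \<Rightarrow> 'a \<Rightarrow> real" where
  "Y h x \<omega> = (X (x + h) \<omega> - X x \<omega>) / sqrt (f h)"

lemma Y_meas [measurable]: "Y h x \<in> borel_measurable M"
  unfolding Y_def[abs_def] by measurable

lemma Y_cont: "continuous_on UNIV (\<lambda>x. Y h x \<omega>)"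
proof -
  have "continuous_on UNIV (\<lambda>x. X (x + h) \<omega>)" by (rule continuous_on_compose2[OF cont]) (auto intro!: continuous_intros)
  then show ?thesis unfolding Y_def divide_inverse using cont by (intro continuous_intros) auto
qed

text \<open>A path is the pointwise limit of its values at the points of the grids with mesh \<open>1 / (k + 1)\<close>, and each
approximation takes only countably many of the random variables \<open>X x\<close>.\<close>

lemma joint_meas: "(\<lambda>z. X (fst z) (snd z)) \<in> borel_measurable (lborel \<Otimes>\<^sub>M M)"
proof (rule borel_measurable_LIMSEQ_metric)
  fix k :: nat
  have [measurable]: "(\<lambda>z. \<lfloor>real (Suc k) * fst z\<rfloor>) \<in> measurable (lborel \<Otimes>\<^sub>M M) (count_space UNIV)"
    by measurable
  show "(\<lambda>z. X (real_of_int \<lfloor>real (Suc k) * fst z\<rfloor> / real (Suc k)) (snd z)) \<in> borel_measurable (lborel \<Otimes>\<^sub>M M)"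
    by (rule measurable_compose_countable[where f="\<lambda>i z. X (real_of_int i / real (Suc k)) (snd z)"]) measurable
next
  fix z :: "real \<times> 'a"
  have lim: "(\<lambda>k. real_of_int \<lfloor>real (Suc k) * fst z\<rfloor> / real (Suc k)) \<longlonglongrightarrow> fst z"
  proof (rule tendsto_sandwich)
    show "\<forall>\<^sub>F k in sequentially. fst z - 1 / real (Suc k) \<le> real_of_int \<lfloor>real (Suc k) * fst z\<rfloor> / real (Suc k)"
    proof (intro always_eventually allI)
      fix k
      have "(real (Suc k) * fst z - 1) / real (Suc k) \<le> real_of_int \<lfloor>real (Suc k) * fst z\<rfloor> / real (Suc k)"
        by (intro divide_right_mono) linarith+
      then show "fst z - 1 / real (Suc k) \<le> real_of_int \<lfloor>real (Suc k) * fst z\<rfloor> / real (Suc k)"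
        by (simp add: diff_divide_distrib)
    qed
    show "\<forall>\<^sub>F k in sequentially. real_of_int \<lfloor>real (Suc k) * fst z\<rfloor> / real (Suc k) \<le> fst z"
    proof (intro always_eventually allI)
      fix k
      have "real_of_int \<lfloor>real (Suc k) * fst z\<rfloor> / real (Suc k) \<le> (real (Suc k) * fst z) / real (Suc k)"
        by (intro divide_right_mono) linarith+
      then show "real_of_int \<lfloor>real (Suc k) * fst z\<rfloor> / real (Suc k) \<le> fst z" by simp
    qed
    have "(\<lambda>k. fst z - 1 / real (Suc k)) \<longlonglongrightarrow> fst z - 0"
      by (intro tendsto_diff tendsto_const LIMSEQ_Suc[OF lim_1_over_n])
    then show "(\<lambda>k. fst z - 1 / real (Suc k)) \<longlonglongrightarrow> fst z" by simp
  qed simp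
  have "isCont (\<lambda>x. X x (snd z)) (fst z)" using cont[of "snd z"] by (simp add: continuous_on_eq_continuous_at)
  then show "(\<lambda>k. X (real_of_int \<lfloor>real (Suc k) * fst z\<rfloor> / real (Suc k)) (snd z)) \<longlonglongrightarrow> X (fst z) (snd z)"
    using lim by (rule isCont_tendsto_compose)
qed

lemma joint_Y [measurable]: "(\<lambda>z. Y h (fst z) (snd z)) \<in> borel_measurable (lborel \<Otimes>\<^sub>M M)"
proof -
  have "(\<lambda>z. X (fst z + h) (snd z)) \<in> borel_measurable (lborel \<Otimes>\<^sub>M M)"
    using measurable_compose[OF _ joint_meas, of "\<lambda>z. (fst z + h, snd z)" "lborel \<Otimes>\<^sub>M M"] by simp
  then show ?thesis unfolding Y_def using joint_meas by measurable
qed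

lemma Y_combination:
  fixes J :: "'i set" and c x :: "'i \<Rightarrow> real"
  assumes J: "finite J"
  obtains K :: "('i \<times> bool) set" and c' t' where "finite K"
    "\<And>\<omega>. (\<Sum>i\<in>J. c i * Y h (x i) \<omega>) = (\<Sum>k\<in>K. c' k * X (t' k) \<omega>)"
proof
  define c' where "c' k = (if snd k then c (fst k) / sqrt (f h) else - c (fst k) / sqrt (f h))" for k :: "'i \<times> bool"
  define t' where "t' k = (if snd k then x (fst k) + h else x (fst k))" for k :: "'i \<times> bool"
  show "finite (J \<times> (UNIV :: bool set))" using J by simp
  show "(\<Sum>i\<in>J. c i * Y h (x i) \<omega>) = (\<Sum>k\<in>J \<times> UNIV. c' k * X (t' k) \<omega>)" for \<omega>
  proof -
    have "(\<Sum>k\<in>J \<times> UNIV. c' k * X (t' k) \<omega>) = (\<Sum>i\<in>J. \<Sum>b\<in>UNIV. c' (i, b) * X (t' (i, b)) \<omega>)"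
      by (simp add: sum.cartesian_product case_prod_unfold)
    then show ?thesis by (simp add: UNIV_bool c'_def t'_def Y_def diff_divide_distrib algebra_simps)
  qed
qed

lemma Y_centered:
  assumes J: "finite J"
  shows "gaussian_rv M (\<lambda>\<omega>. \<Sum>i\<in>J. c i * Y h (x i) \<omega>)" "integrable M (\<lambda>\<omega>. \<Sum>i\<in>J. c i * Y h (x i) \<omega>)"
    "(\<integral>\<omega>. (\<Sum>i\<in>J. c i * Y h (x i) \<omega>) \<partial>M) = 0"
proof -
  obtain K :: "('b \<times> bool) set" and c' t' where K: "finite K"
    and e: "\<And>\<omega>. (\<Sum>i\<in>J. c i * Y h (x i) \<omega>) = (\<Sum>k\<in>K. c' k * X (t' k) \<omega>)"
    using Y_combination[OF J] by metis
  show "gaussian_rv M (\<lambda>\<omega>. \<Sum>i\<in>J. c i * Y h (x i) \<omega>)" "integrable M (\<lambda>\<omega>. \<Sum>i\<in>J. c i * Y h (x i) \<omega>)"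
    "(\<integral>\<omega>. (\<Sum>i\<in>J. c i * Y h (x i) \<omega>) \<partial>M) = 0"
    unfolding e using gaussian_combination[OF K] by auto
qed

lemma Y_single: "gaussian_rv M (Y h x)" "integrable M (Y h x)" "(\<integral>\<omega>. Y h x \<omega> \<partial>M) = 0"
  using Y_centered[of "{()}" "\<lambda>_. 1" h "\<lambda>_. x"] by simp_all

lemma X_diff_square_integrable: "integrable M (\<lambda>\<omega>. (X y \<omega> - X x \<omega>)\<^sup>2)"
proof -
  let ?t = "\<lambda>b. if b then y else x" and ?c = "\<lambda>b. if b then 1 else - 1 :: real"
  have e: "(\<Sum>b\<in>UNIV. ?c b * X (?t b) \<omega>) = X y \<omega> - X x \<omega>" for \<omega> by (simp add: UNIV_bool)
  show ?thesis
    using centered_gaussian(1)[OF prob_space_axioms gaussian_combination[of "UNIV :: bool set" ?c ?t]]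
    unfolding e by simp
qed

text \<open>Polarisation: the product of two increments is a combination of squares of four increments between
the endpoints.\<close>

lemma Y_cov:
  assumes h: "0 < h" "h \<le> \<delta>"
  shows "integrable M (\<lambda>\<omega>. Y h x \<omega> * Y h y \<omega>)"
    and "(\<integral>\<omega>. Y h x \<omega> * Y h y \<omega> \<partial>M) = (f (\<bar>x - y\<bar> + h) + f (\<bar>x - y\<bar> - h) - 2 * f \<bar>x - y\<bar>) / (2 * f h)"
proof -
  have fh: "0 < f h" using pos h by simp
  let ?q = "\<lambda>u v \<omega>. (X u \<omega> - X v \<omega>)\<^sup>2"
  have e: "Y h x \<omega> * Y h y \<omega> = (?q (x + h) y \<omega> + ?q x (y + h) \<omega> - ?q (x + h) (y + h) \<omega> - ?q x y \<omega>) / (2 * f h)" for \<omega>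
  proof -
    have "Y h x \<omega> * Y h y \<omega> = (X (x + h) \<omega> - X x \<omega>) * (X (y + h) \<omega> - X y \<omega>) / f h"
      using fh by (simp add: Y_def)
    also have "\<dots> = (2 * ((X (x + h) \<omega> - X x \<omega>) * (X (y + h) \<omega> - X y \<omega>))) / (2 * f h)" by simp
    also have "2 * ((X (x + h) \<omega> - X x \<omega>) * (X (y + h) \<omega> - X y \<omega>)) =
       ?q (x + h) y \<omega> + ?q x (y + h) \<omega> - ?q (x + h) (y + h) \<omega> - ?q x y \<omega>"
      by (simp add: power2_eq_square algebra_simps)
    finally show ?thesis .
  qed
  have i: "integrable M (?q u v)" for u v by (rule X_diff_square_integrable)
  have v: "(\<integral>\<omega>. ?q u v \<omega> \<partial>M) = f (u - v)" for u v using var[of v "u - v"] by simp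
  show "integrable M (\<lambda>\<omega>. Y h x \<omega> * Y h y \<omega>)" unfolding e using i by simp
  have "(\<integral>\<omega>. Y h x \<omega> * Y h y \<omega> \<partial>M) = (f (x + h - y) + f (x - (y + h)) - f (x + h - (y + h)) - f (x - y)) / (2 * f h)"
    unfolding e using i by (simp add: v)
  also have "f (x + h - y) + f (x - (y + h)) - f (x + h - (y + h)) - f (x - y) = f (\<bar>x - y\<bar> + h) + f (\<bar>x - y\<bar> - h) - 2 * f \<bar>x - y\<bar>"
  proof (cases "y \<le> x")
    case True
    then show ?thesis by (simp add: algebra_simps)
  next
    case False
    have "f (x + h - y) = f (y - x - h)" "f (x - (y + h)) = f (y - x + h)" "f (x - y) = f (y - x)"
      using f_minus[of "y - x - h"] f_minus[of "y - x + h"] f_minus[of "y - x"] by (simp_all add: algebra_simps)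
    then show ?thesis using False by simp
  qed
  finally show "(\<integral>\<omega>. Y h x \<omega> * Y h y \<omega> \<partial>M) = (f (\<bar>x - y\<bar> + h) + f (\<bar>x - y\<bar> - h) - 2 * f \<bar>x - y\<bar>) / (2 * f h)" .
qed

lemma Y_var:
  assumes h: "0 < h" "h \<le> \<delta>"
  shows "(\<integral>\<omega>. (Y h x \<omega>)\<^sup>2 \<partial>M) = 1"
  using Y_cov(2)[OF h, of x x] pos[OF h] by (simp add: power2_eq_square f_0 f_minus)

lemma Y_std:
  assumes h: "0 < h" "h \<le> \<delta>"
  shows "distr M borel (Y h x) = std_normal_distribution"
  using centered_gaussian(3)[OF prob_space_axioms Y_single Y_var[OF h]] .

lemma Y_nearly_standard:
  fixes J :: "'i set"
  assumes h: "0 < h" "h \<le> \<delta>" and J: "finite J"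
    and dom: "\<And>i. i \<in> J \<Longrightarrow> (\<Sum>k\<in>J - {i}. \<bar>(\<integral>\<omega>. Y h (x i) \<omega> * Y h (x k) \<omega> \<partial>M)\<bar>) \<le> e"
  shows "nearly_standard_vector M J (\<lambda>i. Y h (x i)) (\<lambda>i k. \<integral>\<omega>. Y h (x i) \<omega> * Y h (x k) \<omega> \<partial>M) e"
proof
  let ?a = "\<lambda>i k. \<integral>\<omega>. Y h (x i) \<omega> * Y h (x k) \<omega> \<partial>M"
  fix c \<beta>
  have "(\<integral>\<omega>. cos (\<beta> + 1 * (\<Sum>i\<in>J. c i * Y h (x i) \<omega>)) \<partial>M) =
     cos \<beta> * exp (- 1\<^sup>2 * (\<integral>\<omega>. (\<Sum>i\<in>J. c i * Y h (x i) \<omega>)\<^sup>2 \<partial>M) / 2)"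
    by (rule centered_gaussian(2)[OF prob_space_axioms Y_centered[OF J]])
  also have "(\<integral>\<omega>. (\<Sum>i\<in>J. c i * Y h (x i) \<omega>)\<^sup>2 \<partial>M) = (\<integral>\<omega>. (\<Sum>i\<in>J. \<Sum>k\<in>J. c i * c k * (Y h (x i) \<omega> * Y h (x k) \<omega>)) \<partial>M)"
    by (simp add: power2_eq_square sum_product mult_ac)
  also have "\<dots> = (\<Sum>i\<in>J. \<Sum>k\<in>J. c i * c k * ?a i k)"
    using Y_cov(1)[OF h] by (simp add: Bochner_Integration.integral_sum)
  also have "\<dots> = (\<Sum>i\<in>J. (c i)\<^sup>2 + (\<Sum>k\<in>J - {i}. ?a i k * c i * c k))"
  proof (intro sum.cong refl)
    fix i assume i: "i \<in> J"
    have "(\<Sum>k\<in>J. c i * c k * ?a i k) = c i * c i * ?a i i + (\<Sum>k\<in>J - {i}. c i * c k * ?a i k)"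
      by (rule sum.remove[OF J i])
    then show "(\<Sum>k\<in>J. c i * c k * ?a i k) = (c i)\<^sup>2 + (\<Sum>k\<in>J - {i}. ?a i k * c i * c k)"
      using Y_var[OF h, of "x i"] by (simp add: power2_eq_square mult_ac)
  qed
  finally show "(\<integral>\<omega>. cos (\<beta> + (\<Sum>i\<in>J. c i * Y h (x i) \<omega>)) \<partial>M) =
      cos \<beta> * exp (- ((\<Sum>i\<in>J. (c i)\<^sup>2) + (\<Sum>i\<in>J. \<Sum>k\<in>J - {i}. ?a i k * c i * c k)) / 2)"
    by (simp add: sum.distrib)
qed (use J dom in \<open>auto simp: mult.commute\<close>)

end

section \<open>An exponential inequality for integrals along a path\<close>

context stationary_gaussian
begin

lemma mean_path_integral:
  fixes g :: "real \<Rightarrow> real"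
  assumes g: "continuous_on UNIV g" and g0: "\<And>y. 0 \<le> g y" and h: "0 < h" "h \<le> \<delta>" and ab: "a \<le> b"
  shows "(\<integral>\<^sup>+\<omega>. ennreal (integral {a..b} (\<lambda>x. g (Y h x \<omega>))) \<partial>M) =
    ennreal (b - a) * (\<integral>\<^sup>+z. ennreal (g z) \<partial>std_normal_distribution)"
proof -
  interpret P: pair_sigma_finite lborel M ..
  have gm[measurable]: "g \<in> borel_measurable borel" using g by (rule borel_measurable_continuous_onI)
  have gY: "continuous_on S (\<lambda>x. g (Y h x \<omega>))" for S \<omega>
    using continuous_on_compose2[OF g Y_cont] by (rule continuous_on_subset) auto
  have m: "(\<lambda>(x, \<omega>). ennreal (g (Y h x \<omega>)) * indicator {a..b} x) \<in> borel_measurable (lborel \<Otimes>\<^sub>M M)"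
    unfolding case_prod_unfold by measurable
  have "(\<integral>\<^sup>+\<omega>. ennreal (integral {a..b} (\<lambda>x. g (Y h x \<omega>))) \<partial>M) =
      (\<integral>\<^sup>+\<omega>. (\<integral>\<^sup>+x. ennreal (g (Y h x \<omega>)) * indicator {a..b} x \<partial>lborel) \<partial>M)"
    using gY g0 by (simp add: nn_integral_Icc_continuous)
  also have "\<dots> = (\<integral>\<^sup>+x. (\<integral>\<^sup>+\<omega>. ennreal (g (Y h x \<omega>)) * indicator {a..b} x \<partial>M) \<partial>lborel)"
    by (rule P.Fubini'[OF m])
  also have "\<dots> = (\<integral>\<^sup>+x. (\<integral>\<^sup>+z. ennreal (g z) \<partial>std_normal_distribution) * indicator {a..b} x \<partial>lborel)"
  proof (intro nn_integral_cong)
    fix x :: real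
    have "(\<integral>\<^sup>+\<omega>. ennreal (g (Y h x \<omega>)) * indicator {a..b} x \<partial>M) = (\<integral>\<^sup>+\<omega>. ennreal (g (Y h x \<omega>)) \<partial>M) * indicator {a..b} x"
      by (rule nn_integral_multc) measurable
    also have "(\<integral>\<^sup>+\<omega>. ennreal (g (Y h x \<omega>)) \<partial>M) = (\<integral>\<^sup>+z. ennreal (g z) \<partial>distr M borel (Y h x))"
      by (simp add: nn_integral_distr)
    finally show "(\<integral>\<^sup>+\<omega>. ennreal (g (Y h x \<omega>)) * indicator {a..b} x \<partial>M) = (\<integral>\<^sup>+z. ennreal (g z) \<partial>std_normal_distribution) * indicator {a..b} x"
      unfolding Y_std[OF h] .
  qed
  also have "\<dots> = (\<integral>\<^sup>+z. ennreal (g z) \<partial>std_normal_distribution) * emeasure lborel {a..b}"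
    by (rule nn_integral_cmult_indicator) simp
  also have "\<dots> = ennreal (b - a) * (\<integral>\<^sup>+z. ennreal (g z) \<partial>std_normal_distribution)"
    using ab by (simp add: mult.commute)
  finally show ?thesis .
qed

lemma path_integral_measurable [measurable]:
  fixes g :: "real \<Rightarrow> real"
  assumes g: "continuous_on UNIV g"
  shows "(\<lambda>\<omega>. integral {a..b} (\<lambda>x. g (Y h x \<omega>))) \<in> borel_measurable M"
proof -
  have gm[measurable]: "g \<in> borel_measurable borel" using g by (rule borel_measurable_continuous_onI)
  have gY: "continuous_on S (\<lambda>x. g (Y h x \<omega>))" for S \<omega>
    using continuous_on_compose2[OF g Y_cont] by (rule continuous_on_subset) auto
  have si: "set_integrable lborel {a..b} (\<lambda>x. g (Y h x \<omega>))" for \<omega> by (intro borel_integrable_atLeastAtMost' gY)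
  have m: "(\<lambda>(x, \<omega>). indicator {a..b} x *\<^sub>R g (Y h x \<omega>)) \<in> borel_measurable (lborel \<Otimes>\<^sub>M M)"
    unfolding case_prod_unfold by measurable
  have "(\<lambda>\<omega>. LBINT x:{a..b}. g (Y h x \<omega>)) \<in> borel_measurable M"
    unfolding set_lebesgue_integral_def
    using lborel.borel_measurable_lebesgue_integral[of "\<lambda>\<omega> x. indicator {a..b} x *\<^sub>R g (Y h x \<omega>)" M] m
    by (simp add: measurable_pair_swap_iff[of _ M] case_prod_unfold)
  then show ?thesis using set_borel_integral_eq_integral(2)[OF si] by simp
qed

lemma covariance_row_sum_le:
  assumes h: "0 < h" "h \<le> s" and n: "real n * s \<le> \<delta>" and i: "i < n"
  shows "(\<Sum>k\<in>{..<n} - {i}. \<bar>(\<integral>\<omega>. Y h (x + real i * s) \<omega> * Y h (x + real k * s) \<omega> \<partial>M)\<bar>) \<le> 1"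
proof -
  have sn: "s \<le> real n * s" using i h mult_right_mono[of 1 "real n" s] by simp
  then have hd: "h \<le> \<delta>" using h n by linarith
  have fh: "0 < f h" using pos h hd by simp
  define F where "F j = \<bar>f (real j * s + h) + f (real j * s - h) - 2 * f (real j * s)\<bar> / (2 * f h)" for j
  have "(\<Sum>k\<in>{..<n} - {i}. \<bar>(\<integral>\<omega>. Y h (x + real i * s) \<omega> * Y h (x + real k * s) \<omega> \<partial>M)\<bar>) =
     (\<Sum>k\<in>{..<n} - {i}. F (nat \<bar>int i - int k\<bar>))"
  proof (intro sum.cong refl)
    fix k
    have "\<bar>(x + real i * s) - (x + real k * s)\<bar> = real (nat \<bar>int i - int k\<bar>) * s"
    proof -
      have "(x + real i * s) - (x + real k * s) = (real i - real k) * s" by (simp add: algebra_simps)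
      then show ?thesis using h by (simp add: abs_mult)
    qed
    then show "\<bar>(\<integral>\<omega>. Y h (x + real i * s) \<omega> * Y h (x + real k * s) \<omega> \<partial>M)\<bar> = F (nat \<bar>int i - int k\<bar>)"
      using fh by (simp only: Y_cov(2)[OF h(1) hd] F_def abs_divide) simp
  qed
  also have "\<dots> \<le> 2 * (\<Sum>j\<in>{1..n - 1}. F j)" using i fh by (intro sum_distance_le) (auto simp: F_def)
  also have "(\<Sum>j\<in>{1..n - 1}. F j) = (\<Sum>j\<in>{1..n - 1}. \<bar>f (real j * s + h) + f (real j * s - h) - 2 * f (real j * s)\<bar>) / (2 * f h)"
    by (simp add: F_def sum_divide_distrib)
  also have "\<dots> \<le> f h / (2 * f h)"
  proof (intro divide_right_mono concave_second_differences_sum_le[OF conc mono f_0 h])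
    have "real (n - 1) * s + s = real n * s" using i by (simp add: of_nat_diff algebra_simps)
    then show "real (n - 1) * s + h \<le> \<delta>" using h n by linarith
  qed (use fh in simp)
  finally show ?thesis using fh by simp
qed

text \<open>Every colour class is nearly standard with \<open>e = 1 / R\<close>, so the hypothesis applies to it. The exponential of
\<open>1 / R\<close> times the full sum is at most the average of the exponentials of the class sums. This works with
classes of unequal size because the bound 1 in the hypothesis does not depend on the size.\<close>

lemma lattice_exponential_bound:
  fixes u :: "real \<Rightarrow> real"
  assumes um[measurable]: "u \<in> borel_measurable borel" and h: "0 < h" "h \<le> s" and n: "real n * s \<le> \<delta>" and n0: "0 < n"
    and R: "0 < R"
    and E: "\<And>(J :: nat set) Z c. nearly_standard_vector M J Z c (1 / real R) \<Longrightarrow>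
      (\<integral>\<^sup>+\<omega>. (\<Prod>i\<in>J. ennreal (exp (u (Z i \<omega>)))) \<partial>M) \<le> 1"
  shows "(\<integral>\<^sup>+\<omega>. ennreal (exp ((\<Sum>i<n. u (Y h (x + real i * s) \<omega>)) / real R)) \<partial>M) \<le> 1"
proof -
  have "s \<le> real n * s" using n0 h mult_right_mono[of 1 "real n" s] by simp
  then have hd: "h \<le> \<delta>" using h n by linarith
  define c where "c i k = (\<integral>\<omega>. Y h (x + real i * s) \<omega> * Y h (x + real k * s) \<omega> \<partial>M)" for i k
  obtain col where col: "\<And>i. i \<in> {..<n} \<Longrightarrow> col i < R" and
    bal: "\<And>i. i \<in> {..<n} \<Longrightarrow> (\<Sum>k\<in>{..<n} - {i}. if col k = col i then \<bar>c i k\<bar> else 0) \<le> (\<Sum>k\<in>{..<n} - {i}. \<bar>c i k\<bar>) / real R"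
    using balanced_colouring[of "{..<n}" "\<lambda>i k. \<bar>c i k\<bar>" R] R by (auto simp: c_def mult.commute)
  define J where "J r = {i\<in>{..<n}. col i = r}" for r
  define S where "S r \<omega> = (\<Sum>i\<in>J r. u (Y h (x + real i * s) \<omega>))" for r \<omega>
  have [measurable]: "S r \<in> borel_measurable M" for r unfolding S_def[abs_def] by measurable
  have colour_class: "(\<integral>\<^sup>+\<omega>. ennreal (exp (S r \<omega>)) \<partial>M) \<le> 1" for r
  proof -
    have "nearly_standard_vector M (J r) (\<lambda>i. Y h (x + real i * s)) c (1 / real R)"
      unfolding c_def
    proof (rule Y_nearly_standard[OF h(1) hd])
      show "finite (J r)" by (simp add: J_def)
      fix i assume i: "i \<in> J r"
      then have i': "i < n" "col i = r" by (auto simp: J_def)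
      have "(\<Sum>k\<in>J r - {i}. \<bar>c i k\<bar>) = (\<Sum>k\<in>{..<n} - {i}. if col k = col i then \<bar>c i k\<bar> else 0)"
        using i' by (intro sum.mono_neutral_cong_left) (auto simp: J_def)
      also have "\<dots> \<le> (\<Sum>k\<in>{..<n} - {i}. \<bar>c i k\<bar>) / real R" using bal[of i] i' by simp
      also have "\<dots> \<le> 1 / real R"
        using covariance_row_sum_le[OF h n i'(1)] by (intro divide_right_mono) (auto simp: c_def)
      finally show "(\<Sum>k\<in>J r - {i}. \<bar>(\<integral>\<omega>. Y h (x + real i * s) \<omega> * Y h (x + real k * s) \<omega> \<partial>M)\<bar>) \<le> 1 / real R"
        by (simp add: c_def)
    qed
    from E[OF this] show ?thesis by (simp add: S_def exp_sum J_def prod_ennreal)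
  qed
  have total: "(\<Sum>i<n. u (Y h (x + real i * s) \<omega>)) = (\<Sum>r<R. S r \<omega>)" for \<omega>
    unfolding S_def J_def using col by (intro sum.group[symmetric]) auto
  have "(\<integral>\<^sup>+\<omega>. ennreal (exp ((\<Sum>i<n. u (Y h (x + real i * s) \<omega>)) / real R)) \<partial>M) \<le>
      (\<integral>\<^sup>+\<omega>. ennreal (1 / real R) * (\<Sum>r<R. ennreal (exp (S r \<omega>))) \<partial>M)"
  proof (intro nn_integral_mono)
    fix \<omega>
    have "ennreal (exp ((\<Sum>r<R. S r \<omega>) / real R)) \<le> ennreal (1 / real R * (\<Sum>r<R. exp (S r \<omega>)))"
      using exp_average_le_sum[OF R, of "\<lambda>r. S r \<omega>"] by (intro ennreal_leI) simp
    also have "\<dots> = ennreal (1 / real R) * (\<Sum>r<R. ennreal (exp (S r \<omega>)))"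
      by (subst ennreal_mult) (auto intro: sum_nonneg simp: sum_ennreal)
    finally show "ennreal (exp ((\<Sum>i<n. u (Y h (x + real i * s) \<omega>)) / real R)) \<le> ennreal (1 / real R) * (\<Sum>r<R. ennreal (exp (S r \<omega>)))"
      unfolding total .
  qed
  also have "\<dots> = ennreal (1 / real R) * (\<Sum>r<R. \<integral>\<^sup>+\<omega>. ennreal (exp (S r \<omega>)) \<partial>M)"
    by (subst nn_integral_cmult, measurable, subst nn_integral_sum) auto
  also have "\<dots> \<le> ennreal (1 / real R) * (\<Sum>r<R. 1)"
    using colour_class by (intro mult_left_mono sum_mono) auto
  also have "\<dots> = 1" using R by (simp add: ennreal_mult[symmetric] flip: ennreal_of_nat_eq_real_of_nat)
      (simp add: ennreal_of_nat_eq_real_of_nat flip: ennreal_mult)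
  finally show ?thesis .
qed

text \<open>Choose \<open>n\<close> with \<open>s = (b - a) / n\<close> between \<open>h\<close> and \<open>2 * h\<close> and fold the integral onto \<open>[0, s]\<close>. By convexity of the
exponential function and Fubini's theorem the lattice bound, which is uniform in the offset, passes
to the integral; the tail bound is then Markov's inequality. Since about \<open>(b - a) / h\<close> lattice points are
averaged, the exponent has the factor \<open>1 / h\<close>.\<close>

lemma path_exponential_bound:
  fixes u :: "real \<Rightarrow> real"
  assumes u: "continuous_on UNIV u" and h: "0 < h" "h \<le> b - a" and ab: "b - a \<le> \<delta>" and R: "0 < R"
    and E: "\<And>(J :: nat set) Z c. nearly_standard_vector M J Z c (1 / real R) \<Longrightarrow>
      (\<integral>\<^sup>+\<omega>. (\<Prod>i\<in>J. ennreal (exp (u (Z i \<omega>)))) \<partial>M) \<le> 1"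
    and \<eta>: "0 \<le> \<eta>"
  shows "prob {\<omega>\<in>space M. \<eta> \<le> integral {a..b} (\<lambda>x. u (Y h x \<omega>))} \<le> exp (- \<eta> / (2 * real R * h))"
proof -
  define L where "L = b - a"
  define n where "n = nat \<lfloor>L / h\<rfloor>"
  define s where "s = L / real n"
  have Lh: "1 \<le> L / h" using h by (simp add: L_def)
  have n1: "1 \<le> n" unfolding n_def using Lh by (simp add: le_nat_iff)
  have nr: "real n = real_of_int \<lfloor>L / h\<rfloor>" unfolding n_def using Lh by simp
  have "real n \<le> L / h" "L / h < real n + 1" unfolding nr by linarith+
  then have nh: "real n * h \<le> L" "L < (real n + 1) * h" using h by (simp_all add: field_simps)
  have s1: "h \<le> s" unfolding s_def using nh n1 by (simp add: field_simps)
  have ns: "real n * s = L" using n1 by (simp add: s_def)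
  have "L \<le> (real n + 1) * h" using nh by simp
  also have "\<dots> \<le> (real n + real n) * h" using n1 h by (intro mult_right_mono) auto
  finally have "L \<le> real n * (2 * h)" by simp
  then have s2: "s \<le> 2 * h" unfolding s_def using n1 by (simp add: field_simps)
  have s0: "0 < s" using s1 h by simp
  have um[measurable]: "u \<in> borel_measurable borel" using u by (rule borel_measurable_continuous_onI)
  have uY: "continuous_on S (\<lambda>x. u (Y h x \<omega>))" for S \<omega>
    using continuous_on_compose2[OF u Y_cont] by (rule continuous_on_subset) auto
  define w where "w \<omega> x = (\<Sum>i<n. u (Y h (a + x + real i * s) \<omega>))" for \<omega> x
  have wc: "continuous_on S (w \<omega>)" for S \<omega>
    unfolding w_def by (intro continuous_on_sum continuous_on_compose2[OF uY[of UNIV]] continuous_intros) auto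
  have I: "integral {a..b} (\<lambda>x. u (Y h x \<omega>)) = integral {0..s} (w \<omega>)" for \<omega>
  proof -
    have "integral {a..a + real n * s} (\<lambda>x. u (Y h x \<omega>)) = integral {0..s} (w \<omega>)"
      unfolding w_def by (rule integral_sum_translates[OF uY s0])
    then show ?thesis by (simp add: ns L_def)
  qed
  define A where "A = {\<omega>\<in>space M. \<eta> \<le> integral {a..b} (\<lambda>x. u (Y h x \<omega>))}"
  have A[measurable]: "A \<in> sets M" unfolding A_def using path_integral_measurable[OF u] by measurable
  interpret P: pair_sigma_finite lborel M ..
  have wm: "(\<lambda>z. w (snd z) (fst z)) \<in> borel_measurable (lborel \<Otimes>\<^sub>M M)"
  proof -
    have "(\<lambda>z. Y h (a + fst z + real i * s) (snd z)) \<in> borel_measurable (lborel \<Otimes>\<^sub>M M)" for i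
      using measurable_compose[OF _ joint_Y[of h], of "\<lambda>z. (a + fst z + real i * s, snd z)" "lborel \<Otimes>\<^sub>M M"] by simp
    then show ?thesis unfolding w_def by measurable
  qed
  have m: "(\<lambda>(x, \<omega>). ennreal (exp (w \<omega> x / real R)) * indicator {0..s} x) \<in> borel_measurable (lborel \<Otimes>\<^sub>M M)"
    unfolding case_prod_unfold using wm by measurable
  have m': "(\<lambda>(\<omega>, x). ennreal (exp (w \<omega> x / real R)) * indicator {0..s} x) \<in> borel_measurable (M \<Otimes>\<^sub>M lborel)"
    using m by (subst measurable_pair_swap_iff) (simp add: case_prod_unfold)
  have "ennreal (exp (\<eta> / (real R * s))) * emeasure M A = (\<integral>\<^sup>+\<omega>. ennreal (exp (\<eta> / (real R * s))) * indicator A \<omega> \<partial>M)"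
    by (simp add: nn_integral_cmult_indicator)
  also have "\<dots> \<le> (\<integral>\<^sup>+\<omega>. ennreal (1 / s) * (\<integral>\<^sup>+x. ennreal (exp (w \<omega> x / real R)) * indicator {0..s} x \<partial>lborel) \<partial>M)"
  proof (intro nn_integral_mono)
    fix \<omega>
    have c: "continuous_on {0..s} (\<lambda>x. w \<omega> x / real R)" using wc R by (intro continuous_intros) auto
    have "ennreal (exp (\<eta> / (real R * s))) * indicator A \<omega> \<le> ennreal (exp (integral {0..s} (\<lambda>x. w \<omega> x / real R) / s))"
    proof (cases "\<omega> \<in> A")
      case True
      then have "\<eta> / (real R * s) \<le> integral {0..s} (w \<omega>) / (real R * s)"
        using I s0 by (intro divide_right_mono) (auto simp: A_def)
      also have "\<dots> = integral {0..s} (\<lambda>x. w \<omega> x / real R) / s" by (simp add: field_simps)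
      finally show ?thesis using True by (simp add: ennreal_leI)
    qed simp
    also have "\<dots> \<le> ennreal (1 / s * integral {0..s} (\<lambda>x. exp (w \<omega> x / real R)))"
      using exp_average_le_integral[OF s0 c] by (intro ennreal_leI) simp
    also have "\<dots> = ennreal (1 / s) * ennreal (integral {0..s} (\<lambda>x. exp (w \<omega> x / real R)))"
      using s0 by (intro ennreal_mult integral_nonneg integrable_continuous_real continuous_intros c) auto
    also have "ennreal (integral {0..s} (\<lambda>x. exp (w \<omega> x / real R))) = (\<integral>\<^sup>+x\<in>{0..s}. ennreal (exp (w \<omega> x / real R)) \<partial>lborel)"
      by (intro nn_integral_Icc_continuous[symmetric] continuous_intros c) auto
    finally show "ennreal (exp (\<eta> / (real R * s))) * indicator A \<omega> \<le>
       ennreal (1 / s) * (\<integral>\<^sup>+x. ennreal (exp (w \<omega> x / real R)) * indicator {0..s} x \<partial>lborel)" .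
  qed
  also have "\<dots> = ennreal (1 / s) * (\<integral>\<^sup>+\<omega>. (\<integral>\<^sup>+x. ennreal (exp (w \<omega> x / real R)) * indicator {0..s} x \<partial>lborel) \<partial>M)"
    by (intro nn_integral_cmult lborel.borel_measurable_nn_integral m')
  also have "(\<integral>\<^sup>+\<omega>. (\<integral>\<^sup>+x. ennreal (exp (w \<omega> x / real R)) * indicator {0..s} x \<partial>lborel) \<partial>M) =
      (\<integral>\<^sup>+x. (\<integral>\<^sup>+\<omega>. ennreal (exp (w \<omega> x / real R)) * indicator {0..s} x \<partial>M) \<partial>lborel)"
    by (rule P.Fubini'[OF m])
  also have "\<dots> \<le> (\<integral>\<^sup>+x. indicator {0..s} x \<partial>lborel)"
  proof (intro nn_integral_mono)
    fix x :: real
    have "(\<integral>\<^sup>+\<omega>. ennreal (exp (w \<omega> x / real R)) \<partial>M) \<le> 1"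
      unfolding w_def using n1 ns ab by (intro lattice_exponential_bound[OF um h(1) s1 _ _ R E]) (auto simp: L_def)
    then show "(\<integral>\<^sup>+\<omega>. ennreal (exp (w \<omega> x / real R)) * indicator {0..s} x \<partial>M) \<le> indicator {0..s} x"
      by (cases "x \<in> {0..s}") auto
  qed
  also have "(\<integral>\<^sup>+x. indicator {0..s} x \<partial>lborel) = ennreal s" using s0 by simp
  also have "ennreal (1 / s) * ennreal s = 1" using s0 by (simp flip: ennreal_mult)
  finally have "ennreal (exp (\<eta> / (real R * s))) * ennreal (prob A) \<le> 1"
    by (simp add: mult_left_mono emeasure_eq_measure)
  then have "ennreal (exp (\<eta> / (real R * s)) * prob A) \<le> ennreal 1"
    by (simp add: ennreal_mult)
  then have "exp (\<eta> / (real R * s)) * prob A \<le> 1" by (subst (asm) ennreal_le_iff) auto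
  then have "prob A \<le> exp (- (\<eta> / (real R * s)))" by (simp add: exp_minus field_simps)
  also have "\<dots> \<le> exp (- \<eta> / (2 * real R * h))"
  proof -
    have "real R * s \<le> 2 * real R * h" using s2 R by simp
    then have "\<eta> / (2 * real R * h) \<le> \<eta> / (real R * s)"
      using \<eta> s0 R by (intro divide_left_mono) auto
    then show ?thesis by simp
  qed
  finally show ?thesis by (simp add: A_def)
qed

end

section \<open>Tail bounds for the power integral\<close>

definition normal_abs_moment :: "real \<Rightarrow> real" where
  "normal_abs_moment p = (\<integral>z. \<bar>z\<bar> powr p \<partial>std_normal_distribution)"

text \<open>Eventually \<open>\<kappa> * ln n powr r\<close> exceeds \<open>2 * ln n\<close>, as \<open>r > 1\<close>.\<close>

lemma summable_exp_ln_powr: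
  assumes \<kappa>: "0 < \<kappa>" and r: "1 < r"
  shows "summable (\<lambda>n. exp (- \<kappa> * ln (real n) powr r))"
proof (rule summable_comparison_test_ev)
  show "summable (\<lambda>n. real n powr - 2)" by (simp add: summable_real_powr_iff)
  have "filterlim (\<lambda>n. ln (real n)) at_top sequentially"
    by (rule filterlim_compose[OF ln_at_top filterlim_real_sequentially])
  then have "eventually (\<lambda>n. max 1 ((2 / \<kappa>) powr (1 / (r - 1))) \<le> ln (real n)) sequentially"
    unfolding filterlim_at_top by (rule spec)
  then show "eventually (\<lambda>n. norm (exp (- \<kappa> * ln (real n) powr r)) \<le> real n powr - 2) sequentially"
    using eventually_gt_at_top[of 0]
  proof eventually_elim
    case (elim n)
    define l where "l = ln (real n)"
    have l: "1 \<le> l" "(2 / \<kappa>) powr (1 / (r - 1)) \<le> l" using elim by (auto simp: l_def)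
    have "2 / \<kappa> = ((2 / \<kappa>) powr (1 / (r - 1))) powr (r - 1)" using \<kappa> r by (simp add: powr_powr)
    also have "\<dots> \<le> l powr (r - 1)" using l r by (intro powr_mono2) auto
    finally have "2 \<le> \<kappa> * l powr (r - 1)" using \<kappa> by (simp add: field_simps)
    then have "2 * l \<le> \<kappa> * l powr (r - 1) * l" using l by (intro mult_right_mono) auto
    also have "\<dots> = \<kappa> * l powr r" using l powr_mult_base[of l "r - 1"] by (simp add: mult_ac)
    finally have "exp (- \<kappa> * l powr r) \<le> exp (- 2 * l)" by simp
    also have "\<dots> = real n powr - 2" using elim by (simp add: powr_def l_def)
    finally show ?case by (simp add: l_def)
  qed
qed

lemma eventually_scaled_moment:
  fixes m :: real
  assumes lim: "(\<lambda>R. c R) \<longlonglongrightarrow> (1 :: real)" and ab: "a < m" "m < b"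
  obtains R :: nat where "2 \<le> R" "a < c R powr p * m" "c R powr p * m < b"
proof -
  have "(\<lambda>R. c R powr p * m) \<longlonglongrightarrow> 1 powr p * m" using lim by (intro tendsto_intros) auto
  then have "(\<lambda>R. c R powr p * m) \<longlonglongrightarrow> m" by simp
  then have "eventually (\<lambda>R. a < c R powr p * m \<and> c R powr p * m < b) sequentially"
    using order_tendsto_iff ab by (auto simp: order_tendsto_iff eventually_conj_iff)
  then have "eventually (\<lambda>R. 2 \<le> R \<and> a < c R powr p * m \<and> c R powr p * m < b) sequentially"
    using eventually_ge_at_top[of 2] by eventually_elim simp
  then show ?thesis using that by (auto simp: eventually_sequentially)
qed

context stationary_gaussian
begin

definition path_moment :: "real \<Rightarrow> real \<Rightarrow> real \<Rightarrow> real \<Rightarrow> 'a \<Rightarrow> real" where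
  "path_moment p a b h \<omega> = integral {a..b} (\<lambda>x. \<bar>Y h x \<omega>\<bar> powr p)"

lemma continuous_abs_powr: "1 \<le> p \<Longrightarrow> continuous_on UNIV (\<lambda>y::real. \<bar>y\<bar> powr p)"
  by (intro continuous_on_powr' continuous_intros) auto

lemma path_moment_measurable [measurable]: "1 \<le> p \<Longrightarrow> path_moment p a b h \<in> borel_measurable M"
  unfolding path_moment_def[abs_def] by (rule path_integral_measurable[OF continuous_abs_powr])

lemma path_integrable: "continuous_on UNIV g \<Longrightarrow> (\<lambda>x. g (Y h x \<omega>) :: real) integrable_on {a..b}"
  by (intro integrable_continuous_real continuous_on_compose2[of UNIV g _ "\<lambda>x. Y h x \<omega>"] continuous_on_subset[OF Y_cont]) auto

text \<open>Apply the exponential inequality to \<open>u y = \<theta> * (m - \<epsilon> / 2 - \<bar>y\<bar> powr p)\<close>, where \<open>m\<close> is the normal moment. A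
large \<open>R\<close> makes the variance \<open>1 - 1 / R\<close> of the comparison variables so close to 1 that their moment
still exceeds \<open>m - \<epsilon> / 2\<close>, and then some fixed \<open>\<theta> > 0\<close> is admissible.\<close>

lemma lower_tail:
  assumes p: "1 \<le> p" and \<epsilon>: "0 < \<epsilon>" and ab: "a < b" "b - a \<le> \<delta>"
  obtains \<kappa> where "0 < \<kappa>" "\<And>h. 0 < h \<Longrightarrow> h \<le> b - a \<Longrightarrow>
    prob {\<omega>\<in>space M. path_moment p a b h \<omega> \<le> (normal_abs_moment p - \<epsilon>) * (b - a)} \<le> exp (- \<kappa> / h)"
proof -
  interpret S: real_distribution std_normal_distribution by (rule real_dist_normal_dist)
  define m where "m = normal_abs_moment p"
  have lim: "(\<lambda>R. sqrt (1 - 1 / real R)) \<longlonglongrightarrow> 1"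
    using tendsto_real_sqrt[OF tendsto_diff[OF tendsto_const[of 1] lim_1_over_n]] by simp
  obtain R :: nat where R: "2 \<le> R" and mR: "m - \<epsilon> / 2 < sqrt (1 - 1 / real R) powr p * m"
  proof (rule eventually_scaled_moment[OF lim, of "m - \<epsilon> / 2" m "m + 1" p])
    show "m - \<epsilon> / 2 < m" "m < m + 1" using \<epsilon> by simp_all
  qed
  define r where "r = sqrt (1 - 1 / real R)"
  have r: "0 \<le> r" using R by (simp add: r_def)
  have ip: "integrable std_normal_distribution (\<lambda>z. \<bar>z\<bar> powr p)" "integrable std_normal_distribution (\<lambda>z. \<bar>z\<bar> powr (2 * p))"
    using integrable_std_normal_powr(2)[of p 0] integrable_std_normal_powr(2)[of "2 * p" 0] p by auto
  have V: "(\<lambda>z. \<bar>r * z\<bar> powr p) = (\<lambda>z. r powr p * \<bar>z\<bar> powr p)" "(\<lambda>z. (\<bar>r * z\<bar> powr p)\<^sup>2) = (\<lambda>z. (r powr p)\<^sup>2 * \<bar>z\<bar> powr (2 * p))"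
  proof -
    have 1: "\<bar>r * z\<bar> powr p = r powr p * \<bar>z\<bar> powr p" for z using r by (simp add: abs_mult powr_mult)
    have 2: "(\<bar>z\<bar> powr p)\<^sup>2 = \<bar>z\<bar> powr (2 * p)" for z by (simp add: power2_eq_square flip: powr_add)
    show "(\<lambda>z. \<bar>r * z\<bar> powr p) = (\<lambda>z. r powr p * \<bar>z\<bar> powr p)" "(\<lambda>z. (\<bar>r * z\<bar> powr p)\<^sup>2) = (\<lambda>z. (r powr p)\<^sup>2 * \<bar>z\<bar> powr (2 * p))"
      by (simp_all add: 1 power_mult_distrib 2)
  qed
  obtain \<theta> where \<theta>: "0 < \<theta>" and E: "(\<integral>\<^sup>+z. ennreal (exp (\<theta> * (m - \<epsilon> / 2 - \<bar>r * z\<bar> powr p))) \<partial>std_normal_distribution) \<le> 1"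
  proof -
    have i: "integrable std_normal_distribution (\<lambda>z. \<bar>r * z\<bar> powr p)" "integrable std_normal_distribution (\<lambda>z. (\<bar>r * z\<bar> powr p)\<^sup>2)"
      unfolding V using ip by simp_all
    have e: "m - \<epsilon> / 2 < S.expectation (\<lambda>z. \<bar>r * z\<bar> powr p)"
      using mR unfolding V by (simp add: r_def m_def normal_abs_moment_def)
    show thesis by (rule S.exp_lower_moment[OF powr_ge_zero i e that])
  qed
  define u where "u y = \<theta> * (m - \<epsilon> / 2 - \<bar>y\<bar> powr p)" for y
  have uc: "continuous_on UNIV u" unfolding u_def by (intro continuous_intros continuous_abs_powr p)
  have um[measurable]: "u \<in> borel_measurable borel" using uc by (rule borel_measurable_continuous_onI)
  have E': "(\<integral>\<^sup>+\<omega>. (\<Prod>i\<in>J. ennreal (exp (u (Z i \<omega>)))) \<partial>M) \<le> 1"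
    if N: "nearly_standard_vector M J Z c (1 / real R)" for J :: "nat set" and Z c
  proof -
    interpret N: nearly_standard_vector M J Z c "1 / real R" by fact
    have "(\<integral>\<^sup>+\<omega>. (\<Prod>i\<in>J. ennreal (exp (u (Z i \<omega>)))) \<partial>M) \<le>
      (\<integral>\<^sup>+z. ennreal (exp (u (sqrt (1 - 1 / real R) * z))) \<partial>std_normal_distribution) ^ card J"
    proof (rule N.expectation_prod_le)
      show "exp (u y) \<le> exp (u x)" if "\<bar>x\<bar> \<le> \<bar>y\<bar>" for x y
        using that \<theta> p by (auto simp: u_def intro!: powr_mono2)
    qed (use R in auto)
    also have "\<dots> \<le> 1 ^ card J" using E by (intro power_mono) (auto simp: u_def r_def)
    finally show ?thesis by simp
  qed
  define \<kappa> where "\<kappa> = \<theta> * (\<epsilon> / 2) * (b - a) / (2 * real R)"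
  show thesis
  proof
    show "0 < \<kappa>" using \<theta> \<epsilon> ab R by (simp add: \<kappa>_def)
    fix h assume h: "0 < h" "h \<le> b - a"
    have "integral {a..b} (\<lambda>x. u (Y h x \<omega>)) = \<theta> * ((m - \<epsilon> / 2) * (b - a) - path_moment p a b h \<omega>)" for \<omega>
    proof -
      have "integral {a..b} (\<lambda>x. m - \<epsilon> / 2 - \<bar>Y h x \<omega>\<bar> powr p) = integral {a..b} (\<lambda>x. m - \<epsilon> / 2) - path_moment p a b h \<omega>"
        unfolding path_moment_def by (intro integral_diff path_integrable[OF continuous_abs_powr[OF p]] integrable_const_ivl)
      then show ?thesis using ab by (simp add: u_def)
    qed
    note I = this
    have "{\<omega>\<in>space M. path_moment p a b h \<omega> \<le> (m - \<epsilon>) * (b - a)} \<subseteq>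
        {\<omega>\<in>space M. \<theta> * (\<epsilon> / 2) * (b - a) \<le> integral {a..b} (\<lambda>x. u (Y h x \<omega>))}"
    proof clarify
      fix \<omega> assume "path_moment p a b h \<omega> \<le> (m - \<epsilon>) * (b - a)"
      moreover have "(m - \<epsilon>) * (b - a) + \<epsilon> / 2 * (b - a) = (m - \<epsilon> / 2) * (b - a)"
        unfolding distrib_right[symmetric] by simp
      ultimately have "\<epsilon> / 2 * (b - a) \<le> (m - \<epsilon> / 2) * (b - a) - path_moment p a b h \<omega>" by linarith
      then show "\<theta> * (\<epsilon> / 2) * (b - a) \<le> integral {a..b} (\<lambda>x. u (Y h x \<omega>))"
        unfolding I mult.assoc using \<theta> by (intro mult_left_mono) auto
    qed
    moreover have "{\<omega>\<in>space M. \<theta> * (\<epsilon> / 2) * (b - a) \<le> integral {a..b} (\<lambda>x. u (Y h x \<omega>))} \<in> events"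
      using path_integral_measurable[OF uc] by measurable
    ultimately have "prob {\<omega>\<in>space M. path_moment p a b h \<omega> \<le> (m - \<epsilon>) * (b - a)} \<le>
       prob {\<omega>\<in>space M. \<theta> * (\<epsilon> / 2) * (b - a) \<le> integral {a..b} (\<lambda>x. u (Y h x \<omega>))}"
      by (rule finite_measure_mono)
    also have "\<dots> \<le> exp (- (\<theta> * (\<epsilon> / 2) * (b - a)) / (2 * real R * h))"
      using R \<theta> \<epsilon> ab by (intro path_exponential_bound[OF uc h _ _ E']) auto
    also have "\<dots> = exp (- \<kappa> / h)" by (simp add: \<kappa>_def)
    finally show "prob {\<omega>\<in>space M. path_moment p a b h \<omega> \<le> (normal_abs_moment p - \<epsilon>) * (b - a)} \<le> exp (- \<kappa> / h)"
      by (simp add: m_def)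
  qed
qed

text \<open>For \<open>p > 2\<close> the variable \<open>\<bar>\<eta>\<bar> powr p\<close> has no exponential moments, so it is truncated at a level \<open>T\<close>, to be chosen
depending on \<open>h\<close>. The truncated power is at most \<open>p * T powr (p - 1) * \<bar>y\<bar>\<close>, so \<open>\<theta>\<close> may be of the order
\<open>T powr (1 - p)\<close>; this gives the first term. The second term is Markov's inequality for the part cut off.\<close>

lemma upper_tail:
  assumes p: "1 \<le> p" and \<epsilon>: "0 < \<epsilon>" and ab: "a < b" "b - a \<le> \<delta>"
  obtains \<kappa> C where "0 < \<kappa>" "0 \<le> C" "\<And>h T. 0 < h \<Longrightarrow> h \<le> b - a \<Longrightarrow> 1 \<le> T \<Longrightarrow>
    prob {\<omega>\<in>space M. (normal_abs_moment p + \<epsilon>) * (b - a) \<le> path_moment p a b h \<omega>} \<le>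
      exp (- \<kappa> * T powr (1 - p) / h) + C * exp (- T\<^sup>2 / 8)"
proof -
  define m where "m = normal_abs_moment p"
  have lim: "(\<lambda>R. sqrt (1 + 1 / real R)) \<longlonglongrightarrow> 1"
    using tendsto_real_sqrt[OF tendsto_add[OF tendsto_const[of 1] lim_1_over_n]] by simp
  obtain R :: nat where R: "2 \<le> R" and mR: "sqrt (1 + 1 / real R) powr p * m < m + \<epsilon> / 8"
  proof (rule eventually_scaled_moment[OF lim, of "m - 1" m "m + \<epsilon> / 8" p])
    show "m - 1 < m" "m < m + \<epsilon> / 8" using \<epsilon> by simp_all
  qed
  define r where "r = sqrt (1 + 1 / real R)"
  have r: "0 \<le> r" "r \<le> 2" 
  proof -
    have "1 + 1 / real R \<le> 2\<^sup>2" using R by (simp add: field_simps)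
    then show "0 \<le> r" "r \<le> 2" using R by (auto simp: r_def intro: real_le_lsqrt)
  qed
  obtain B where B: "0 \<le> B" and EB: "\<And>T \<theta> r. 0 < T \<Longrightarrow> 0 < \<theta> \<Longrightarrow> \<theta> * (p * T powr (p - 1)) \<le> 1 \<Longrightarrow> 0 \<le> r \<Longrightarrow> r \<le> 2 \<Longrightarrow>
      (\<integral>\<^sup>+z. ennreal (exp (\<theta> * truncated_powr p T (r * z))) \<partial>std_normal_distribution) \<le>
      ennreal (exp (\<theta> * (r powr p * m) + \<theta>\<^sup>2 * B))"
    using truncated_powr_exp_moment[OF p] unfolding m_def normal_abs_moment_def by metis
  \<comment> \<open>The first bound gives \<open>\<theta> * p * T powr (p - 1) \<le> 1\<close>, the second absorbs the quadratic term \<open>\<theta> * B\<close> into \<open>\<epsilon> / 8\<close>.\<close>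
  define \<theta>\<^sub>0 where "\<theta>\<^sub>0 = min (1 / p) (\<epsilon> / (8 * (B + 1)))"
  have \<theta>0: "0 < \<theta>\<^sub>0" "\<theta>\<^sub>0 * p \<le> 1" "\<theta>\<^sub>0 * B \<le> \<epsilon> / 8"
  proof -
    show "0 < \<theta>\<^sub>0" using p \<epsilon> B by (simp add: \<theta>\<^sub>0_def)
    have "\<theta>\<^sub>0 * p \<le> 1 / p * p" using p by (intro mult_right_mono) (auto simp: \<theta>\<^sub>0_def)
    then show "\<theta>\<^sub>0 * p \<le> 1" using p by simp
    have "\<theta>\<^sub>0 * B \<le> \<epsilon> / (8 * (B + 1)) * (B + 1)" using B \<epsilon> by (intro mult_mono) (auto simp: \<theta>\<^sub>0_def)
    moreover have "\<epsilon> / (8 * (B + 1)) * (B + 1) = \<epsilon> / 8"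
    proof -
      have "B + 1 \<noteq> 0" using B by linarith
      then show ?thesis by (simp add: divide_eq_eq)
    qed
    ultimately show "\<theta>\<^sub>0 * B \<le> \<epsilon> / 8" by (rule ord_le_eq_trans)
  qed
  define \<rho> where "\<rho> y = \<bar>y\<bar> powr p * exp (y\<^sup>2 / 8)" for y :: real
  have \<rho>c: "continuous_on UNIV \<rho>" unfolding \<rho>_def by (intro continuous_intros continuous_abs_powr p) auto
  have \<rho>0: "0 \<le> \<rho> y" for y by (simp add: \<rho>_def)
  define K where "K = (\<integral>z. \<rho> z \<partial>std_normal_distribution)"
  have K: "0 \<le> K" "(\<integral>\<^sup>+z. ennreal (\<rho> z) \<partial>std_normal_distribution) = ennreal K"
  proof -
    have "integrable std_normal_distribution \<rho>"
      using integrable_std_normal_powr_exp[of p 0] p by (simp add: \<rho>_def[abs_def])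
    then show "0 \<le> K" "(\<integral>\<^sup>+z. ennreal (\<rho> z) \<partial>std_normal_distribution) = ennreal K"
      using \<rho>0 by (auto simp: K_def nn_integral_eq_integral)
  qed
  define \<kappa> where "\<kappa> = \<theta>\<^sub>0 * (\<epsilon> / 4) * (b - a) / (2 * real R)"
  define C where "C = 2 * K / \<epsilon>"
  show thesis
  proof
    show "0 < \<kappa>" using \<theta>0 \<epsilon> ab R by (simp add: \<kappa>_def)
    show "0 \<le> C" using K \<epsilon> by (simp add: C_def)
    fix h T :: real assume h: "0 < h" "h \<le> b - a" and T: "1 \<le> T"
    have hd: "h \<le> \<delta>" using h ab by simp
    have T0: "0 < T" using T by simp
    define \<theta> where "\<theta> = \<theta>\<^sub>0 * T powr (1 - p)"
    have \<theta>: "0 < \<theta>" "\<theta> \<le> \<theta>\<^sub>0" "\<theta> * (p * T powr (p - 1)) \<le> 1"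
    proof -
      show "0 < \<theta>" using \<theta>0 T by (simp add: \<theta>_def)
      have "T powr (1 - p) \<le> T powr 0" using T p by (intro powr_mono) auto
      then show "\<theta> \<le> \<theta>\<^sub>0" using \<theta>0 T by (simp add: \<theta>_def mult_le_cancel_left1)
      have "\<theta> * (p * T powr (p - 1)) = \<theta>\<^sub>0 * p * (T powr (1 - p) * T powr (p - 1))" by (simp add: \<theta>_def mult_ac)
      also have "T powr (1 - p) * T powr (p - 1) = 1" using T by (simp flip: powr_add)
      finally show "\<theta> * (p * T powr (p - 1)) \<le> 1" using \<theta>0(2) by (simp only: mult_1_right)
    qed
    let ?\<psi> = "truncated_powr p T"
    have \<psi>c: "continuous_on UNIV ?\<psi>" using p T by (intro continuous_truncated_powr) auto
    define u where "u y = \<theta> * (?\<psi> y - (m + \<epsilon> / 4))" for y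
    have uc: "continuous_on UNIV u" unfolding u_def by (intro continuous_intros \<psi>c)
    have um[measurable]: "u \<in> borel_measurable borel" using uc by (rule borel_measurable_continuous_onI)
    have Eu: "(\<integral>\<^sup>+z. ennreal (exp (u (r * z))) \<partial>std_normal_distribution) \<le> 1"
    proof -
      have [measurable]: "?\<psi> \<in> borel_measurable borel" using \<psi>c by (rule borel_measurable_continuous_onI)
      have "(\<integral>\<^sup>+z. ennreal (exp (u (r * z))) \<partial>std_normal_distribution) =
          (\<integral>\<^sup>+z. ennreal (exp (- (\<theta> * (m + \<epsilon> / 4)))) * ennreal (exp (\<theta> * ?\<psi> (r * z))) \<partial>std_normal_distribution)"
        by (intro nn_integral_cong) (simp add: u_def algebra_simps exp_add[symmetric] flip: ennreal_mult)
      also have "\<dots> = ennreal (exp (- (\<theta> * (m + \<epsilon> / 4)))) * (\<integral>\<^sup>+z. ennreal (exp (\<theta> * ?\<psi> (r * z))) \<partial>std_normal_distribution)"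
        by (rule nn_integral_cmult) measurable
      also have "\<dots> \<le> ennreal (exp (- (\<theta> * (m + \<epsilon> / 4)))) * ennreal (exp (\<theta> * (r powr p * m) + \<theta>\<^sup>2 * B))"
        by (intro mult_left_mono EB T0 \<theta> r) auto
      also have "\<dots> = ennreal (exp (\<theta> * (r powr p * m + \<theta> * B - (m + \<epsilon> / 4))))"
        by (simp add: ennreal_mult[symmetric] exp_add[symmetric] power2_eq_square algebra_simps)
      also have "\<dots> \<le> ennreal 1"
      proof -
        have "\<theta> * B \<le> \<epsilon> / 8" using \<theta> \<theta>0 B by (meson mult_right_mono order_trans)
        then have "r powr p * m + \<theta> * B - (m + \<epsilon> / 4) \<le> 0" using mR by (simp add: r_def)
        then show ?thesis using \<theta> by (intro ennreal_leI) (simp add: mult_nonneg_nonpos)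
      qed
      finally show ?thesis by simp
    qed
    have E': "(\<integral>\<^sup>+\<omega>. (\<Prod>i\<in>J. ennreal (exp (u (Z i \<omega>)))) \<partial>M) \<le> 1"
      if N: "nearly_standard_vector M J Z c (1 / real R)" for J :: "nat set" and Z c
    proof -
      interpret N: nearly_standard_vector M J Z c "1 / real R" by fact
      have "(\<integral>\<^sup>+\<omega>. (\<Prod>i\<in>J. ennreal (exp (u (Z i \<omega>)))) \<partial>M) \<le>
        (\<integral>\<^sup>+z. ennreal (exp (u (sqrt (1 + 1 / real R) * z))) \<partial>std_normal_distribution) ^ card J"
      proof (rule N.expectation_exp_convex_le)
        show "u x \<le> (u (x + w) + u (x - w)) / 2" for x w
        proof -
          have "\<theta> * ?\<psi> x \<le> \<theta> * ((?\<psi> (x + w) + ?\<psi> (x - w)) / 2)"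
            using \<theta> truncated_powr_midpoint[OF p T0] by (intro mult_left_mono) auto
          then show ?thesis by (simp add: u_def algebra_simps add_divide_distrib)
        qed
      qed (use R in auto)
      also have "\<dots> \<le> 1 ^ card J" using Eu by (intro power_mono) (auto simp: r_def)
      finally show ?thesis by simp
    qed
    define A1 where "A1 = {\<omega>\<in>space M. \<theta> * (\<epsilon> / 4) * (b - a) \<le> integral {a..b} (\<lambda>x. u (Y h x \<omega>))}"
    define A2 where "A2 = {\<omega>\<in>space M. \<epsilon> / 2 * (b - a) \<le> exp (- T\<^sup>2 / 8) * integral {a..b} (\<lambda>x. \<rho> (Y h x \<omega>))}"
    have [measurable]: "A1 \<in> events" unfolding A1_def using path_integral_measurable[OF uc] by measurable
    have [measurable]: "A2 \<in> events" unfolding A2_def using path_integral_measurable[OF \<rho>c] by measurable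
    have sub: "{\<omega>\<in>space M. (m + \<epsilon>) * (b - a) \<le> path_moment p a b h \<omega>} \<subseteq> A1 \<union> A2"
    proof
      fix \<omega> assume "\<omega> \<in> {\<omega>\<in>space M. (m + \<epsilon>) * (b - a) \<le> path_moment p a b h \<omega>}"
      then have \<omega>: "\<omega> \<in> space M" "(m + \<epsilon>) * (b - a) \<le> path_moment p a b h \<omega>" by auto
      define P where "P = integral {a..b} (\<lambda>x. ?\<psi> (Y h x \<omega>))"
      define Q where "Q = exp (- T\<^sup>2 / 8) * integral {a..b} (\<lambda>x. \<rho> (Y h x \<omega>))"
      have i\<psi>: "(\<lambda>x. ?\<psi> (Y h x \<omega>)) integrable_on {a..b}" by (rule path_integrable[OF \<psi>c])
      have i\<rho>: "(\<lambda>x. exp (- T\<^sup>2 / 8) * \<rho> (Y h x \<omega>)) integrable_on {a..b}"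
        by (rule path_integrable[of "\<lambda>y. exp (- T\<^sup>2 / 8) * \<rho> y"]) (intro continuous_intros \<rho>c)
      have "path_moment p a b h \<omega> \<le> integral {a..b} (\<lambda>x. ?\<psi> (Y h x \<omega>) + exp (- T\<^sup>2 / 8) * \<rho> (Y h x \<omega>))"
        unfolding path_moment_def using truncated_powr_bounds(4)[OF p T0]
        by (intro integral_le path_integrable[OF continuous_abs_powr[OF p]] integrable_add i\<psi> i\<rho>) (auto simp: \<rho>_def)
      also have "\<dots> = P + Q" unfolding P_def Q_def using integral_add[OF i\<psi> i\<rho>] by simp
      finally have PQ: "(m + \<epsilon>) * (b - a) \<le> P + Q" using \<omega> by simp
      have "integral {a..b} (\<lambda>x. u (Y h x \<omega>)) = \<theta> * (P - (m + \<epsilon> / 4) * (b - a))"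
      proof -
        have "integral {a..b} (\<lambda>x. ?\<psi> (Y h x \<omega>) - (m + \<epsilon> / 4)) = P - integral {a..b} (\<lambda>x. m + \<epsilon> / 4)"
          unfolding P_def by (intro integral_diff i\<psi> integrable_const_ivl)
        then show ?thesis using ab by (simp add: u_def mult.commute)
      qed
      moreover have "(\<epsilon> / 4) * (b - a) \<le> P - (m + \<epsilon> / 4) * (b - a) \<or> \<epsilon> / 2 * (b - a) \<le> Q"
      proof (rule disjCI)
        assume "\<not> \<epsilon> / 2 * (b - a) \<le> Q"
        then have "(m + \<epsilon>) * (b - a) < P + \<epsilon> / 2 * (b - a)" using PQ by simp
        then show "(\<epsilon> / 4) * (b - a) \<le> P - (m + \<epsilon> / 4) * (b - a)" by (simp add: field_simps)
      qed
      ultimately show "\<omega> \<in> A1 \<union> A2"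
        using \<omega> \<theta> by (auto simp: A1_def A2_def Q_def mult.assoc)
    qed
    have "prob {\<omega>\<in>space M. (m + \<epsilon>) * (b - a) \<le> path_moment p a b h \<omega>} \<le> prob (A1 \<union> A2)"
      by (rule finite_measure_mono[OF sub]) measurable
    also have "\<dots> \<le> prob A1 + prob A2" by (rule measure_Un_le) measurable
    also have "prob A1 \<le> exp (- \<kappa> * T powr (1 - p) / h)"
    proof -
      have "prob A1 \<le> exp (- (\<theta> * (\<epsilon> / 4) * (b - a)) / (2 * real R * h))"
        unfolding A1_def using R \<theta> \<epsilon> ab by (intro path_exponential_bound[OF uc h _ _ E']) auto
      also have "\<dots> = exp (- \<kappa> * T powr (1 - p) / h)" by (simp add: \<kappa>_def \<theta>_def mult_ac)
      finally show ?thesis .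
    qed
    also have "prob A2 \<le> C * exp (- T\<^sup>2 / 8)"
    proof -
      have "ennreal (\<epsilon> / 2 * (b - a)) * emeasure M A2 = (\<integral>\<^sup>+\<omega>. ennreal (\<epsilon> / 2 * (b - a)) * indicator A2 \<omega> \<partial>M)"
        by (simp add: nn_integral_cmult_indicator)
      also have "\<dots> \<le> (\<integral>\<^sup>+\<omega>. ennreal (exp (- T\<^sup>2 / 8)) * ennreal (integral {a..b} (\<lambda>x. \<rho> (Y h x \<omega>))) \<partial>M)"
      proof (intro nn_integral_mono)
        fix \<omega>
        show "ennreal (\<epsilon> / 2 * (b - a)) * indicator A2 \<omega> \<le> ennreal (exp (- T\<^sup>2 / 8)) * ennreal (integral {a..b} (\<lambda>x. \<rho> (Y h x \<omega>)))"
        proof (cases "\<omega> \<in> A2")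
          case True
          then show ?thesis by (auto simp: A2_def ennreal_mult'[symmetric] intro!: ennreal_leI)
        qed simp
      qed
      also have "\<dots> = ennreal (exp (- T\<^sup>2 / 8)) * (ennreal (b - a) * ennreal K)"
        using path_integral_measurable[OF \<rho>c] ab by (subst nn_integral_cmult) (auto simp: mean_path_integral[OF \<rho>c \<rho>0 h(1) hd] K)
      also have "\<dots> = ennreal (exp (- T\<^sup>2 / 8) * ((b - a) * K))"
        using ab K by (simp add: ennreal_mult)
      also have "ennreal (\<epsilon> / 2 * (b - a)) * emeasure M A2 = ennreal (\<epsilon> / 2 * (b - a) * prob A2)"
        unfolding emeasure_eq_measure using ab \<epsilon> by (intro ennreal_mult[symmetric]) auto
      finally have "ennreal (\<epsilon> / 2 * (b - a) * prob A2) \<le> ennreal (exp (- T\<^sup>2 / 8) * ((b - a) * K))" .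
      then have "\<epsilon> / 2 * (b - a) * prob A2 \<le> exp (- T\<^sup>2 / 8) * ((b - a) * K)"
        using ab K by (subst (asm) ennreal_le_iff) auto
      then have "(b - a) * (\<epsilon> / 2 * prob A2) \<le> (b - a) * (exp (- T\<^sup>2 / 8) * K)" by (simp add: mult_ac)
      then have "\<epsilon> / 2 * prob A2 \<le> exp (- T\<^sup>2 / 8) * K" using ab by (simp add: mult_le_cancel_left)
      then show ?thesis using \<epsilon> by (simp add: C_def field_simps)
    qed
    finally show "prob {\<omega>\<in>space M. (normal_abs_moment p + \<epsilon>) * (b - a) \<le> path_moment p a b h \<omega>} \<le>
      exp (- \<kappa> * T powr (1 - p) / h) + C * exp (- T\<^sup>2 / 8)" by (simp add: m_def)
  qed
qed

end

section \<open>Almost sure convergence along the sequence of step sizes\<close>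

context stationary_gaussian
begin

text \<open>With \<open>l = ln n\<close>, \<open>h = l powr (- q)\<close> and \<open>T = l powr (q / (2 * p))\<close>, the two error terms of the upper tail have
exponents of order \<open>T powr (1 - p) / h = l powr (q * (p + 1) / (2 * p))\<close> and \<open>T\<^sup>2 = l powr (q / p)\<close>. Both
exponents of \<open>l\<close> exceed 1, as does the exponent \<open>q\<close> from the lower tail, so the tail
probabilities are summable. The window must not be longer than \<open>\<delta>\<close>: nothing is known about covariances at larger distances, and a periodic process shows that they
need not be small.\<close>

lemma window_convergence:
  assumes p: "1 \<le> p" "p < q" and hs: "\<And>n. 2 \<le> n \<Longrightarrow> hs n = 1 / ln (real n) powr q" and ab: "a < b" "b - a \<le> \<delta>"
  shows "AE \<omega> in M. (\<lambda>n. path_moment p a b (hs n) \<omega>) \<longlonglongrightarrow> normal_abs_moment p * (b - a)"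
proof -
  define m where "m = normal_abs_moment p"
  define L where "L = b - a"
  have L: "0 < L" using ab by (simp add: L_def)
  have ln_top: "filterlim (\<lambda>n. ln (real n)) at_top sequentially"
    by (rule filterlim_compose[OF ln_at_top filterlim_real_sequentially])
  have small: "eventually (\<lambda>n. 1 \<le> ln (real n) \<and> 0 < hs n \<and> hs n \<le> L \<and> hs n = 1 / ln (real n) powr q) sequentially"
  proof -
    have "eventually (\<lambda>n. max 1 ((1 / L) powr (1 / q)) \<le> ln (real n)) sequentially"
      using ln_top unfolding filterlim_at_top by (rule spec)
    then show ?thesis using eventually_ge_at_top[of 2]
    proof eventually_elim
      case (elim n)
      have "1 / L = ((1 / L) powr (1 / q)) powr q" using p L by (simp add: powr_powr)
      also have "\<dots> \<le> ln (real n) powr q" using elim p by (intro powr_mono2) auto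
      finally have "1 / ln (real n) powr q \<le> L" using L elim by (simp add: field_simps)
      then show ?case using elim hs[of n] by auto
    qed
  qed
  have conv: "AE \<omega> in M. eventually (\<lambda>n. \<bar>path_moment p a b (hs n) \<omega> - m * L\<bar> < \<epsilon> * L) sequentially" if \<epsilon>: "0 < \<epsilon>" for \<epsilon>
  proof -
    obtain \<kappa>1 where \<kappa>1: "0 < \<kappa>1" and lo: "\<And>h. 0 < h \<Longrightarrow> h \<le> b - a \<Longrightarrow>
      prob {\<omega>\<in>space M. path_moment p a b h \<omega> \<le> (normal_abs_moment p - \<epsilon>) * (b - a)} \<le> exp (- \<kappa>1 / h)"
      by (rule lower_tail[OF p(1) \<epsilon> ab]) (rule that)
    obtain \<kappa>2 C where \<kappa>2: "0 < \<kappa>2" and C: "0 \<le> C" and up: "\<And>h T. 0 < h \<Longrightarrow> h \<le> b - a \<Longrightarrow> 1 \<le> T \<Longrightarrow>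
      prob {\<omega>\<in>space M. (normal_abs_moment p + \<epsilon>) * (b - a) \<le> path_moment p a b h \<omega>} \<le>
      exp (- \<kappa>2 * T powr (1 - p) / h) + C * exp (- T\<^sup>2 / 8)"
      by (rule upper_tail[OF p(1) \<epsilon> ab]) (rule that)
    define A where "A n = {\<omega>\<in>space M. path_moment p a b (hs n) \<omega> \<le> (m - \<epsilon>) * L} \<union> {\<omega>\<in>space M. (m + \<epsilon>) * L \<le> path_moment p a b (hs n) \<omega>}" for n
    have pm: "path_moment p a b h \<in> borel_measurable M" for h using p(1) by (rule path_moment_measurable)
    have Alo: "{\<omega>\<in>space M. path_moment p a b (hs n) \<omega> \<le> (m - \<epsilon>) * L} \<in> events" for n using pm by measurable
    have Aup: "{\<omega>\<in>space M. (m + \<epsilon>) * L \<le> path_moment p a b (hs n) \<omega>} \<in> events" for n using pm by measurable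
    have A: "A n \<in> events" for n unfolding A_def using Alo Aup by (rule sets.Un)
    define l where "l n = ln (real n)" for n
    define r where "r = q * (p + 1) / (2 * p)"
    have r: "1 < r"
    proof -
      have "2 * p \<le> (p + 1) * p" using p by (intro mult_right_mono) auto
      also have "\<dots> < (p + 1) * q" using p by (intro mult_strict_left_mono) auto
      finally have "2 * p < q * (p + 1)" by (simp only: mult.commute)
      then show ?thesis unfolding r_def using p by (simp add: less_divide_eq)
    qed
    have qp: "1 < q / p" "1 < q" using p by (auto simp: field_simps)
    have "summable (\<lambda>n. prob (A n))"
    proof (rule summable_comparison_test_ev)
      have c8: "(0::real) < 1 / 8" by simp
      show "summable (\<lambda>n. exp (- \<kappa>1 * ln (real n) powr q) + (exp (- \<kappa>2 * ln (real n) powr r) + C * exp (- (1 / 8) * ln (real n) powr (q / p))))"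
        by (intro summable_add summable_mult summable_exp_ln_powr \<kappa>1 \<kappa>2 r qp c8)
      show "eventually (\<lambda>n. norm (prob (A n)) \<le> exp (- \<kappa>1 * ln (real n) powr q) +
          (exp (- \<kappa>2 * ln (real n) powr r) + C * exp (- (1 / 8) * ln (real n) powr (q / p)))) sequentially"
        using small
      proof eventually_elim
        case (elim n)
        define T where "T = l n powr (q / (2 * p))"
        have l1: "1 \<le> l n" and h: "0 < hs n" "hs n \<le> b - a" and hn: "hs n = 1 / l n powr q" using elim by (auto simp: l_def L_def)
        have T: "1 \<le> T" unfolding T_def using l1 p by (simp add: ge_one_powr_ge_zero)
        have "prob (A n) \<le> prob {\<omega>\<in>space M. path_moment p a b (hs n) \<omega> \<le> (m - \<epsilon>) * L} + prob {\<omega>\<in>space M. (m + \<epsilon>) * L \<le> path_moment p a b (hs n) \<omega>}"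
          unfolding A_def by (rule measure_Un_le[OF Alo Aup])
        also have "\<dots> \<le> exp (- \<kappa>1 / hs n) + (exp (- \<kappa>2 * T powr (1 - p) / hs n) + C * exp (- T\<^sup>2 / 8))"
          unfolding m_def L_def by (intro add_mono lo[OF h] up[OF h T])
        also have "- \<kappa>1 / hs n = - \<kappa>1 * l n powr q" by (simp add: hn)
        also have "- \<kappa>2 * T powr (1 - p) / hs n = - \<kappa>2 * l n powr r"
        proof -
          have "T powr (1 - p) * l n powr q = l n powr (q / (2 * p) * (1 - p) + q)"
            unfolding T_def by (simp add: powr_powr powr_add)
          also have "q / (2 * p) * (1 - p) + q = r" unfolding r_def using p by (simp add: field_simps)
          finally show ?thesis by (simp add: hn)
        qed
        also have "- T\<^sup>2 / 8 = - (1 / 8) * l n powr (q / p)"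
        proof -
          have "T\<^sup>2 = l n powr (q / (2 * p) + q / (2 * p))" unfolding T_def power2_eq_square by (rule powr_add[symmetric])
          also have "q / (2 * p) + q / (2 * p) = q / p" by (simp add: field_simps)
          finally show ?thesis by simp
        qed
        finally show ?case by (simp add: l_def)
      qed
    qed
    then have "AE \<omega> in M. eventually (\<lambda>n. \<omega> \<in> space M - A n) sequentially"
      by (intro borel_cantelli_AE1 A) (auto simp: emeasure_eq_measure)
    then show ?thesis
    proof (eventually_elim)
      case (elim \<omega>)
      then show ?case
      proof eventually_elim
        case (elim n)
        then have "(m - \<epsilon>) * L < path_moment p a b (hs n) \<omega>" "path_moment p a b (hs n) \<omega> < (m + \<epsilon>) * L"
          by (auto simp: A_def not_le)
        then have "m * L - \<epsilon> * L < path_moment p a b (hs n) \<omega>" "path_moment p a b (hs n) \<omega> < m * L + \<epsilon> * L"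
          by (simp_all add: algebra_simps)
        then show ?case by linarith
      qed
    qed
  qed
  have "AE \<omega> in M. \<forall>k::nat. eventually (\<lambda>n. \<bar>path_moment p a b (hs n) \<omega> - m * L\<bar> < 1 / real (Suc k) * L) sequentially"
    unfolding AE_all_countable by (intro allI conv) simp
  then show ?thesis
  proof eventually_elim
    case (elim \<omega>)
    have "(\<lambda>n. path_moment p a b (hs n) \<omega>) \<longlonglongrightarrow> m * L"
    proof (rule tendstoI)
      fix e :: real assume e: "0 < e"
      obtain k where k: "inverse (real (Suc k)) < e / L" using reals_Archimedean[of "e / L"] e L by auto
      then have kL: "1 / real (Suc k) * L < e" using L by (simp add: field_simps del: of_nat_Suc)
      show "eventually (\<lambda>n. dist (path_moment p a b (hs n) \<omega>) (m * L) < e) sequentially"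
        using elim[rule_format, of k] by eventually_elim (use kL in \<open>simp add: dist_real_def\<close>)
    qed
    then show ?case by (simp add: m_def L_def)
  qed
qed

lemma path_moment_subdivide:
  assumes p: "1 \<le> p" and d: "0 \<le> d"
  shows "path_moment p a (a + real N * d) h \<omega> = (\<Sum>i<N. path_moment p (a + real i * d) (a + real (Suc i) * d) h \<omega>)"
proof (induction N)
  case (Suc N)
  have "path_moment p a (a + real N * d) h \<omega> + path_moment p (a + real N * d) (a + real (Suc N) * d) h \<omega> = path_moment p a (a + real (Suc N) * d) h \<omega>"
    unfolding path_moment_def
    by (intro Henstock_Kurzweil_Integration.integral_combine path_integrable[OF continuous_abs_powr[OF p]])
       (use d in \<open>auto intro: mult_right_mono\<close>)
  then show ?case using Suc by simp
qed (simp add: path_moment_def)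

text \<open>Longer windows are cut into pieces of length at most \<open>\<delta>\<close>. Only countably many windows are treated, so
that a single null set suffices.\<close>

lemma rational_windows_convergence:
  assumes p: "1 \<le> p" "p < q" and hs: "\<And>n. 2 \<le> n \<Longrightarrow> hs n = 1 / ln (real n) powr q"
  shows "AE \<omega> in M. \<forall>a\<in>\<rat>. \<forall>b\<in>\<rat>. a < b \<longrightarrow> (\<lambda>n. path_moment p a b (hs n) \<omega>) \<longlonglongrightarrow> normal_abs_moment p * (b - a)"
proof -
  have "AE \<omega> in M. a < b \<longrightarrow> (\<lambda>n. path_moment p a b (hs n) \<omega>) \<longlonglongrightarrow> normal_abs_moment p * (b - a)"
    if ab: "a \<in> \<rat>" "b \<in> \<rat>" for a b
  proof (cases "a < b")
    case True
    obtain N :: nat where N: "(b - a) / \<delta> < real N" using reals_Archimedean2 by blast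
    have N0: "0 < N" using N True \<delta> by (metis diff_gt_0_iff_gt divide_pos_pos gr0I less_asym of_nat_0)
    define d where "d = (b - a) / real N"
    have d: "0 < d" "d \<le> \<delta>" using N N0 True \<delta> by (auto simp: d_def field_simps)
    have Nd: "a + real N * d = b" using N0 by (simp add: d_def)
    have "AE \<omega> in M. \<forall>i\<in>{..<N}. (\<lambda>n. path_moment p (a + real i * d) (a + real (Suc i) * d) (hs n) \<omega>) \<longlonglongrightarrow> normal_abs_moment p * d"
    proof (rule AE_finite_allI)
      fix i assume "i \<in> {..<N}"
      show "AE \<omega> in M. (\<lambda>n. path_moment p (a + real i * d) (a + real (Suc i) * d) (hs n) \<omega>) \<longlonglongrightarrow> normal_abs_moment p * d"
        using window_convergence[OF p hs, of "a + real i * d" "a + real (Suc i) * d"] d by (simp add: algebra_simps)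
    qed simp
    then show ?thesis
    proof eventually_elim
      case (elim \<omega>)
      have "(\<lambda>n. \<Sum>i<N. path_moment p (a + real i * d) (a + real (Suc i) * d) (hs n) \<omega>) \<longlonglongrightarrow> (\<Sum>i<N. normal_abs_moment p * d)"
        using elim by (intro tendsto_sum) auto
      also have "(\<Sum>i<N. normal_abs_moment p * d) = normal_abs_moment p * (b - a)" using N0 by (simp add: d_def)
      finally show ?case using path_moment_subdivide[OF p(1), of d a N] d Nd by simp
    qed
  qed simp
  then have "AE \<omega> in M. \<forall>b\<in>\<rat>. a < b \<longrightarrow> (\<lambda>n. path_moment p a b (hs n) \<omega>) \<longlonglongrightarrow> normal_abs_moment p * (b - a)" if "a \<in> \<rat>" for a
    using that by (subst AE_ball_countable[OF countable_rat]) auto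
  then show ?thesis by (subst AE_ball_countable[OF countable_rat]) auto
qed

end

section \<open>From the sequence of step sizes to all step sizes\<close>

lemma powr_convex_combination_le:
  fixes x y t p :: real
  assumes p: "1 \<le> p" and xy: "0 \<le> x" "0 \<le> y" and t: "0 \<le> t" "t \<le> 1"
  shows "(t * x + (1 - t) * y) powr p \<le> t * x powr p + (1 - t) * y powr p"
proof -
  define z where "z = t * x + (1 - t) * y"
  have z: "0 \<le> z" using xy t by (simp add: z_def)
  define d where "d = p * z powr (p - 1)"
  have "t * (z powr p + d * (x - z)) \<le> t * x powr p" "(1 - t) * (z powr p + d * (y - z)) \<le> (1 - t) * y powr p"
    unfolding d_def using powr_tangent_le[OF p z] xy t by (auto intro!: mult_left_mono)
  moreover have "t * (z powr p + d * (x - z)) + (1 - t) * (z powr p + d * (y - z)) = z powr p + d * (t * x + (1 - t) * y - z)"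
    by (simp add: algebra_simps)
  ultimately show ?thesis by (simp add: z_def[symmetric])
qed

definition Lp_norm :: "real \<Rightarrow> real \<Rightarrow> real \<Rightarrow> (real \<Rightarrow> real) \<Rightarrow> real" where
  "Lp_norm p a b v = integral {a..b} (\<lambda>x. \<bar>v x\<bar> powr p) powr (1 / p)"

context
  fixes p :: real
  assumes p: "1 \<le> p"
begin

lemma Lp_norm_nonneg: "0 \<le> Lp_norm p a b v"
  by (simp add: Lp_norm_def)

lemma abs_powr_continuous:
  fixes v :: "real \<Rightarrow> real"
  shows "continuous_on S v \<Longrightarrow> continuous_on S (\<lambda>x. \<bar>v x\<bar> powr p)"
  using p by (intro continuous_on_powr' continuous_intros) auto

lemma abs_powr_integrable:
  fixes v :: "real \<Rightarrow> real"
  shows "continuous_on UNIV v \<Longrightarrow> (\<lambda>x. \<bar>v x\<bar> powr p) integrable_on {a..b}"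
  by (intro integrable_continuous_real abs_powr_continuous) (rule continuous_on_subset, auto)

lemma Lp_norm_powr: "continuous_on UNIV v \<Longrightarrow> Lp_norm p a b v powr p = integral {a..b} (\<lambda>x. \<bar>v x\<bar> powr p)"
  using p integral_nonneg[OF abs_powr_integrable[of v a b]] by (simp add: Lp_norm_def powr_powr)

lemma Lp_norm_mono:
  assumes "continuous_on UNIV v" "continuous_on UNIV w" "{a..b} \<subseteq> {a'..b'}" "\<And>x. x \<in> {a..b} \<Longrightarrow> \<bar>v x\<bar> \<le> \<bar>w x\<bar>"
  shows "Lp_norm p a b v \<le> Lp_norm p a' b' w"
proof -
  have "integral {a..b} (\<lambda>x. \<bar>v x\<bar> powr p) \<le> integral {a..b} (\<lambda>x. \<bar>w x\<bar> powr p)"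
    using assms p by (intro integral_le abs_powr_integrable powr_mono2) auto
  also have "\<dots> \<le> integral {a'..b'} (\<lambda>x. \<bar>w x\<bar> powr p)"
    using assms by (intro integral_subset_le abs_powr_integrable) auto
  finally show ?thesis unfolding Lp_norm_def using p
    by (intro powr_mono2) (auto intro!: integral_nonneg abs_powr_integrable assms)
qed

lemma Lp_norm_shift:
  assumes "continuous_on UNIV v"
  shows "Lp_norm p a b (\<lambda>x. v (x + s)) = Lp_norm p (a + s) (b + s) v"
  using integral_shift_Icc_real[of a b "\<lambda>x. \<bar>v x\<bar> powr p" s] by (simp add: Lp_norm_def comp_def add.commute)

lemma Lp_norm_scale:
  assumes "continuous_on UNIV v" "0 \<le> k"
  shows "Lp_norm p a b (\<lambda>x. k * v x) = k * Lp_norm p a b v"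
proof -
  have "integral {a..b} (\<lambda>x. \<bar>k * v x\<bar> powr p) = k powr p * integral {a..b} (\<lambda>x. \<bar>v x\<bar> powr p)"
    using assms by (simp add: abs_mult powr_mult)
  then show ?thesis using p assms integral_nonneg[OF abs_powr_integrable[OF assms(1)], of a b]
    by (simp add: Lp_norm_def powr_mult powr_powr)
qed

text \<open>Minkowski's inequality. With \<open>A\<close> and \<open>B\<close> slightly larger than the two norms, \<open>(u + v) / (A + B)\<close> is a convex
combination of \<open>u / A\<close> and \<open>v / B\<close>, and the \<open>p\<close>-th power is convex.\<close>

lemma Lp_norm_triangle:
  assumes u: "continuous_on UNIV u" and v: "continuous_on UNIV v"
  shows "Lp_norm p a b (\<lambda>x. u x + v x) \<le> Lp_norm p a b u + Lp_norm p a b v"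
proof (rule field_le_epsilon)
  fix e :: real assume e: "0 < e"
  define A where "A = Lp_norm p a b u + e / 2"
  define B where "B = Lp_norm p a b v + e / 2"
  have AB: "0 < A" "0 < B" using e Lp_norm_nonneg[of a b u] Lp_norm_nonneg[of a b v] by (auto simp: A_def B_def)
  define t where "t = A / (A + B)"
  have t: "0 \<le> t" "t \<le> 1" "1 - t = B / (A + B)" using AB by (auto simp: t_def field_simps)
  let ?U = "integral {a..b} (\<lambda>x. \<bar>u x\<bar> powr p)" and ?V = "integral {a..b} (\<lambda>x. \<bar>v x\<bar> powr p)"
  have bU: "?U \<le> A powr p" "?V \<le> B powr p"
    unfolding Lp_norm_powr[OF u, symmetric] Lp_norm_powr[OF v, symmetric]
    using e p Lp_norm_nonneg by (auto simp: A_def B_def intro!: powr_mono2)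
  have pt: "\<bar>u x + v x\<bar> powr p \<le> (A + B) powr p * (t / A powr p * \<bar>u x\<bar> powr p + (1 - t) / B powr p * \<bar>v x\<bar> powr p)" for x
  proof -
    have "t * (\<bar>u x\<bar> / A) = \<bar>u x\<bar> / (A + B)" "(1 - t) * (\<bar>v x\<bar> / B) = \<bar>v x\<bar> / (A + B)"
      unfolding t(3) using AB by (simp_all add: t_def)
    then have "(A + B) * (t * (\<bar>u x\<bar> / A) + (1 - t) * (\<bar>v x\<bar> / B)) = \<bar>u x\<bar> + \<bar>v x\<bar>"
      using AB by (simp add: add_divide_distrib[symmetric])
    then have "\<bar>u x + v x\<bar> \<le> (A + B) * (t * (\<bar>u x\<bar> / A) + (1 - t) * (\<bar>v x\<bar> / B))"
      using abs_triangle_ineq[of "u x" "v x"] by simp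
    then have "\<bar>u x + v x\<bar> powr p \<le> ((A + B) * (t * (\<bar>u x\<bar> / A) + (1 - t) * (\<bar>v x\<bar> / B))) powr p"
      using p by (intro powr_mono2) auto
    also have "\<dots> = (A + B) powr p * (t * (\<bar>u x\<bar> / A) + (1 - t) * (\<bar>v x\<bar> / B)) powr p"
      by (rule powr_mult)
    also have "\<dots> \<le> (A + B) powr p * (t * (\<bar>u x\<bar> / A) powr p + (1 - t) * (\<bar>v x\<bar> / B) powr p)"
      using AB t by (intro mult_left_mono powr_convex_combination_le p) auto
    also have "\<dots> = (A + B) powr p * (t / A powr p * \<bar>u x\<bar> powr p + (1 - t) / B powr p * \<bar>v x\<bar> powr p)"
      using AB by (simp add: powr_divide)
    finally show ?thesis .
  qed
  have iu: "(\<lambda>x. t / A powr p * \<bar>u x\<bar> powr p) integrable_on {a..b}" and iv: "(\<lambda>x. (1 - t) / B powr p * \<bar>v x\<bar> powr p) integrable_on {a..b}"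
    using integrable_on_cmult_left[OF abs_powr_integrable[OF u], of "t / A powr p" a b]
      integrable_on_cmult_left[OF abs_powr_integrable[OF v], of "(1 - t) / B powr p" a b] by simp_all
  have "integral {a..b} (\<lambda>x. \<bar>u x + v x\<bar> powr p) \<le>
     integral {a..b} (\<lambda>x. (A + B) powr p * (t / A powr p * \<bar>u x\<bar> powr p + (1 - t) / B powr p * \<bar>v x\<bar> powr p))"
    using integrable_on_cmult_left[OF integrable_add[OF iu iv], of "(A + B) powr p"] pt u v
    by (intro integral_le abs_powr_integrable continuous_intros) auto
  also have "\<dots> = (A + B) powr p * (t / A powr p * ?U + (1 - t) / B powr p * ?V)"
    using integral_add[OF iu iv] by simp
  also have "\<dots> \<le> (A + B) powr p * (t / A powr p * A powr p + (1 - t) / B powr p * B powr p)"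
    using bU t(1,2) AB by (intro mult_left_mono add_mono) auto
  also have "\<dots> = (A + B) powr p" using AB by simp
  finally have "integral {a..b} (\<lambda>x. \<bar>u x + v x\<bar> powr p) powr (1 / p) \<le> ((A + B) powr p) powr (1 / p)"
    using p by (intro powr_mono2 integral_nonneg abs_powr_integrable continuous_intros u v) auto
  also have "\<dots> = A + B" using p AB by (simp add: powr_powr)
  finally show "Lp_norm p a b (\<lambda>x. u x + v x) \<le> Lp_norm p a b u + Lp_norm p a b v + e"
    by (simp add: Lp_norm_def A_def B_def)
qed

lemma Lp_norm_bounded:
  assumes v: "continuous_on UNIV v" and k: "0 \<le> k" "\<And>x. x \<in> {a..b} \<Longrightarrow> \<bar>v x\<bar> \<le> k" and ab: "a \<le> b"
  shows "Lp_norm p a b v \<le> k * (b - a) powr (1 / p)"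
proof -
  have "Lp_norm p a b v \<le> Lp_norm p a b (\<lambda>x. k * 1)"
    using k by (intro Lp_norm_mono v continuous_intros) auto
  also have "\<dots> = k * Lp_norm p a b (\<lambda>x. 1)" by (rule Lp_norm_scale) (auto intro: k)
  also have "Lp_norm p a b (\<lambda>x. 1) = (b - a) powr (1 / p)" using ab by (simp add: Lp_norm_def)
  finally show ?thesis .
qed

end

text \<open>Integrals of nonnegative functions increase with the window, so windows with rational endpoints on
both sides determine the limit. Moving endpoints are allowed because, for negative steps, the
window moves with the step.\<close>

lemma integral_window_sandwich:
  fixes \<phi> :: "'h \<Rightarrow> real \<Rightarrow> real"
  assumes \<phi>: "\<And>h. continuous_on UNIV (\<phi> h)" "\<And>h x. 0 \<le> \<phi> h x" and c: "0 \<le> c"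
    and lim: "\<And>a b. a \<in> \<rat> \<Longrightarrow> b \<in> \<rat> \<Longrightarrow> a < b \<Longrightarrow> ((\<lambda>h. integral {a..b} (\<phi> h)) \<longlongrightarrow> c * (b - a)) F"
    and \<alpha>: "(\<alpha> \<longlongrightarrow> a) F" and \<beta>: "(\<beta> \<longlongrightarrow> b) F" and ab: "a < b"
  shows "((\<lambda>h. integral {\<alpha> h..\<beta> h} (\<phi> h)) \<longlongrightarrow> c * (b - a)) F"
proof -
  have i: "\<phi> h integrable_on {u..v}" for h u v
    by (intro integrable_continuous_real continuous_on_subset[OF \<phi>(1)]) auto
  have mono: "integral {u..v} (\<phi> h) \<le> integral {u'..v'} (\<phi> h)" if "u' \<le> u" "v \<le> v'" for u v u' v' h
    using that by (intro integral_subset_le i) (auto intro: \<phi>(2))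
  have gap: "\<exists>\<eta>>0. c * \<eta> < d" if "0 < d" for d
    using that c by (intro exI[of _ "d / (c + 1)"]) (auto simp: field_simps add_pos_nonneg intro: add_nonneg_pos)
  show ?thesis
  proof (rule order_tendstoI)
    fix y assume "y < c * (b - a)"
    then obtain \<eta> where \<eta>: "0 < \<eta>" "c * \<eta> < c * (b - a) - y" using gap[of "c * (b - a) - y"] by auto
    \<comment> \<open>The margins are small enough to keep \<open>a2 < b2\<close> and to lose less than \<open>\<eta>\<close> in length.\<close>
    define \<mu> where "\<mu> = min \<eta> (b - a) / 3"
    have \<mu>: "0 < \<mu>" "2 * \<mu> < \<eta>" "2 * \<mu> < b - a" using \<eta> ab by (auto simp: \<mu>_def min_def)
    obtain a2 where a2: "a2 \<in> \<rat>" "a < a2" "a2 < a + \<mu>" using Rats_dense_in_real[of a "a + \<mu>"] \<mu> by auto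
    obtain b2 where b2: "b2 \<in> \<rat>" "b - \<mu> < b2" "b2 < b" using Rats_dense_in_real[of "b - \<mu>" b] \<mu> by auto
    have lt: "a2 < b2" using a2 b2 \<mu> by simp
    have "c * (b - a - \<eta>) \<le> c * (b2 - a2)" using c a2 b2 \<mu> by (intro mult_left_mono) auto
    then have "y < c * (b2 - a2)" using \<eta> by (simp add: algebra_simps)
    then have "eventually (\<lambda>h. y < integral {a2..b2} (\<phi> h)) F"
      using order_tendstoD(1)[OF lim[OF a2(1) b2(1) lt]] by blast
    moreover have "eventually (\<lambda>h. \<alpha> h < a2) F" "eventually (\<lambda>h. b2 < \<beta> h) F"
      using order_tendstoD(2)[OF \<alpha> a2(2)] order_tendstoD(1)[OF \<beta> b2(3)] by auto
    ultimately show "eventually (\<lambda>h. y < integral {\<alpha> h..\<beta> h} (\<phi> h)) F"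
    proof eventually_elim
      case (elim h)
      then show ?case using mono[of "\<alpha> h" a2 b2 "\<beta> h" h] by simp
    qed
  next
    fix y assume "c * (b - a) < y"
    then obtain \<eta> where \<eta>: "0 < \<eta>" "c * \<eta> < y - c * (b - a)" using gap[of "y - c * (b - a)"] by auto
    define \<mu> where "\<mu> = \<eta> / 3"
    have \<mu>: "0 < \<mu>" "2 * \<mu> < \<eta>" using \<eta> by (auto simp: \<mu>_def)
    obtain a1 where a1: "a1 \<in> \<rat>" "a - \<mu> < a1" "a1 < a" using Rats_dense_in_real[of "a - \<mu>" a] \<mu> by auto
    obtain b1 where b1: "b1 \<in> \<rat>" "b < b1" "b1 < b + \<mu>" using Rats_dense_in_real[of b "b + \<mu>"] \<mu> by auto
    have lt: "a1 < b1" using a1 b1 ab by simp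
    have "c * (b1 - a1) \<le> c * (b - a + \<eta>)" using c a1 b1 \<mu> by (intro mult_left_mono) auto
    then have "c * (b1 - a1) < y" using \<eta> by (simp add: algebra_simps)
    then have "eventually (\<lambda>h. integral {a1..b1} (\<phi> h) < y) F"
      using order_tendstoD(2)[OF lim[OF a1(1) b1(1) lt]] by blast
    moreover have "eventually (\<lambda>h. a1 < \<alpha> h) F" "eventually (\<lambda>h. \<beta> h < b1) F"
      using order_tendstoD(1)[OF \<alpha> a1(3)] order_tendstoD(2)[OF \<beta> b1(2)] by auto
    ultimately show "eventually (\<lambda>h. integral {\<alpha> h..\<beta> h} (\<phi> h) < y) F"
    proof eventually_elim
      case (elim h)
      then show ?case using mono[of a1 "\<alpha> h" "\<beta> h" b1 h] by simp
    qed
  qed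
qed

text \<open>One path \<open>g\<close> whose normalised power integrals converge along the step sizes \<open>hs\<close> on all rational windows.
The function \<open>f\<close> stands for the variance of the increments.\<close>

locale sampled_path =
  fixes g f :: "real \<Rightarrow> real" and \<delta> p c :: real and hs :: "nat \<Rightarrow> real"
  assumes g: "continuous_on UNIV g" and \<delta>: "0 < \<delta>" and conc: "concave_on {0..\<delta>} f" and mono: "mono_on {0..\<delta>} f"
    and f0: "f 0 = 0" and pos: "\<And>h. 0 < h \<Longrightarrow> h \<le> \<delta> \<Longrightarrow> 0 < f h" and p: "1 \<le> p" and c: "0 \<le> c"
    and hs_pos: "\<And>n. 2 \<le> n \<Longrightarrow> 0 < hs n" and hs_dec: "\<And>n. 2 \<le> n \<Longrightarrow> hs (Suc n) \<le> hs n" and hs_lim: "hs \<longlonglongrightarrow> 0"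
    and ratio: "(\<lambda>n. sqrt (f (hs n - hs (Suc n))) / sqrt (f (hs (Suc n)))) \<longlonglongrightarrow> 0"
    and conv: "\<And>a b. a \<in> \<rat> \<Longrightarrow> b \<in> \<rat> \<Longrightarrow> a < b \<Longrightarrow>
      (\<lambda>n. integral {a..b} (\<lambda>x. \<bar>(g (x + hs n) - g x) / sqrt (f (hs n))\<bar> powr p)) \<longlonglongrightarrow> c * (b - a)"
begin

definition \<sigma> :: "real \<Rightarrow> real" where "\<sigma> h = sqrt (f h)"

definition inc :: "real \<Rightarrow> real \<Rightarrow> real" where "inc h x = g (x + h) - g x"

lemma inc_continuous: "continuous_on UNIV (inc h)"
proof -
  have "continuous_on UNIV (\<lambda>x. g (x + h))" by (rule continuous_on_compose2[OF g]) (auto intro!: continuous_intros)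
  then show ?thesis unfolding inc_def using g by (intro continuous_intros)
qed

lemma inc_quotient_continuous: "continuous_on UNIV (\<lambda>x. inc h x / k)"
  unfolding divide_inverse by (intro continuous_intros inc_continuous)

lemma inc_add: "inc (r + s) x = inc r x + inc s (x + r)"
  by (simp add: inc_def add.assoc)

lemma \<sigma>_pos: "0 < h \<Longrightarrow> h \<le> \<delta> \<Longrightarrow> 0 < \<sigma> h"
  using pos by (simp add: \<sigma>_def)

lemma \<sigma>_0: "\<sigma> 0 = 0" by (simp add: \<sigma>_def f0)

lemma \<sigma>_mono: "0 \<le> h \<Longrightarrow> h \<le> k \<Longrightarrow> k \<le> \<delta> \<Longrightarrow> \<sigma> h \<le> \<sigma> k"
  using mono_onD[OF mono, of h k] by (simp add: \<sigma>_def)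

lemma \<sigma>_add_le:
  assumes "0 \<le> h" "0 \<le> k" "h + k \<le> \<delta>"
  shows "\<sigma> (h + k) \<le> \<sigma> h + \<sigma> k"
proof -
  have nn: "0 \<le> f h" "0 \<le> f k" using pos[of h] pos[of k] f0 assms by (cases "h = 0"; cases "k = 0"; simp add: less_imp_le)+
  have "f (h + k) \<le> f h + f k" using concave_on_inner_pair_le[OF conc, of 0 "h + k" h] assms f0 by simp
  then have "\<sigma> (h + k) \<le> sqrt (f h + f k)" by (simp add: \<sigma>_def)
  also have "\<dots> \<le> \<sigma> h + \<sigma> k" unfolding \<sigma>_def using nn by (rule sqrt_add_le_add_sqrt)
  finally show ?thesis .
qed

lemma hs_antimono: "2 \<le> m \<Longrightarrow> m \<le> n \<Longrightarrow> hs n \<le> hs m"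
proof (induction n)
  case (Suc n)
  then show ?case using hs_dec[of n] by (cases "m = Suc n") auto
qed simp

lemma bracket:
  assumes "2 \<le> n0" "0 < r" "r < hs n0"
  obtains n where "n0 \<le> n" "hs (Suc n) \<le> r" "r < hs n"
proof -
  obtain N where N: "hs N < r" "n0 \<le> N"
    using order_tendstoD(2)[OF hs_lim assms(2)] eventually_ge_at_top[of n0]
    by (metis (mono_tags, lifting) eventually_conj eventually_sequentially order_refl)
  define m where "m = (LEAST m. n0 \<le> m \<and> hs m \<le> r)"
  have m: "n0 \<le> m" "hs m \<le> r" using LeastI[of "\<lambda>m. n0 \<le> m \<and> hs m \<le> r" N] N by (auto simp: m_def)
  have "m \<noteq> n0" using m assms by auto
  then obtain n where n: "m = Suc n" "n0 \<le> n" using m by (metis le_neq_implies_less less_imp_Suc_add le_add1)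
  have "\<not> (n0 \<le> n \<and> hs n \<le> r)" using not_less_Least[of n "\<lambda>m. n0 \<le> m \<and> hs m \<le> r"] n by (simp add: m_def[symmetric])
  then show ?thesis using that[of n] n m by auto
qed

lemma eventually_at_right_if_between_steps:
  assumes "eventually (\<lambda>n. \<forall>h. hs (Suc n) \<le> h \<longrightarrow> h < hs n \<longrightarrow> P h) sequentially"
  shows "eventually P (at_right 0)"
proof -
  obtain n0 where n0: "2 \<le> n0" "\<And>n h. n0 \<le> n \<Longrightarrow> hs (Suc n) \<le> h \<Longrightarrow> h < hs n \<Longrightarrow> P h"
    using eventually_conj[OF assms eventually_ge_at_top[of 2]] unfolding eventually_sequentially by blast
  have "P h" if "0 < h" "h < hs n0" for h
    using bracket[OF n0(1) that] n0(2) by blast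
  then show ?thesis unfolding eventually_at_right_field using hs_pos[OF n0(1)] by blast
qed

text \<open>For \<open>hs (Suc n) \<le> r < hs n\<close> write \<open>r = hs (Suc n) + s\<close>. The increment over \<open>hs (Suc n)\<close> has norm at most \<open>C * \<sigma> r\<close> by
assumption, and \<open>\<sigma> s \<le> \<sigma> r / 2\<close>, so the increment over \<open>s\<close>, on the window shifted by \<open>hs (Suc n)\<close>, has norm at most
\<open>2 * C * \<sigma> s \<le> C * \<sigma> r\<close> by induction. The recursion need not end; it is stopped when \<open>r\<close> is so small that uniform
continuity of \<open>g\<close> makes the norm smaller than an arbitrary \<open>\<tau>\<close>. The condition \<open>\<beta> + r \<le> b'\<close> is preserved by the
shift and keeps all windows inside \<open>[a', b']\<close>.\<close>

lemma chaining:
  assumes n0: "2 \<le> n0" "hs n0 \<le> \<delta>" and C: "0 \<le> C"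
    and bound: "\<And>n. n0 \<le> n \<Longrightarrow> Lp_norm p a' b' (inc (hs n)) \<le> C * \<sigma> (hs n)"
    and half: "\<And>n. n0 \<le> n \<Longrightarrow> \<sigma> (hs n - hs (Suc n)) \<le> \<sigma> (hs (Suc n)) / 2"
    and r: "0 < r" "r < hs n0" and win: "a' \<le> \<alpha>" "\<alpha> \<le> \<beta>" "\<beta> + r \<le> b'"
  shows "Lp_norm p \<alpha> \<beta> (inc r) \<le> 2 * C * \<sigma> r"
proof (rule field_le_epsilon)
  fix \<tau> :: real assume \<tau>: "0 < \<tau>"
  define K where "K = (b' - a') powr (1 / p) + 1"
  have K: "1 \<le> K" by (simp add: K_def)
  have ucg: "uniformly_continuous_on {a'..b'} g"
    by (intro compact_uniformly_continuous continuous_on_subset[OF g]) auto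
  have \<tau>K: "0 < \<tau> / K" using \<tau> K by simp
  obtain d where d: "0 < d" and uc: "\<And>x y. x \<in> {a'..b'} \<Longrightarrow> y \<in> {a'..b'} \<Longrightarrow> dist y x < d \<Longrightarrow> dist (g y) (g x) < \<tau> / K"
    by (rule uniformly_continuous_onE[OF ucg \<tau>K]) (rule that)
  define \<rho> where "\<rho> = min d \<delta>"
  have \<rho>: "0 < \<rho>" "\<rho> \<le> \<delta>" "0 < \<sigma> \<rho>" using d \<delta> \<sigma>_pos[of \<rho>] by (auto simp: \<rho>_def)
  have claim: "Lp_norm p \<alpha> \<beta> (inc r) \<le> 2 * C * \<sigma> r + \<tau>"
    if "0 < r" "r < hs n0" "\<sigma> r < 2 ^ k * \<sigma> \<rho>" "a' \<le> \<alpha>" "\<alpha> \<le> \<beta>" "\<beta> + r \<le> b'" for k r \<alpha> \<beta>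
    using that
  proof (induction k arbitrary: r \<alpha> \<beta>)
    case 0
    have r\<delta>: "r \<le> \<delta>" using 0 n0 by simp
    have "r < \<rho>" using \<sigma>_mono[of \<rho> r] 0 r\<delta> \<rho> by (cases "r < \<rho>") auto
    then have rd: "r < d" by (simp add: \<rho>_def)
    have "Lp_norm p \<alpha> \<beta> (inc r) \<le> \<tau> / K * (\<beta> - \<alpha>) powr (1 / p)"
    proof (rule Lp_norm_bounded[OF p inc_continuous])
      show "0 \<le> \<tau> / K" using \<tau> K by simp
      show "\<bar>inc r x\<bar> \<le> \<tau> / K" if "x \<in> {\<alpha>..\<beta>}" for x
        using uc[of x "x + r"] that 0 rd by (simp add: inc_def dist_real_def)
    qed (use 0 in simp)
    also have "\<dots> \<le> \<tau> / K * K"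
    proof (rule mult_left_mono)
      have "(\<beta> - \<alpha>) powr (1 / p) \<le> (b' - a') powr (1 / p)" using 0 p by (intro powr_mono2) auto
      then show "(\<beta> - \<alpha>) powr (1 / p) \<le> K" by (simp add: K_def)
    qed (use \<tau> K in simp)
    also have "\<dots> = \<tau>" using K by simp
    moreover have "0 \<le> 2 * C * \<sigma> r" using C \<sigma>_pos[OF 0(1) r\<delta>] by simp
    ultimately show ?case by linarith
  next
    case (Suc k)
    obtain n where n: "n0 \<le> n" "hs (Suc n) \<le> r" "r < hs n" using bracket[OF n0(1) Suc.prems(1,2)] .
    define h where "h = hs (Suc n)"
    have h: "0 < h" "h \<le> r" using hs_pos[of "Suc n"] n n0 by (auto simp: h_def)
    have r\<delta>: "r \<le> \<delta>" using Suc.prems n0 by simp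
    have "Lp_norm p \<alpha> \<beta> (inc h) \<le> Lp_norm p a' b' (inc h)"
      using Suc.prems by (intro Lp_norm_mono[OF p] inc_continuous) auto
    also have "\<dots> \<le> C * \<sigma> h" unfolding h_def using n by (intro bound) simp
    also have "\<dots> \<le> C * \<sigma> r" using h r\<delta> C by (intro mult_left_mono \<sigma>_mono) auto
    finally have first: "Lp_norm p \<alpha> \<beta> (inc h) \<le> C * \<sigma> r" .
    show ?case
    proof (cases "r = h")
      case True
      then have "Lp_norm p \<alpha> \<beta> (inc r) \<le> C * \<sigma> r" using first by simp
      moreover have "0 \<le> C * \<sigma> r" using C \<sigma>_pos[OF Suc.prems(1) r\<delta>] by simp
      ultimately show ?thesis using \<tau> by linarith
    next
      case False
      define s where "s = r - h"
      have s: "0 < s" "s < r" "r = h + s" using False h by (auto simp: s_def)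
      have "s \<le> hs n - hs (Suc n)" using n by (simp add: s_def h_def)
      moreover have "hs n - hs (Suc n) \<le> \<delta>" using hs_antimono[OF n0(1) n(1)] n0 h by (simp add: h_def)
      ultimately have "\<sigma> s \<le> \<sigma> (hs n - hs (Suc n))" using s by (intro \<sigma>_mono) auto
      also have "\<dots> \<le> \<sigma> h / 2" unfolding h_def using half[OF n(1)] .
      also have "\<sigma> h \<le> \<sigma> r" using h r\<delta> by (intro \<sigma>_mono) auto
      finally have \<sigma>s: "\<sigma> s \<le> \<sigma> r / 2" by simp
      have "Lp_norm p \<alpha> \<beta> (\<lambda>x. inc s (x + h)) = Lp_norm p (\<alpha> + h) (\<beta> + h) (inc s)"
        by (rule Lp_norm_shift[OF p inc_continuous])
      also have "\<dots> \<le> 2 * C * \<sigma> s + \<tau>"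
        using Suc.prems s h \<sigma>s by (intro Suc.IH) auto
      also have "\<dots> \<le> C * \<sigma> r + \<tau>" using mult_left_mono[OF \<sigma>s C] by simp
      finally have second: "Lp_norm p \<alpha> \<beta> (\<lambda>x. inc s (x + h)) \<le> C * \<sigma> r + \<tau>" .
      have cs: "continuous_on UNIV (\<lambda>x. inc s (x + h))"
        by (rule continuous_on_compose2[OF inc_continuous]) (auto intro!: continuous_intros)
      have "Lp_norm p \<alpha> \<beta> (inc r) = Lp_norm p \<alpha> \<beta> (\<lambda>x. inc h x + inc s (x + h))"
        unfolding s(3) inc_add[abs_def] ..
      also have "\<dots> \<le> Lp_norm p \<alpha> \<beta> (inc h) + Lp_norm p \<alpha> \<beta> (\<lambda>x. inc s (x + h))"
        by (rule Lp_norm_triangle[OF p inc_continuous cs])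
      finally show ?thesis using first second by simp
    qed
  qed
  obtain k where "\<sigma> r / \<sigma> \<rho> < 2 ^ k" using real_arch_pow[of 2] by auto
  then have "\<sigma> r < 2 ^ k * \<sigma> \<rho>" using \<rho> by (simp add: field_simps)
  then show "Lp_norm p \<alpha> \<beta> (inc r) \<le> 2 * C * \<sigma> r + \<tau>" using r win by (intro claim)
qed

lemma sampled_norms_converge:
  assumes "a \<in> \<rat>" "b \<in> \<rat>" "a < b"
  shows "(\<lambda>n. Lp_norm p a b (inc (hs n)) / \<sigma> (hs n)) \<longlonglongrightarrow> (c * (b - a)) powr (1 / p)"
proof -
  have "(\<lambda>n. integral {a..b} (\<lambda>x. \<bar>(g (x + hs n) - g x) / sqrt (f (hs n))\<bar> powr p) powr (1 / p)) \<longlonglongrightarrow> (c * (b - a)) powr (1 / p)"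
  proof (intro tendsto_powr' conv[OF assms] tendsto_const disjI2 conjI)
    show "0 < 1 / p" using p by simp
    have "0 \<le> integral {a..b} (\<lambda>x. \<bar>(g (x + hs n) - g x) / sqrt (f (hs n))\<bar> powr p)" for n
      using inc_quotient_continuous[of "hs n" "sqrt (f (hs n))"] unfolding inc_def
      by (intro integral_nonneg abs_powr_integrable[OF p]) auto
    then show "eventually (\<lambda>n. 0 \<le> integral {a..b} (\<lambda>x. \<bar>(g (x + hs n) - g x) / sqrt (f (hs n))\<bar> powr p)) sequentially"
      by (intro always_eventually allI)
  qed
  moreover have "eventually (\<lambda>n. integral {a..b} (\<lambda>x. \<bar>(g (x + hs n) - g x) / sqrt (f (hs n))\<bar> powr p) powr (1 / p) =
      Lp_norm p a b (inc (hs n)) / \<sigma> (hs n)) sequentially"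
    using order_tendstoD(2)[OF hs_lim \<delta>] eventually_ge_at_top[of 2]
  proof eventually_elim
    case (elim n)
    have s: "0 < \<sigma> (hs n)" using elim hs_pos[of n] by (intro \<sigma>_pos) auto
    have "integral {a..b} (\<lambda>x. \<bar>(g (x + hs n) - g x) / sqrt (f (hs n))\<bar> powr p) powr (1 / p) =
      Lp_norm p a b (\<lambda>x. (1 / \<sigma> (hs n)) * inc (hs n) x)"
      by (simp add: Lp_norm_def inc_def \<sigma>_def)
    also have "\<dots> = (1 / \<sigma> (hs n)) * Lp_norm p a b (inc (hs n))"
      using s by (intro Lp_norm_scale[OF p] inc_continuous) simp
    finally show ?case by simp
  qed
  ultimately show ?thesis by (rule Lim_transform_eventually)
qed

text \<open>For \<open>hs (Suc n) \<le> h < hs n\<close> the norms at \<open>h\<close> and at \<open>k = hs (Suc n)\<close> differ by at most \<open>2 * C * \<epsilon> n * \<sigma> k\<close>, and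
\<open>\<sigma> k \<le> \<sigma> h \<le> (1 + \<epsilon> n) * \<sigma> k\<close> since \<open>\<sigma>\<close> is subadditive. So the normalised norm at \<open>h\<close> lies between two
sequences with the same limit.\<close>

lemma norms_converge_right:
  assumes ab: "a \<in> \<rat>" "b \<in> \<rat>" "a < b"
  shows "((\<lambda>h. Lp_norm p a b (inc h) / \<sigma> h) \<longlongrightarrow> (c * (b - a)) powr (1 / p)) (at_right 0)"
proof -
  \<comment> \<open>A larger window leaves room for the shifts in the chaining argument, which are at most 1.\<close>
  obtain b' where b': "b' \<in> \<rat>" "b + 1 < b'" using Rats_dense_in_real[of "b + 1" "b + 2"] by auto
  define l where "l = (c * (b' - a)) powr (1 / p)"
  define C where "C = l + 1"
  have C: "0 \<le> C" by (simp add: C_def l_def)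
  define \<epsilon> where "\<epsilon> n = \<sigma> (hs n - hs (Suc n)) / \<sigma> (hs (Suc n))" for n
  have \<epsilon>0: "\<epsilon> \<longlonglongrightarrow> 0" using ratio by (simp add: \<epsilon>_def[abs_def] \<sigma>_def)
  have "eventually (\<lambda>n. Lp_norm p a b' (inc (hs n)) / \<sigma> (hs n) < C) sequentially"
    using sampled_norms_converge[OF ab(1) b'(1)] ab b' by (intro order_tendstoD(2)) (auto simp: C_def l_def)
  moreover have "eventually (\<lambda>n. hs n < min \<delta> 1) sequentially" using \<delta> by (intro order_tendstoD(2)[OF hs_lim]) auto
  moreover have "eventually (\<lambda>n. \<epsilon> n < 1 / 2) sequentially" by (intro order_tendstoD(2)[OF \<epsilon>0]) simp
  ultimately have "eventually (\<lambda>n. Lp_norm p a b' (inc (hs n)) / \<sigma> (hs n) < C \<and> hs n < min \<delta> 1 \<and> \<epsilon> n < 1 / 2 \<and> 2 \<le> n) sequentially"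
    using eventually_ge_at_top[of 2] by eventually_elim simp
  then obtain n0 where n0: "\<And>n. n0 \<le> n \<Longrightarrow> Lp_norm p a b' (inc (hs n)) / \<sigma> (hs n) < C \<and> hs n < min \<delta> 1 \<and> \<epsilon> n < 1 / 2 \<and> 2 \<le> n"
    by (auto simp: eventually_sequentially)
  have n02: "2 \<le> n0" "hs n0 \<le> \<delta>" "hs n0 \<le> 1" using n0[of n0] by auto
  have \<sigma>h: "0 < \<sigma> (hs n)" if "n0 \<le> n" for n using n0[OF that] hs_pos[of n] by (intro \<sigma>_pos) auto
  have bound: "Lp_norm p a b' (inc (hs n)) \<le> C * \<sigma> (hs n)" if "n0 \<le> n" for n
    using n0[OF that] \<sigma>h[OF that] by (simp add: pos_divide_less_eq)
  have half: "\<sigma> (hs n - hs (Suc n)) \<le> \<sigma> (hs (Suc n)) / 2" if "n0 \<le> n" for n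
  proof -
    have "\<epsilon> n < 1 / 2" "0 < \<sigma> (hs (Suc n))" using n0[OF that] \<sigma>h[of "Suc n"] that by simp_all
    then show ?thesis by (simp add: \<epsilon>_def pos_divide_less_eq)
  qed
  define Q where "Q n = Lp_norm p a b (inc (hs n)) / \<sigma> (hs n)" for n
  have Q: "Q \<longlonglongrightarrow> (c * (b - a)) powr (1 / p)" unfolding Q_def by (rule sampled_norms_converge[OF ab])
  define lo where "lo n = (Q (Suc n) - 2 * C * \<epsilon> n) / (1 + \<epsilon> n)" for n
  define up where "up n = Q (Suc n) + 2 * C * \<epsilon> n" for n
  have lo: "lo \<longlonglongrightarrow> (c * (b - a)) powr (1 / p)"
  proof -
    have "lo \<longlonglongrightarrow> ((c * (b - a)) powr (1 / p) - 2 * C * 0) / (1 + 0)"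
      unfolding lo_def by (intro tendsto_intros LIMSEQ_Suc[OF Q] \<epsilon>0) simp
    then show ?thesis by simp
  qed
  have up: "up \<longlonglongrightarrow> (c * (b - a)) powr (1 / p)"
  proof -
    have "up \<longlonglongrightarrow> (c * (b - a)) powr (1 / p) + 2 * C * 0"
      unfolding up_def by (intro tendsto_intros LIMSEQ_Suc[OF Q] \<epsilon>0)
    then show ?thesis by simp
  qed
  have between: "lo n \<le> Lp_norm p a b (inc h) / \<sigma> h \<and> Lp_norm p a b (inc h) / \<sigma> h \<le> up n"
    if n: "n0 \<le> n" "hs (Suc n) \<le> h" "h < hs n" for n h
  proof -
    define k where "k = hs (Suc n)"
    have k: "0 < k" "k \<le> h" "h \<le> \<delta>" "h \<le> 1"
      using hs_pos[of "Suc n"] n n02 hs_antimono[OF n02(1) n(1)] by (auto simp: k_def)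
    have \<sigma>k: "0 < \<sigma> k" "\<sigma> k \<le> \<sigma> h" using k by (auto intro!: \<sigma>_pos \<sigma>_mono)
    define r where "r = h - k"
    have r: "0 \<le> r" "h = k + r" using k by (auto simp: r_def)
    have "\<sigma> r \<le> \<sigma> (hs n - hs (Suc n))" using n r(1) k(1) hs_antimono[OF n02(1) n(1)] n02 by (intro \<sigma>_mono) (auto simp: r_def k_def)
    also have "\<dots> = \<epsilon> n * \<sigma> k" using \<sigma>k by (simp add: \<epsilon>_def k_def)
    finally have \<sigma>r: "\<sigma> r \<le> \<epsilon> n * \<sigma> k" .
    have \<sigma>r0: "0 \<le> \<sigma> r" using \<sigma>_0 \<sigma>_mono[of 0 r] r(1) k by (simp add: r_def)
    have \<epsilon>n: "0 \<le> \<epsilon> n" 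
    proof -
      have "0 \<le> \<epsilon> n * \<sigma> k" using \<sigma>r \<sigma>r0 by linarith
      then show ?thesis using \<sigma>k(1) by (simp add: zero_le_mult_iff)
    qed
    have "\<sigma> h \<le> \<sigma> k + \<sigma> r" using \<sigma>_add_le[of k r] r(1) k unfolding r_def by simp
    then have \<sigma>hk: "\<sigma> h \<le> (1 + \<epsilon> n) * \<sigma> k" using \<sigma>r by (simp add: algebra_simps)
    have rest: "Lp_norm p a b (\<lambda>x. inc r (x + k)) \<le> 2 * C * (\<epsilon> n * \<sigma> k)"
    proof (cases "r = 0")
      case True
      have "inc 0 = (\<lambda>x. 0)" by (auto simp: inc_def fun_eq_iff)
      then have "Lp_norm p a b (\<lambda>x. inc r (x + k)) = 0" using True by (simp add: Lp_norm_def)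
      then show ?thesis using C \<epsilon>n \<sigma>k by simp
    next
      case False
      have "Lp_norm p a b (\<lambda>x. inc r (x + k)) = Lp_norm p (a + k) (b + k) (inc r)"
        by (rule Lp_norm_shift[OF p inc_continuous])
      also have "\<dots> \<le> 2 * C * \<sigma> r"
      proof (rule chaining[OF n02(1,2) C bound half])
        show "r < hs n0" using n k hs_antimono[OF n02(1) n(1)] by (simp add: r_def)
      qed (use False r(1) k ab b' in \<open>auto simp: r_def\<close>)
      also have "\<dots> \<le> 2 * C * (\<epsilon> n * \<sigma> k)" using \<sigma>r C by (intro mult_left_mono) auto
      finally show ?thesis .
    qed
    have cr: "continuous_on UNIV (\<lambda>x. inc r (x + k))"
      by (rule continuous_on_compose2[OF inc_continuous]) (auto intro!: continuous_intros)
    have ih: "inc h = (\<lambda>x. inc k x + inc r (x + k))" unfolding r(2) inc_add[abs_def] ..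
    have u: "Lp_norm p a b (inc h) \<le> Lp_norm p a b (inc k) + 2 * C * (\<epsilon> n * \<sigma> k)"
      using Lp_norm_triangle[OF p inc_continuous cr, of a b k] rest unfolding ih by linarith
    have l: "Lp_norm p a b (inc k) \<le> Lp_norm p a b (inc h) + 2 * C * (\<epsilon> n * \<sigma> k)"
    proof -
      have "inc k = (\<lambda>x. inc h x + (- inc r (x + k)))" unfolding ih by simp
      then have "Lp_norm p a b (inc k) \<le> Lp_norm p a b (inc h) + Lp_norm p a b (\<lambda>x. - inc r (x + k))"
        using Lp_norm_triangle[OF p inc_continuous continuous_on_minus[OF cr], of a b h] by simp
      also have "Lp_norm p a b (\<lambda>x. - inc r (x + k)) = Lp_norm p a b (\<lambda>x. inc r (x + k))" by (simp add: Lp_norm_def)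
      finally show ?thesis using rest by linarith
    qed
    have Nk: "Lp_norm p a b (inc k) = Q (Suc n) * \<sigma> k" using \<sigma>k by (simp add: Q_def k_def)
    have u': "Lp_norm p a b (inc h) \<le> up n * \<sigma> k" using u by (simp add: Nk up_def algebra_simps)
    have l': "(Q (Suc n) - 2 * C * \<epsilon> n) * \<sigma> k \<le> Lp_norm p a b (inc h)" using l by (simp add: Nk algebra_simps)
    have \<sigma>hp: "0 < \<sigma> h" using \<sigma>k by simp
    have upn: "0 \<le> up n" using C \<epsilon>n \<sigma>k Lp_norm_nonneg[OF p] by (simp add: up_def Q_def k_def)
    have "Lp_norm p a b (inc h) \<le> up n * \<sigma> h" using u' mult_left_mono[OF \<sigma>k(2) upn] by linarith
    then have 1: "Lp_norm p a b (inc h) / \<sigma> h \<le> up n" using \<sigma>hp by (simp add: field_simps)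
    \<comment> \<open>If the numerator of \<open>lo n\<close> is negative, dividing by \<open>\<sigma> h\<close> goes the wrong way, but then the bound is trivial.\<close>
    have 2: "lo n \<le> Lp_norm p a b (inc h) / \<sigma> h"
    proof (cases "0 \<le> Q (Suc n) - 2 * C * \<epsilon> n")
      case True
      have "lo n * \<sigma> h \<le> lo n * ((1 + \<epsilon> n) * \<sigma> k)" using True \<epsilon>n \<sigma>hk by (intro mult_left_mono) (auto simp: lo_def)
      also have "\<dots> = (Q (Suc n) - 2 * C * \<epsilon> n) * \<sigma> k" using \<epsilon>n by (simp add: lo_def)
      finally show ?thesis using l' \<sigma>hp by (simp add: field_simps)
    next
      case False
      then have "lo n \<le> 0" using \<epsilon>n by (simp add: lo_def divide_le_0_iff)
      also have "0 \<le> Lp_norm p a b (inc h) / \<sigma> h" using \<sigma>hp Lp_norm_nonneg[OF p] by simp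
      finally show ?thesis .
    qed
    show ?thesis using 1 2 by simp
  qed
  have steps: "eventually (\<lambda>n. \<forall>h. hs (Suc n) \<le> h \<longrightarrow> h < hs n \<longrightarrow>
      lo n \<le> Lp_norm p a b (inc h) / \<sigma> h \<and> Lp_norm p a b (inc h) / \<sigma> h \<le> up n) sequentially"
    using eventually_ge_at_top[of n0] by eventually_elim (use between in blast)
  show ?thesis
  proof (rule order_tendstoI)
    fix y assume "y < (c * (b - a)) powr (1 / p)"
    from order_tendstoD(1)[OF lo this] steps
    have "eventually (\<lambda>n. \<forall>h. hs (Suc n) \<le> h \<longrightarrow> h < hs n \<longrightarrow> y < Lp_norm p a b (inc h) / \<sigma> h) sequentially"
      by eventually_elim force
    then show "eventually (\<lambda>h. y < Lp_norm p a b (inc h) / \<sigma> h) (at_right 0)" by (rule eventually_at_right_if_between_steps)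
  next
    fix y assume "(c * (b - a)) powr (1 / p) < y"
    from order_tendstoD(2)[OF up this] steps
    have "eventually (\<lambda>n. \<forall>h. hs (Suc n) \<le> h \<longrightarrow> h < hs n \<longrightarrow> Lp_norm p a b (inc h) / \<sigma> h < y) sequentially"
      by eventually_elim force
    then show "eventually (\<lambda>h. Lp_norm p a b (inc h) / \<sigma> h < y) (at_right 0)" by (rule eventually_at_right_if_between_steps)
  qed
qed

lemma quotient_continuous: "continuous_on UNIV (\<lambda>x. \<bar>inc h x / \<sigma> h\<bar> powr p)"
  by (rule abs_powr_continuous[OF p inc_quotient_continuous])

lemma integrals_converge_right:
  assumes ab: "a \<in> \<rat>" "b \<in> \<rat>" "a < b"
  shows "((\<lambda>h. integral {a..b} (\<lambda>x. \<bar>inc h x / \<sigma> h\<bar> powr p)) \<longlongrightarrow> c * (b - a)) (at_right 0)"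
proof -
  have ev: "eventually (\<lambda>h. 0 < h \<and> h < \<delta>) (at_right (0 :: real))"
    unfolding eventually_at_right_field using \<delta> by blast
  have "((\<lambda>h. (Lp_norm p a b (inc h) / \<sigma> h) powr p) \<longlongrightarrow> ((c * (b - a)) powr (1 / p)) powr p) (at_right 0)"
  proof (intro tendsto_powr' norms_converge_right ab tendsto_const disjI2 conjI)
    show "0 < p" using p by simp
    show "eventually (\<lambda>h. 0 \<le> Lp_norm p a b (inc h) / \<sigma> h) (at_right 0)"
      using ev
    proof eventually_elim
      case (elim h)
      then have "0 < \<sigma> h" by (intro \<sigma>_pos) auto
      then show ?case using Lp_norm_nonneg[OF p] by (intro divide_nonneg_pos) auto
    qed
  qed
  moreover have "((c * (b - a)) powr (1 / p)) powr p = c * (b - a)" using p c ab by (simp add: powr_powr)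
  ultimately have lim: "((\<lambda>h. (Lp_norm p a b (inc h) / \<sigma> h) powr p) \<longlongrightarrow> c * (b - a)) (at_right 0)" by simp
  have "eventually (\<lambda>h. (Lp_norm p a b (inc h) / \<sigma> h) powr p = integral {a..b} (\<lambda>x. \<bar>inc h x / \<sigma> h\<bar> powr p)) (at_right 0)"
    using ev
  proof eventually_elim
    case (elim h)
    then have s: "0 < \<sigma> h" by (intro \<sigma>_pos) auto
    have "Lp_norm p a b (\<lambda>x. inc h x / \<sigma> h) = Lp_norm p a b (inc h) / \<sigma> h"
      using Lp_norm_scale[OF p inc_continuous, of "1 / \<sigma> h" a b h] s by simp
    then show ?case using Lp_norm_powr[OF p inc_quotient_continuous[of h "\<sigma> h"], of a b] by simp
  qed
  with lim show ?thesis by (rule Lim_transform_eventually)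
qed

theorem integrals_converge:
  assumes ab: "a < b" and F: "\<And>h. s h = \<sigma> \<bar>h\<bar>"
  shows "((\<lambda>h. integral {a..b} (\<lambda>x. \<bar>(g (x + h) - g x) / s h\<bar> powr p)) \<longlongrightarrow> c * (b - a)) (at 0)"
proof -
  let ?\<phi> = "\<lambda>h x. \<bar>inc h x / \<sigma> h\<bar> powr p"
  have sand: "((\<lambda>h. integral {\<alpha> h..\<beta> h} (?\<phi> h)) \<longlongrightarrow> c * (b - a)) (at_right 0)"
    if "(\<alpha> \<longlongrightarrow> a) (at_right 0)" "(\<beta> \<longlongrightarrow> b) (at_right 0)" for \<alpha> \<beta>
    by (rule integral_window_sandwich[OF quotient_continuous _ c integrals_converge_right that ab]) simp_all
  have pos: "eventually (\<lambda>h. 0 < h) (at_right (0 :: real))" by (rule eventually_at_right_less)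
  have right: "((\<lambda>h. integral {a..b} (\<lambda>x. \<bar>(g (x + h) - g x) / s h\<bar> powr p)) \<longlongrightarrow> c * (b - a)) (at_right 0)"
  proof (rule Lim_transform_eventually)
    show "((\<lambda>h. integral {a..b} (?\<phi> h)) \<longlongrightarrow> c * (b - a)) (at_right 0)"
      using sand[of "\<lambda>_. a" "\<lambda>_. b", OF tendsto_const tendsto_const] .
    show "eventually (\<lambda>h. integral {a..b} (?\<phi> h) = integral {a..b} (\<lambda>x. \<bar>(g (x + h) - g x) / s h\<bar> powr p)) (at_right 0)"
      using pos by eventually_elim (simp add: inc_def F)
  qed
  have left: "((\<lambda>h. integral {a..b} (\<lambda>x. \<bar>(g (x + - h) - g x) / s (- h)\<bar> powr p)) \<longlongrightarrow> c * (b - a)) (at_right 0)"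
  proof (rule Lim_transform_eventually)
    have "((\<lambda>h. a - h) \<longlongrightarrow> a - 0) (at_right 0)" "((\<lambda>h. b - h) \<longlongrightarrow> b - 0) (at_right 0)"
      by (intro tendsto_intros)+
    then show "((\<lambda>h. integral {a - h..b - h} (?\<phi> h)) \<longlongrightarrow> c * (b - a)) (at_right 0)"
      using sand[of "\<lambda>h. a - h" "\<lambda>h. b - h"] by simp
    show "eventually (\<lambda>h. integral {a - h..b - h} (?\<phi> h) = integral {a..b} (\<lambda>x. \<bar>(g (x + - h) - g x) / s (- h)\<bar> powr p)) (at_right 0)"
      using pos
    proof eventually_elim
      case (elim h)
      have "?\<phi> h \<circ> (+) (- h) = (\<lambda>x. \<bar>(g (x + - h) - g x) / s (- h)\<bar> powr p)"
      proof
        fix x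
        have "\<bar>inc h (- h + x)\<bar> = \<bar>g (x + - h) - g x\<bar>" using abs_minus_commute[of "g x" "g (x - h)"] by (simp add: inc_def)
        moreover have "s (- h) = \<sigma> h" using elim by (simp add: F)
        ultimately show "(?\<phi> h \<circ> (+) (- h)) x = \<bar>(g (x + - h) - g x) / s (- h)\<bar> powr p" by simp
      qed
      then show ?case using integral_shift_Icc_real[of a b "?\<phi> h" "- h"] by simp
    qed
  qed
  show ?thesis
  proof (rule filterlim_split_at)
    show "((\<lambda>h. integral {a..b} (\<lambda>x. \<bar>(g (x + h) - g x) / s h\<bar> powr p)) \<longlongrightarrow> c * (b - a)) (at_left 0)"
      using left filterlim_at_left_to_right[of "\<lambda>h. integral {a..b} (\<lambda>x. \<bar>(g (x + h) - g x) / s h\<bar> powr p)" "nhds (c * (b - a))" 0] by simp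
  qed (rule right)
qed

end

section \<open>The limit theorem\<close>

lemma inverse_ln_powr_steps:
  fixes hs :: "nat \<Rightarrow> real"
  assumes q: "0 < q" and hs: "\<And>n. 2 \<le> n \<Longrightarrow> hs n = 1 / ln (real n) powr q"
  shows "2 \<le> n \<Longrightarrow> 0 < hs n" "2 \<le> n \<Longrightarrow> hs (Suc n) \<le> hs n" "hs \<longlonglongrightarrow> 0"
proof -
  show "0 < hs n" if "2 \<le> n" using that hs[OF that] by simp
  show "hs (Suc n) \<le> hs n" if "2 \<le> n"
  proof -
    have l: "0 < ln (real n)" "ln (real n) \<le> ln (real (Suc n))" using that by simp_all
    then have "ln (real n) powr q \<le> ln (real (Suc n)) powr q" using q by (intro powr_mono2) auto
    then show ?thesis using that l hs[of n] hs[of "Suc n"] by (simp add: frac_le)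
  qed
  have "filterlim (\<lambda>n. ln (real n)) at_top sequentially"
    by (rule filterlim_compose[OF ln_at_top filterlim_real_sequentially])
  then have "(\<lambda>n. ln (real n) powr - q) \<longlonglongrightarrow> 0" using q by (intro tendsto_neg_powr) auto
  then show "hs \<longlonglongrightarrow> 0"
  proof (rule Lim_transform_eventually)
    show "eventually (\<lambda>n. ln (real n) powr - q = hs n) sequentially"
      using eventually_ge_at_top[of 2] by eventually_elim (simp add: hs powr_minus_divide)
  qed
qed

text \<open>Redefining the process as 0 on a null set makes all its paths continuous and changes neither the
finite-dimensional distributions nor the variances of the increments, so the probabilistic part applies to
the modification. It gives the hypothesis of the interpolation argument for almost every path.\<close>

theorem theorem2p2:
  fixes M :: "'a measure" and G :: "real \<Rightarrow> 'a \<Rightarrow> real"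
    and N :: "'b measure" and \<eta> :: "'b \<Rightarrow> real"
    and \<delta> p q :: real and hs :: "nat \<Rightarrow> real"
  assumes "prob_space M"
    and "gaussian_process M G" and "mean_zero M G"
    and "continuous_paths M G" and "stationary_increments M G"
    and "prob_space N" and "distributed N lborel \<eta> (normal_density 0 1)"
    and "0 < \<delta>"
    and "concave_on {0..\<delta>} (incr_var M G)"
    and "mono_on {0..\<delta>} (incr_var M G)"
    and "\<And>h. h \<in> {0<..\<delta>} \<Longrightarrow> 0 < incr_sd M G h"
    and "1 \<le> p" and "p < q"
    and "\<And>n. 2 \<le> n \<Longrightarrow> hs n = 1 / (ln (real n)) powr q"
    and "(\<lambda>n. incr_sd M G (hs n - hs (n + 1)) / incr_sd M G (hs (n + 1))) \<longlonglongrightarrow> 0"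
  shows "AE \<omega> in M. \<forall>a b. a < b \<longrightarrow>
           ((\<lambda>h. LBINT x:{a..b}. \<bar>(G (x + h) \<omega> - G x \<omega>) / incr_sd M G h\<bar> powr p)
              \<longlongrightarrow> (\<integral>w. \<bar>\<eta> w\<bar> powr p \<partial>N) * (b - a)) (at 0)"
proof -
  note hs = assms(14) and ratio = assms(15)
  interpret prob_space M by fact
  define f where "f = incr_var M G"
  have sd: "incr_sd M G h = sqrt (f h)" for h by (simp add: incr_sd_def f_def)
  have Gm[measurable]: "G x \<in> borel_measurable M" for x using gaussian_process_measurable[OF assms(2)] .
  obtain S where S: "S \<in> null_sets M" "{\<omega>\<in>space M. \<not> continuous_on UNIV (\<lambda>x. G x \<omega>)} \<subseteq> S"
    using assms(4) unfolding continuous_paths_def eventually_ae_filter by blast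
  define X where "X x \<omega> = (if \<omega> \<in> space M - S then G x \<omega> else 0)" for x \<omega>
  have good: "AE \<omega> in M. \<omega> \<in> space M - S" using AE_not_in[OF S(1)] AE_space by eventually_elim simp
  have XG: "AE \<omega> in M. \<forall>x. X x \<omega> = G x \<omega>" using good by eventually_elim (simp add: X_def)
  have S_sets: "S \<in> sets M" using S(1) by auto
  have Xm[measurable]: "X x \<in> borel_measurable M" for x
    unfolding X_def[abs_def] using S_sets by measurable
  interpret stationary_gaussian M X f \<delta>
  proof
    show "gaussian_process M X"
      unfolding gaussian_process_def
    proof (intro allI impI)
      fix I :: "real set" and c assume "finite I"
      then have "gaussian_rv M (\<lambda>\<omega>. \<Sum>x\<in>I. c x * G x \<omega>)" using assms(2) by (simp add: gaussian_process_def)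
      then show "gaussian_rv M (\<lambda>\<omega>. \<Sum>x\<in>I. c x * X x \<omega>)"
      proof (rule gaussian_rv_cong_AE)
        show "AE \<omega> in M. (\<Sum>x\<in>I. c x * G x \<omega>) = (\<Sum>x\<in>I. c x * X x \<omega>)" using XG by eventually_elim simp
      qed measurable
    qed
    show "mean_zero M X"
      unfolding mean_zero_def
    proof
      fix x
      have ae: "AE \<omega> in M. G x \<omega> = X x \<omega>" using XG by eventually_elim simp
      have "integrable M (G x)" "(\<integral>\<omega>. G x \<omega> \<partial>M) = 0" using assms(3) by (auto simp: mean_zero_def)
      then show "integrable M (X x) \<and> (\<integral>\<omega>. X x \<omega> \<partial>M) = 0"
        using integrable_cong_AE[OF Gm Xm ae] integral_cong_AE[OF Gm Xm ae] by simp
    qed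
    show "continuous_on UNIV (\<lambda>x. X x \<omega>)" for \<omega>
      using S(2) by (cases "\<omega> \<in> space M - S") (auto simp: X_def)
    show "(\<integral>\<omega>. (X (x + h) \<omega> - X x \<omega>)\<^sup>2 \<partial>M) = f h" for x h
    proof -
      have "(\<integral>\<omega>. (X (x + h) \<omega> - X x \<omega>)\<^sup>2 \<partial>M) = (\<integral>\<omega>. (G (x + h) \<omega> - G x \<omega>)\<^sup>2 \<partial>M)"
      proof (rule integral_cong_AE)
        show "AE \<omega> in M. (X (x + h) \<omega> - X x \<omega>)\<^sup>2 = (G (x + h) \<omega> - G x \<omega>)\<^sup>2" using XG by eventually_elim simp
      qed measurable
      also have "\<dots> = f h" unfolding f_def by (rule incr_var_eq[OF assms(2,5)])
      finally show ?thesis .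
    qed
    show "0 < f h" if "0 < h" "h \<le> \<delta>" for h using assms(11)[of h] that by (simp add: sd)
  qed (use assms in \<open>auto simp: f_def\<close>)
  have q: "0 < q" using assms by simp
  define c where "c = normal_abs_moment p"
  have c0: "0 \<le> c" by (simp add: c_def normal_abs_moment_def)
  have \<eta>: "(\<integral>w. \<bar>\<eta> w\<bar> powr p \<partial>N) = c"
  proof -
    have "(\<integral>w. \<bar>\<eta> w\<bar> powr p \<partial>N) = (\<integral>x. normal_density 0 1 x * \<bar>x\<bar> powr p \<partial>lborel)"
      by (rule distributed_integral[OF assms(7), symmetric]) auto
    also have "\<dots> = c" unfolding c_def normal_abs_moment_def by (subst integral_density) auto
    finally show ?thesis .
  qed
  have sampled: "AE \<omega> in M. \<forall>a\<in>\<rat>. \<forall>b\<in>\<rat>. a < b \<longrightarrow> (\<lambda>n. path_moment p a b (hs n) \<omega>) \<longlonglongrightarrow> c * (b - a)"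
    unfolding c_def by (rule rational_windows_convergence[OF assms(12,13) hs])
  show ?thesis
    using sampled XG
  proof eventually_elim
    case (elim \<omega>)
    interpret sampled_path "\<lambda>x. X x \<omega>" f \<delta> p c hs
    proof
      show "continuous_on UNIV (\<lambda>x. X x \<omega>)" by (rule cont)
      show "(\<lambda>n. integral {a..b} (\<lambda>x. \<bar>(X (x + hs n) \<omega> - X x \<omega>) / sqrt (f (hs n))\<bar> powr p)) \<longlonglongrightarrow> c * (b - a)"
        if "a \<in> \<rat>" "b \<in> \<rat>" "a < b" for a b
        using elim(1) that by (simp add: path_moment_def Y_def)
      show "(\<lambda>n. sqrt (f (hs n - hs (Suc n))) / sqrt (f (hs (Suc n)))) \<longlonglongrightarrow> 0"
        using ratio by (simp add: sd)
    qed (use \<delta> conc mono f_0 pos assms(12) c0 inverse_ln_powr_steps[OF q hs] in auto)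
    show ?case
    proof (intro allI impI)
      fix a b :: real assume ab: "a < b"
      have "((\<lambda>h. integral {a..b} (\<lambda>x. \<bar>(X (x + h) \<omega> - X x \<omega>) / incr_sd M G h\<bar> powr p)) \<longlongrightarrow> c * (b - a)) (at 0)"
      proof (rule integrals_converge[OF ab])
        show "incr_sd M G h = \<sigma> \<bar>h\<bar>" for h
          using f_minus[of h] by (cases "0 \<le> h") (simp_all add: sd \<sigma>_def)
      qed
      moreover have "integral {a..b} (\<lambda>x. \<bar>(X (x + h) \<omega> - X x \<omega>) / incr_sd M G h\<bar> powr p) =
          (LBINT x:{a..b}. \<bar>(G (x + h) \<omega> - G x \<omega>) / incr_sd M G h\<bar> powr p)" for h
      proof -
        have "continuous_on {a..b} (\<lambda>x. \<bar>(X (x + h) \<omega> - X x \<omega>) / incr_sd M G h\<bar> powr p)"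
          using abs_powr_continuous[OF assms(12) continuous_on_subset[OF inc_quotient_continuous[of h "incr_sd M G h"]], of "{a..b}"]
          by (simp add: inc_def)
        then have "set_integrable lborel {a..b} (\<lambda>x. \<bar>(X (x + h) \<omega> - X x \<omega>) / incr_sd M G h\<bar> powr p)"
          by (rule borel_integrable_atLeastAtMost')
        from set_borel_integral_eq_integral(2)[OF this] elim(2) show ?thesis by simp
      qed
      ultimately show "((\<lambda>h. LBINT x:{a..b}. \<bar>(G (x + h) \<omega> - G x \<omega>) / incr_sd M G h\<bar> powr p)
              \<longlongrightarrow> (\<integral>w. \<bar>\<eta> w\<bar> powr p \<partial>N) * (b - a)) (at 0)"
        by (simp add: \<eta>)
    qed
  qed
qed

end
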